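(* Let $N\ge 2$ be an even integer and let $T>0$. Then the system $\mathbf X(t)$, $t\in[0,T]$, of $N$ non-colliding Brownian motions all started from the origin and conditioned not to collide in the time interval $(0,T]$ is a pfaffian process, in the sense that every multi-time correlation function is a pfaffian. Precisely: for every integer $M\ge 1$, all times $0=t_0<t_1<t_2<\cdots<t_M<t_{M+1}=T$, all integers $N_1,\dots,N_{M+1}\in\{1,2,\dots,N\}$, all points $\mathbf x^{(\mu)}_{N_\mu}=(x^{(\mu)}_1,\dots,x^{(\mu)}_{N_\mu})\in\mathbb R^{N_\mu}$, $1\le\mu\le M+1$, and any choice of real polynomials $M_i(x)=b_i x^i+\cdots$ of degree exactly $i$ ($b_i\neq 0$), $i=0,1,\dots,N-1$, used to build the kernels below, one has $$ \rho_{N,T}\left(t_1,\{\mathbf x^{(1)}_{N_1}\};\,t_2,\{\mathbf x^{(2)}_{N_2}\};\dots;\,t_{M+1},\{\mathbf x^{(M+1)}_{N_{M+1}}\}\right)=\mathrm{Pf}\left[A\left(\mathbf x^{(1)}_{N_1},\mathbf x^{(2)}_{N_2},\dots,\mathbf x^{(M+1)}_{N_{M+1}}\right)\right], $$ where $\rho_{N,T}$ is the multi-time correlation function of $\mathbf X(t)$, and $A(\mathbf x^{(1)}_{N_1},\dots,\mathbf x^{(M+1)}_{N_{M+1}})$ is the antisymmetric matrix of size $2\sum_{\mu=1}^{M+1}N_\mu$ made of the $2\times2$ blocks $$ A^{\mu,\nu}\left(x^{(\mu)}_i,x^{(\nu)}_j\right),\quad 1\le i\le N_\mu,\ 1\le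 j\le N_\nu,\ 1\le\mu,\nu\le M+1,\qquad A^{\mu,\nu}(x,y)=\begin{pmatrix} D^{\mu,\nu}(x,y) & \widetilde S^{\nu,\mu}(y,x)\\ -\widetilde S^{\mu,\nu}(x,y) & -\widetilde I^{\mu,\nu}(x,y)\end{pmatrix}, $$ with block rows indexed by the pairs $(\mu,i)$ and block columns by the pairs $(\nu,j)$, both in the same order. The functions $\rho_{N,T}$, $D^{\mu,\nu}$, $\widetilde S^{\mu,\nu}$, $\widetilde I^{\mu,\nu}$ are defined in the context.
   Context: **The process.** Let $\mathbb R^N_<=\{\mathbf x\in\mathbb R^N: x_1<x_2<\cdots<x_N\}$ and let $p_t(x,y)=\frac{1}{\sqrt{2\pi t}}e^{-(x-y)^2/2t}$ be the heat kernel for $t>0$, with the convention $p_0(x,y)=\delta(x-y)$ (i.e. integration against $p_0(x,\cdot)$ is evaluation at $x$). Put $$f_N(t;\mathbf x,\mathbf y)=\det_{1\le i,j\le N}[p_t(x_i,y_j)],\qquad \mathcal N_N(t;\mathbf x)=\int_{\mathbb R^N_<}f_N(t;\mathbf x,\mathbf y)\,d\mathbf y,\quad \mathcal N_N(0;\mathbf x)=1,\qquad h_N(\mathbf x)=\prod_{1\le i<j\le N}(x_j-x_i).$$ The process $\mathbf X(t)=(X_1(t),\dots,X_N(t))$, $t\in[0,T]$, with $\mathbf X(0)=\mathbf 0$, is the temporally inhomogeneous Markov process on $\mathbb R^N_<$ (for $t>0$) with transition densities $$g_{N,T}(s,\mathbf x;t,\mathbf y)=\frac{f_N(t-s;\mathbf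 x,\mathbf y)\,\mathcal N_N(T-t;\mathbf y)}{\mathcal N_N(T-s;\mathbf x)},\quad 0<s<t\le T,$$ $$g_{N,T}(0,\mathbf 0;t,\mathbf y)=C(N,T,t)\,h_N(\mathbf y)\prod_{i=1}^N p_t(0,y_i)\;\mathcal N_N(T-t;\mathbf y),\quad C(N,T,t)=\frac{\pi^{N/2}}{\prod_{j=1}^N\Gamma(j/2)}\,T^{N(N-1)/4}\,t^{-N(N-1)/2}.$$ It is viewed as a process of unlabelled configurations $\{\mathbf X(t)\}$. **Multi-time density and correlation functions.** Given $0=t_0<t_1<\dots<t_M<t_{M+1}=T$, the multi-time density $\mathfrak g_{N,T}(0,\{0\};t_1,\{\mathbf x^{(1)}\};\dots;t_{M+1},\{\mathbf x^{(M+1)}\})$ is the product of the successive transition densities, regarded as a function of the unlabelled configurations (so it is symmetric in the coordinates of each $\mathbf x^{(\mu)}\in\mathbb R^N$, and vanishes if two coordinates of some $\mathbf x^{(\mu)}$ coincide). Explicitly, for $\mathbf x^{(\mu)}\in\mathbb R^N$, $$\mathfrak g_{N,T}=C(N,T,t_1)\,h_N(\mathbf x^{(1)})\,\mathrm{sgn}\big(h_N(\mathbf x^{(M+1)})\big)\prod_{i=1}^N p_{t_1}(0,x^{(1)}_i)\prod_{\mu=1}^M\det_{1\le i,j\le N}\left[p_{t_{\mu+1}-t_\mu}(x^{(\mu)}_i,x^{(\mu+1)}_j)\right].$$ With $\mathbf x^{(\mu)}_{N'}=(x^{(\mu)}_1,\dots,x^{(\mu)}_{N'})$, the multi-time correlation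 function is $$\rho_{N,T}\left(t_1,\{\mathbf x^{(1)}_{N_1}\};\dots;t_{M+1},\{\mathbf x^{(M+1)}_{N_{M+1}}\}\right)=\int_{\prod_{\mu=1}^{M+1}\mathbb R^{N-N_\mu}}\prod_{\mu=1}^{M+1}\frac{1}{(N-N_\mu)!}\prod_{i=N_\mu+1}^N dx^{(\mu)}_i\;\;\mathfrak g_{N,T}\left(0,\{0\};t_1,\{\mathbf x^{(1)}_N\};\dots;t_{M+1},\{\mathbf x^{(M+1)}_N\}\right).$$ **Kernels.** Fix real polynomials $M_i(x)=b_ix^i+\cdots$ with $b_i\ne0$, $0\le i\le N-1$. Use $\mathrm{sgn}(0)=0$. For $1\le i\le N$, $1\le\mu\le M+1$, $x\in\mathbb R$, set $$\phi_i^{(\mu)}(x)=\int_{\mathbb R}dy\,M_{i-1}(y)\,p_{t_1}(0,y)\,p_{t_\mu-t_1}(y,x)$$ (so $\phi_i^{(1)}(x)=M_{i-1}(x)p_{t_1}(0,x)$), $$\psi_i^{(\mu)}(x)=\int_{\mathbb R}dz\int_{\mathbb R}dw\;p_{T-t_\mu}(x,z)\,\mathrm{sgn}(w-z)\,\phi_i^{(M+1)}(w)$$ (so $\psi_i^{(M+1)}(x)=\int\mathrm{sgn}(w-x)\phi_i^{(M+1)}(w)\,dw$). Let $A_0$ be the antisymmetric $N\times N$ matrix $$(A_0)_{ij}=\int_{\mathbb R}dy\int_{\mathbb R}d\tilde y\;\mathrm{sgn}(\tilde y-y)\,\phi_i^{(M+1)}(y)\,\phi_j^{(M+1)}(\tilde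 y),\qquad 1\le i,j\le N,$$ which is invertible. For $1\le\mu,\nu\le M+1$ and $x,y\in\mathbb R$ define $$D^{\mu,\nu}(x,y)=-\sum_{i,j=1}^N\phi_i^{(\mu)}(x)\,(A_0^{-1})_{ij}\,\phi_j^{(\nu)}(y),$$ $$S^{\mu,\nu}(x,y)=\sum_{i,j=1}^N\psi_i^{(\mu)}(x)\,(A_0^{-1})_{ij}\,\phi_j^{(\nu)}(y),$$ $$I^{\mu,\nu}(x,y)=\sum_{i,j=1}^N\psi_i^{(\mu)}(x)\,(A_0^{-1})_{ij}\,\psi_j^{(\nu)}(y),$$ $$\widetilde S^{\mu,\nu}(x,y)=S^{\mu,\nu}(x,y)-\mathbf 1_{(\mu<\nu)}\,p_{t_\nu-t_\mu}(x,y),$$ $$\widetilde I^{\mu,\nu}(x,y)=I^{\mu,\nu}(x,y)+\int_{\mathbb R}dz\int_{\mathbb R}dw\;p_{T-t_\mu}(x,z)\,\mathrm{sgn}(w-z)\,p_{T-t_\nu}(w,y)$$ (for $\mu=\nu=M+1$ the last double integral equals $\mathrm{sgn}(y-x)$). **Pfaffian.** For an antisymmetric $2n\times2n$ matrix $(a_{ij})$, $$\mathrm{Pf}(a_{ij})=\frac1{n!}\sum_\sigma\mathrm{sgn}(\sigma)\,a_{\sigma(1)\sigma(2)}a_{\sigma(3)\sigma(4)}\cdots a_{\sigma(2n-1)\sigma(2n)},$$ the sum being over permutations $\sigma$ of $\{1,\dots,2n\}$ with $\sigma(2k-1)<\sigma(2k)$ for $k=1,\dots,n$. *)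

theory Defs
  imports
    "HOL-Analysis.Analysis"
    "HOL-Combinatorics.Permutations"
    "Jordan_Normal_Form.Determinant"
    "Jordan_Normal_Form.Gauss_Jordan_Elimination"
begin

text \<open>
  Conventions. A vector in \<open>\<real>\<^sup>N\<close> is a function \<open>x :: nat \<Rightarrow> real\<close> of which only the values at the
  indices \<open>0, \<dots>, N - 1\<close> matter; coordinates, matrix entries and the functions \<open>\<phi>\<close>, \<open>\<psi>\<close> are
  therefore indexed from 0, so that \<open>\<phi>\<close> with index \<open>i\<close> is built from the polynomial of degree \<open>i\<close>.
  Times \<open>t \<mu>\<close> are indexed by \<open>\<mu> = 0, \<dots>, M + 1\<close>, with \<open>t 0 = 0\<close> and \<open>t (M + 1) = T\<close>, and
  \<open>x \<mu>\<close> is the configuration at time \<open>t \<mu>\<close> for \<open>1 \<le> \<mu> \<le> M + 1\<close>.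
\<close>

section \<open>The process and its correlation functions\<close>

definition heat_kernel :: "real \<Rightarrow> real \<Rightarrow> real \<Rightarrow> real" where
  "heat_kernel t x y = exp (- ((x - y)\<^sup>2 / (2 * t))) / sqrt (2 * pi * t)"

definition karlin_mcgregor :: "nat \<Rightarrow> real \<Rightarrow> (nat \<Rightarrow> real) \<Rightarrow> (nat \<Rightarrow> real) \<Rightarrow> real" where
  "karlin_mcgregor N t x y = Determinant.det (mat N N (\<lambda>(i, j). heat_kernel t (x i) (y j)))"

definition ordered_configs :: "nat \<Rightarrow> (nat \<Rightarrow> real) set" where
  "ordered_configs N = {y \<in> {..<N} \<rightarrow>\<^sub>E UNIV. strict_mono_on {..<N} y}"

definition noncolliding_prob :: "nat \<Rightarrow> real \<Rightarrow> (nat \<Rightarrow> real) \<Rightarrow> real" where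
  "noncolliding_prob N t x =
     (if t = 0 then 1
      else (LINT y : ordered_configs N | PiM {..<N} (\<lambda>_. lborel). karlin_mcgregor N t x y))"

definition vandermonde :: "nat \<Rightarrow> (nat \<Rightarrow> real) \<Rightarrow> real" where
  "vandermonde N x = (\<Prod>j<N. \<Prod>i<j. x j - x i)"

definition transition_density ::
    "nat \<Rightarrow> real \<Rightarrow> real \<Rightarrow> (nat \<Rightarrow> real) \<Rightarrow> real \<Rightarrow> (nat \<Rightarrow> real) \<Rightarrow> real" where
  "transition_density N T s x t y =
     karlin_mcgregor N (t - s) x y * noncolliding_prob N (T - t) y / noncolliding_prob N (T - s) x"

definition entrance_const :: "nat \<Rightarrow> real \<Rightarrow> real \<Rightarrow> real" where
  "entrance_const N T t =
     pi powr (real N / 2) / (\<Prod>j=1..N. Gamma (real j / 2))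
       * T powr (real N * (real N - 1) / 4) * t powr (- (real N * (real N - 1) / 2))"

text \<open>The density at time \<open>t > 0\<close> of the process started from the origin at time 0.\<close>

definition entrance_density :: "nat \<Rightarrow> real \<Rightarrow> real \<Rightarrow> (nat \<Rightarrow> real) \<Rightarrow> real" where
  "entrance_density N T t y =
     entrance_const N T t * vandermonde N y * (\<Prod>i<N. heat_kernel t 0 (y i))
       * noncolliding_prob N (T - t) y"

text \<open>The increasing rearrangement of the first \<open>N\<close> coordinates: it picks the labelled
  representative of the unlabelled configuration \<open>{x 0, \<dots>, x (N - 1)}\<close>.\<close>

definition rearrange :: "nat \<Rightarrow> (nat \<Rightarrow> real) \<Rightarrow> nat \<Rightarrow> real" where
  "rearrange N x = (\<lambda>i. sort (map x [0..<N]) ! i)"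

definition multi_time_density ::
    "nat \<Rightarrow> real \<Rightarrow> nat \<Rightarrow> (nat \<Rightarrow> real) \<Rightarrow> (nat \<Rightarrow> nat \<Rightarrow> real) \<Rightarrow> real" where
  "multi_time_density N T M t x =
     (if \<forall>\<mu>\<in>{1..M+1}. inj_on (x \<mu>) {..<N}
      then entrance_density N T (t 1) (rearrange N (x 1))
        * (\<Prod>\<mu>=1..M. transition_density N T (t \<mu>) (rearrange N (x \<mu>))
                        (t (\<mu> + 1)) (rearrange N (x (\<mu> + 1))))
      else 0)"

text \<open>Only the first \<open>n \<mu>\<close> coordinates of \<open>x \<mu>\<close> are used; the remaining \<open>N - n \<mu>\<close> ones are
  integrated out, \<open>z (\<mu>, i)\<close> being the integration variable for coordinate \<open>i\<close> at time \<open>t \<mu>\<close>.\<close>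

definition correlation_function ::
    "nat \<Rightarrow> real \<Rightarrow> nat \<Rightarrow> (nat \<Rightarrow> real) \<Rightarrow> (nat \<Rightarrow> nat) \<Rightarrow> (nat \<Rightarrow> nat \<Rightarrow> real) \<Rightarrow> real" where
  "correlation_function N T M t n x =
     (LINT z | PiM (SIGMA \<mu>:{1..M+1}. {n \<mu>..<N}) (\<lambda>_. lborel).
        (\<Prod>\<mu>=1..M+1. 1 / fact (N - n \<mu>))
        * multi_time_density N T M t (\<lambda>\<mu> i. if i < n \<mu> then x \<mu> i else z (\<mu>, i)))"

section \<open>The kernels\<close>

text \<open>Integration of \<open>F\<close> against \<open>heat_kernel t x\<close>, which for \<open>t = 0\<close> is the unit mass at \<open>x\<close>. Since
  the heat kernel is symmetric, this also covers integration against \<open>\<lambda>y. heat_kernel t y x\<close>.\<close>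

definition heat_integral :: "real \<Rightarrow> real \<Rightarrow> (real \<Rightarrow> real) \<Rightarrow> real" where
  "heat_integral t x F = (if t = 0 then F x else (LINT y | lborel. heat_kernel t x y * F y))"

text \<open>In the following definitions \<open>P i\<close> are the polynomials, and the final time \<open>T\<close> is
  \<open>t (M + 1)\<close>.\<close>

definition phi ::
    "(nat \<Rightarrow> real poly) \<Rightarrow> (nat \<Rightarrow> real) \<Rightarrow> nat \<Rightarrow> nat \<Rightarrow> real \<Rightarrow> real" where
  "phi P t i \<mu> x = heat_integral (t \<mu> - t 1) x (\<lambda>y. poly (P i) y * heat_kernel (t 1) 0 y)"

definition psi ::
    "nat \<Rightarrow> (nat \<Rightarrow> real poly) \<Rightarrow> (nat \<Rightarrow> real) \<Rightarrow> nat \<Rightarrow> nat \<Rightarrow> real \<Rightarrow> real" where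
  "psi M P t i \<mu> x =
     heat_integral (t (M + 1) - t \<mu>) x
       (\<lambda>z. LINT w | lborel. sgn (w - z) * phi P t i (M + 1) w)"

definition A0 :: "nat \<Rightarrow> nat \<Rightarrow> (nat \<Rightarrow> real poly) \<Rightarrow> (nat \<Rightarrow> real) \<Rightarrow> real mat" where
  "A0 N M P t = mat N N (\<lambda>(i, j).
     LINT y | lborel. LINT y' | lborel.
       sgn (y' - y) * phi P t i (M + 1) y * phi P t j (M + 1) y')"

definition A0_inv :: "nat \<Rightarrow> nat \<Rightarrow> (nat \<Rightarrow> real poly) \<Rightarrow> (nat \<Rightarrow> real) \<Rightarrow> real mat" where
  "A0_inv N M P t = the (mat_inverse (A0 N M P t))"

definition D_kernel ::
    "nat \<Rightarrow> nat \<Rightarrow> (nat \<Rightarrow> real poly) \<Rightarrow> (nat \<Rightarrow> real) \<Rightarrow> nat \<Rightarrow> nat \<Rightarrow> real \<Rightarrow> real \<Rightarrow> real" where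
  "D_kernel N M P t \<mu> \<nu> x y =
     - (\<Sum>i<N. \<Sum>j<N. phi P t i \<mu> x * A0_inv N M P t $$ (i, j) * phi P t j \<nu> y)"

definition S_kernel ::
    "nat \<Rightarrow> nat \<Rightarrow> (nat \<Rightarrow> real poly) \<Rightarrow> (nat \<Rightarrow> real) \<Rightarrow> nat \<Rightarrow> nat \<Rightarrow> real \<Rightarrow> real \<Rightarrow> real" where
  "S_kernel N M P t \<mu> \<nu> x y =
     (\<Sum>i<N. \<Sum>j<N. psi M P t i \<mu> x * A0_inv N M P t $$ (i, j) * phi P t j \<nu> y)"

definition I_kernel ::
    "nat \<Rightarrow> nat \<Rightarrow> (nat \<Rightarrow> real poly) \<Rightarrow> (nat \<Rightarrow> real) \<Rightarrow> nat \<Rightarrow> nat \<Rightarrow> real \<Rightarrow> real \<Rightarrow> real" where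
  "I_kernel N M P t \<mu> \<nu> x y =
     (\<Sum>i<N. \<Sum>j<N. psi M P t i \<mu> x * A0_inv N M P t $$ (i, j) * psi M P t j \<nu> y)"

definition S_tilde ::
    "nat \<Rightarrow> nat \<Rightarrow> (nat \<Rightarrow> real poly) \<Rightarrow> (nat \<Rightarrow> real) \<Rightarrow> nat \<Rightarrow> nat \<Rightarrow> real \<Rightarrow> real \<Rightarrow> real" where
  "S_tilde N M P t \<mu> \<nu> x y =
     S_kernel N M P t \<mu> \<nu> x y - (if \<mu> < \<nu> then heat_kernel (t \<nu> - t \<mu>) x y else 0)"

definition I_tilde ::
    "nat \<Rightarrow> nat \<Rightarrow> (nat \<Rightarrow> real poly) \<Rightarrow> (nat \<Rightarrow> real) \<Rightarrow> nat \<Rightarrow> nat \<Rightarrow> real \<Rightarrow> real \<Rightarrow> real" where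
  "I_tilde N M P t \<mu> \<nu> x y =
     I_kernel N M P t \<mu> \<nu> x y
     + heat_integral (t (M + 1) - t \<mu>) x
         (\<lambda>z. heat_integral (t (M + 1) - t \<nu>) y (\<lambda>w. sgn (w - z)))"

section \<open>The pfaffian\<close>

definition pfaffian :: "real mat \<Rightarrow> real" where
  "pfaffian A = (let n = dim_row A div 2 in
     1 / fact n *
       (\<Sum>\<sigma> | \<sigma> permutes {..<2 * n} \<and> (\<forall>k<n. \<sigma> (2 * k) < \<sigma> (2 * k + 1)).
          of_int (sign \<sigma>) * (\<Prod>k<n. A $$ (\<sigma> (2 * k), \<sigma> (2 * k + 1)))))"

definition A_block ::
    "nat \<Rightarrow> nat \<Rightarrow> (nat \<Rightarrow> real poly) \<Rightarrow> (nat \<Rightarrow> real) \<Rightarrow> nat \<Rightarrow> nat \<Rightarrow> real \<Rightarrow> real \<Rightarrow> real mat" where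
  "A_block N M P t \<mu> \<nu> x y = mat_of_rows_list 2
     [[D_kernel N M P t \<mu> \<nu> x y, S_tilde N M P t \<nu> \<mu> y x],
      [- S_tilde N M P t \<mu> \<nu> x y, - I_tilde N M P t \<mu> \<nu> x y]]"

text \<open>The pairs \<open>(\<mu>, i)\<close>, in lexicographic order, that index the block rows and block columns.\<close>

definition block_indices :: "nat \<Rightarrow> (nat \<Rightarrow> nat) \<Rightarrow> (nat \<times> nat) list" where
  "block_indices M n = [(\<mu>, i). \<mu> \<leftarrow> [1..<M + 2], i \<leftarrow> [0..<n \<mu>]]"

definition A_matrix ::
    "nat \<Rightarrow> nat \<Rightarrow> (nat \<Rightarrow> real poly) \<Rightarrow> (nat \<Rightarrow> real) \<Rightarrow> (nat \<Rightarrow> nat) \<Rightarrow> (nat \<Rightarrow> nat \<Rightarrow> real) \<Rightarrow> real mat"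
  where
  "A_matrix N M P t n x =
     (let L = (\<Sum>\<mu>=1..M+1. n \<mu>) in
      mat (2 * L) (2 * L) (\<lambda>(a, b).
        let (\<mu>, i) = block_indices M n ! (a div 2);
            (\<nu>, j) = block_indices M n ! (b div 2)
        in A_block N M P t \<mu> \<nu> (x \<mu> i) (x \<nu> j) $$ (a mod 2, b mod 2)))"

end

theory Submission
  imports Defs "HOL-Probability.Distributions" "HOL-Combinatorics.Multiset_Permutations"
begin

text \<open>
  To every point \<open>x\<close> at time \<open>t \<mu>\<close> we attach two indices: \<open>Pt\<close> stands for the particle flowing on
  from \<open>x\<close>, paired with another such index by running both to the final time and integrating the sign of
  the difference; \<open>One\<close> stands for evaluation at \<open>x\<close> and pairs with everything at earlier times through
  the heat kernel or the functions \<open>phi\<close>. Together with one index for each \<open>phi\<close> this defines one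
  antisymmetric form. Expanding its pfaffian along the \<open>One\<close> indices, level by level, produces the
  determinants of heat kernels and finally the pfaffian of signs, which is the sign of the
  Vandermonde product; so with \<open>N\<close> points at each time it is the multi-time density up to a constant.

  By the semigroup property, integrating over a point reproduces a pairing exactly when it goes from
  earlier to later times. A count of the pairings that are lost shows that the integral over one
  of \<open>k\<close> points at some time is \<open>N - k + 1\<close> times the pfaffian without that point. Iterating gives
  the correlation functions as pfaffians that still contain the \<open>phi\<close> indices, and the Schur complement
  with respect to \<open>A0\<close> removes these. The constant is fixed by evaluating the pfaffian of \<open>A0\<close> with
  skew-orthogonal Hermite polynomials.

  To read the density off the transition densities one needs that the probability of
  non-collision does not vanish, which follows from the total positivity of \<open>exp (x * y)\<close>.
\<close>

section \<open>Pfaffians over finite index sets\<close>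

text \<open>The usual rule for integrating pfaffian kernels asks the kernel to reproduce itself
  under every integration, and \<open>S_tilde\<close> fails this because of the heat kernel it
  subtracts. With the functions \<open>phi\<close> kept as indices, no inverse matrix enters, and
  every failure becomes an exact zero: \<open>One \<mu> k\<close> pairs only with \<open>phi\<close>
  and with \<open>Pt\<close> at strictly earlier times, and \<open>Pt \<mu> k\<close> does not pair
  with \<open>One\<close> at times up to \<mu>. When a point at time \<mu> is integrated out, each
  earlier point accounts for one pairing that survives through its \<open>Pt\<close> and one that is
  lost through its \<open>One\<close>. The earlier times therefore cancel in the count, and only the
  N functions \<open>phi\<close> and the other points at time \<mu> remain.

  The probabilities of non-collision are never computed: they telescope, and only the division by
  them has to be justified. The pfaffian of \<open>A0\<close>, found in order to fix the constant,
  also shows that \<open>A0\<close> is invertible, so that \<open>A0_inv\<close> is a genuine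
  inverse. Its evaluation rests on the sign kernel being, up to a factor, inverse to
  differentiation.\<close>

lemma sum_offdiag_swap:
  fixes g :: "'i \<Rightarrow> 'i \<Rightarrow> 'b::comm_monoid_add"
  assumes "finite A"
  shows "(\<Sum>q\<in>A. \<Sum>r\<in>A - {q}. g q r) = (\<Sum>r\<in>A. \<Sum>q\<in>A - {r}. g q r)"
proof -
  have *: "A - {q} = {r\<in>A. r \<noteq> q}" for q by auto
  have **: "{r\<in>A. r \<noteq> q} = {r\<in>A. q \<noteq> r}" for q by auto
  show ?thesis unfolding * by (subst sum.swap_restrict[OF assms assms]) (simp add: **)
qed

text \<open>No order on the index set is needed: signs are taken from an arbitrary function \<open>e\<close> with
  \<open>e q p = - e p q = \<plusminus> 1\<close> for \<open>p \<noteq> q\<close>. The choice of the row \<open>m\<close> below is immaterial by \<open>pf_expand\<close>.\<close>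

definition psgn :: "('i \<Rightarrow> 'i \<Rightarrow> real) \<Rightarrow> 'i set \<Rightarrow> 'i \<Rightarrow> 'i \<Rightarrow> real" where
  "psgn e S p q = e p q * (\<Prod>s\<in>S - {p, q}. e p s * e q s)"

primrec pfn :: "('i \<Rightarrow> 'i \<Rightarrow> real) \<Rightarrow> ('i \<Rightarrow> 'i \<Rightarrow> real) \<Rightarrow> nat \<Rightarrow> 'i set \<Rightarrow> real" where
  "pfn e a 0 S = 1"
| "pfn e a (Suc n) S =
     (let m = (SOME m. m \<in> S) in \<Sum>q\<in>S - {m}. psgn e S m q * a m q * pfn e a n (S - {m, q}))"

text \<open>The counter is the number of pairs still to be matched. On sets of odd size the value
  has no meaning, hence the parity hypotheses below.\<close>

definition pf :: "('i \<Rightarrow> 'i \<Rightarrow> real) \<Rightarrow> ('i \<Rightarrow> 'i \<Rightarrow> real) \<Rightarrow> 'i set \<Rightarrow> real" where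
  "pf e a S = pfn e a (card S div 2) S"

text \<open>The diagonal is exempt: an expansion never pairs an index with itself, and sign
  functions leave it unspecified as well.\<close>

definition skew_on :: "'i set \<Rightarrow> ('i \<Rightarrow> 'i \<Rightarrow> real) \<Rightarrow> bool" where
  "skew_on S a \<longleftrightarrow> (\<forall>p\<in>S. \<forall>q\<in>S. p \<noteq> q \<longrightarrow> a q p = - a p q)"

lemma skew_onD: "skew_on S a \<Longrightarrow> p \<in> S \<Longrightarrow> q \<in> S \<Longrightarrow> p \<noteq> q \<Longrightarrow> a q p = - a p q"
  unfolding skew_on_def by blast

lemma skew_on_subset: "skew_on S a \<Longrightarrow> R \<subseteq> S \<Longrightarrow> skew_on R a"
  unfolding skew_on_def by blast

lemma skew_onI: "(\<And>p q. p \<in> S \<Longrightarrow> q \<in> S \<Longrightarrow> p \<noteq> q \<Longrightarrow> a q p = - a p q) \<Longrightarrow> skew_on S a"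
  unfolding skew_on_def by blast

lemma pf_empty [simp]: "pf e a {} = 1" by (simp add: pf_def)

lemma card_minus_two:
  assumes "finite S" "p \<in> S" "q \<in> S" "p \<noteq> q"
  shows "card (S - {p, q}) = card S - 2"
proof -
  have "S - {p,q} = S - {p} - {q}" by auto
  then show ?thesis using assms by simp
qed

lemma pf_unfold:
  assumes "finite S" "even (card S)" "S \<noteq> {}"
  shows "\<exists>m\<in>S. pf e a S = (\<Sum>q\<in>S - {m}. psgn e S m q * a m q * pf e a (S - {m, q}))"
proof -
  let ?m = "SOME m. m \<in> S"
  have m: "?m \<in> S" using assms(3) some_in_eq by blast
  have c: "card S \<noteq> 0" using assms by auto
  then obtain k where k: "card S = 2 * Suc k" using assms(2) by (metis evenE mult_0_right not0_implies_Suc)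
  have "pf e a S = (\<Sum>q\<in>S - {?m}. psgn e S ?m q * a ?m q * pfn e a k (S - {?m, q}))"
    by (simp add: pf_def k Let_def)
  also have "\<dots> = (\<Sum>q\<in>S - {?m}. psgn e S ?m q * a ?m q * pf e a (S - {?m, q}))"
    by (rule sum.cong) (use m k in \<open>auto simp: pf_def card_minus_two assms\<close>)
  finally show ?thesis using m by blast
qed

locale sign_function =
  fixes e :: "'i \<Rightarrow> 'i \<Rightarrow> real"
  assumes e_anti: "p \<noteq> q \<Longrightarrow> e q p = - e p q" and e_sq: "p \<noteq> q \<Longrightarrow> e p q * e p q = 1"
begin

lemma psgn_anti:
  assumes "p \<noteq> q"
  shows "psgn e S q p = - psgn e S p q"
proof -
  have "(\<Prod>s\<in>S - {q, p}. e q s * e p s) = (\<Prod>s\<in>S - {p, q}. e p s * e q s)"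
    by (rule prod.cong) (auto simp: mult.commute)
  then show ?thesis unfolding psgn_def e_anti[OF assms] by simp
qed

lemma psgn_remove:
  assumes "finite S" "distinct [m, q, p, r]" "{m,q,p,r} \<subseteq> S"
  shows "psgn e S m q = e m p * e q p * (e m r * e q r) * psgn e (S - {p, r}) m q"
proof -
  have "S - {m,q} = insert p (insert r (S - {p,r} - {m,q}))" using assms by auto
  then have "(\<Prod>s\<in>S - {m,q}. e m s * e q s)
     = e m p * e q p * (e m r * e q r) * (\<Prod>s\<in>S - {p,r} - {m,q}. e m s * e q s)"
    using assms by (simp add: mult.assoc)
  then show ?thesis by (simp add: psgn_def)
qed

text \<open>Two disjoint pairs can be removed in either order because the four mixed factors between
  them all change sign, and four minus signs cancel.\<close>

lemma psgn_commute:
  assumes "finite S" "distinct [m, q, p, r]" "{m,q,p,r} \<subseteq> S"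
  shows "psgn e S m q * psgn e (S - {m, q}) p r = psgn e S p r * psgn e (S - {p, r}) m q"
proof -
  have 1: "psgn e S m q = e m p * e q p * (e m r * e q r) * psgn e (S - {p, r}) m q"
    by (rule psgn_remove) fact+
  have 2: "psgn e S p r = e p m * e r m * (e p q * e r q) * psgn e (S - {m, q}) p r"
    by (rule psgn_remove) (use assms in auto)
  have "e p m = - e m p" "e r m = - e m r" "e p q = - e q p" "e r q = - e q r"
    using assms(2) by (auto intro: e_anti)
  then show ?thesis unfolding 1 2 by simp
qed

text \<open>The recursion expands along a chosen row \<open>m\<close>. Expanding the smaller
  pfaffians along \<open>p\<close> by induction gives a double sum that \<open>psgn_commute\<close>
  makes symmetric in the two rows, so it can be read as an expansion along \<open>p\<close>
  first.\<close>

theorem pf_expand: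
  assumes "finite S" "even (card S)" "skew_on S a" "p \<in> S"
  shows "pf e a S = (\<Sum>q\<in>S - {p}. psgn e S p q * a p q * pf e a (S - {p, q}))"
  using assms
proof (induction "card S" arbitrary: S p rule: less_induct)
  case less
  obtain m where m: "m \<in> S"
    and pfm: "pf e a S = (\<Sum>q\<in>S - {m}. psgn e S m q * a m q * pf e a (S - {m, q}))"
    using pf_unfold[of S e a] less.prems by blast
  show ?case
  proof (cases "m = p")
    case True
    then show ?thesis using pfm by simp
  next
    case False
    let ?A = "S - {m, p}"
    have IH: "pf e a (S - {x, q}) = (\<Sum>r\<in>?A - {q}. psgn e (S - {x, q}) y r * a y r * pf e a (S - {x, q} - {y, r}))"
      if "{x, y} = {m, p}" "q \<in> ?A" for x y q
    proof -
      have xy: "x \<noteq> y" "x \<in> S" "y \<in> S" "q \<noteq> x" "q \<noteq> y" "q \<in> S"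
        using that m less.prems False by (auto simp: doubleton_eq_iff)
      have c: "card (S - {x, q}) = card S - 2" using xy less.prems by (intro card_minus_two) auto
      have "card S \<noteq> 0" using m less.prems by auto
      then have less: "card (S - {x,q}) < card S" using c by linarith
      have ev: "even (card (S - {x,q}))" unfolding c using less.prems(2) by simp
      have "finite (S - {x,q})" "y \<in> S - {x,q}" using less.prems(1) xy by auto
      note less.hyps[OF less this(1) ev skew_on_subset[OF less.prems(3)] this(2)]
      then have "pf e a (S - {x, q}) = (\<Sum>r\<in>S - {x, q} - {y}. psgn e (S - {x, q}) y r * a y r * pf e a (S - {x, q} - {y, r}))"
        by blast
      moreover have "S - {x, q} - {y} = ?A - {q}" using that(1) by auto
      ultimately show ?thesis by simp
    qed
    define g where "g q r = psgn e S m q * a m q * (psgn e (S - {m, q}) p r * a p r * pf e a (S - {m, q} - {p, r}))" for q r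
    have "pf e a S = psgn e S m p * a m p * pf e a (S - {m, p})
        + (\<Sum>q\<in>?A. psgn e S m q * a m q * pf e a (S - {m, q}))"
      unfolding pfm using less.prems False
      by (subst sum.remove[of _ p]) (auto intro!: sum.cong)
    also have "(\<Sum>q\<in>?A. psgn e S m q * a m q * pf e a (S - {m, q})) = (\<Sum>q\<in>?A. \<Sum>r\<in>?A - {q}. g q r)"
      by (rule sum.cong) (simp_all add: IH[of m p] g_def sum_distrib_left)
    also have "\<dots> = (\<Sum>r\<in>?A. \<Sum>q\<in>?A - {r}. g q r)"
      using less.prems by (intro sum_offdiag_swap) auto
    also have "\<dots> = (\<Sum>r\<in>?A. psgn e S p r * a p r * pf e a (S - {p, r}))"
    proof (rule sum.cong)
      fix r assume r: "r \<in> ?A"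
      have "g q r = psgn e S p r * a p r * (psgn e (S - {p, r}) m q * a m q * pf e a (S - {p, r} - {m, q}))"
        if "q \<in> ?A - {r}" for q
      proof -
        have "psgn e S m q * psgn e (S - {m, q}) p r = psgn e S p r * psgn e (S - {p, r}) m q"
          by (rule psgn_commute[OF less.prems(1)]) (use r that False m less.prems(4) in auto)
        moreover have "S - {m, q} - {p, r} = S - {p, r} - {m, q}" by auto
        ultimately show ?thesis unfolding g_def by (simp add: algebra_simps)
      qed
      then show "(\<Sum>q\<in>?A - {r}. g q r) = psgn e S p r * a p r * pf e a (S - {p, r})"
        using r by (simp add: IH[of p m] insert_commute sum_distrib_left)
    qed simp
    \<comment> \<open>The term that pairs \<open>m\<close> with \<open>p\<close> stays outside the
      double sum; reversing the pair changes the sign of both \<open>psgn\<close> and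
      \<open>a\<close>.\<close>
    also have "psgn e S m p * a m p * pf e a (S - {m, p}) = psgn e S p m * a p m * pf e a (S - {p, m})"
      using skew_onD[OF less.prems(3), of m p] psgn_anti[of m p S] False m less.prems
      by (simp add: insert_commute)
    also have "\<dots> + (\<Sum>r\<in>?A. psgn e S p r * a p r * pf e a (S - {p, r}))
       = (\<Sum>r\<in>S - {p}. psgn e S p r * a p r * pf e a (S - {p, r}))"
      using less.prems False m by (subst (2) sum.remove[of _ m]) (auto intro!: sum.cong)
    finally show ?thesis .
  qed
qed

text \<open>For arguments that act on the partners of \<open>p\<close> and \<open>q\<close>
  simultaneously: exchanging them in \<open>pf_equal_rows\<close>, integrating over a product of
  both entries in \<open>pf_integrate_out\<close>.\<close>

lemma pf_expand2:
  assumes "finite S" "even (card S)" "skew_on S a" "p \<in> S" "q \<in> S" "p \<noteq> q"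
  shows "pf e a S = psgn e S p q * a p q * pf e a (S - {p, q})
    + (\<Sum>r\<in>S - {p, q}. \<Sum>s\<in>S - {p, q} - {r}. psgn e S p r * psgn e (S - {p, r}) q s * a p r * a q s * pf e a (S - {p, q} - {r, s}))"
proof -
  have *: "pf e a (S - {p, r}) = (\<Sum>s\<in>S - {p, q} - {r}. psgn e (S - {p, r}) q s * a q s * pf e a (S - {p, q} - {r, s}))"
    if "r \<in> S - {p, q}" for r
  proof -
    have c: "card (S - {p, r}) = card S - 2" using that assms by (intro card_minus_two) auto
    have "pf e a (S - {p, r}) = (\<Sum>s\<in>S - {p, r} - {q}. psgn e (S - {p, r}) q s * a q s * pf e a (S - {p, r} - {q, s}))"
      by (rule pf_expand[OF _ _ skew_on_subset[OF assms(3)]]) (use c assms(1,2,4-6) that in auto)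
    moreover have "S - {p, r} - {q} = S - {p, q} - {r}" by auto
    moreover have "S - {p, r} - {q, s} = S - {p, q} - {r, s}" for s by auto
    ultimately show ?thesis by simp
  qed
  have "pf e a S = (\<Sum>r\<in>S - {p}. psgn e S p r * a p r * pf e a (S - {p, r}))"
    by (rule pf_expand) fact+
  also have "\<dots> = psgn e S p q * a p q * pf e a (S - {p, q}) + (\<Sum>r\<in>S - {p, q}. psgn e S p r * a p r * pf e a (S - {p, r}))"
    using assms by (subst sum.remove[of _ q]) (auto intro!: sum.cong)
  also have "(\<Sum>r\<in>S - {p, q}. psgn e S p r * a p r * pf e a (S - {p, r}))
    = (\<Sum>r\<in>S - {p, q}. \<Sum>s\<in>S - {p, q} - {r}. psgn e S p r * psgn e (S - {p, r}) q s * a p r * a q s * pf e a (S - {p, q} - {r, s}))"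
    by (rule sum.cong) (simp_all add: * sum_distrib_left algebra_simps)
  finally show ?thesis .
qed

text \<open>Exchanging the partners \<open>r\<close> and \<open>s\<close> of the two rows reverses
  the sign of each term in the double expansion while the entries stay the same; the single term
  pairing \<open>p\<close> with \<open>q\<close> vanishes since \<open>a p q = 0\<close>.\<close>

lemma pf_equal_rows:
  assumes "finite S" "even (card S)" "skew_on S a" "p \<in> S" "q \<in> S" "p \<noteq> q"
    and "a p q = 0" and eq: "\<And>s. s \<in> S - {p, q} \<Longrightarrow> a p s = a q s"
  shows "pf e a S = 0"
proof -
  let ?A = "S - {p, q}"
  define g where "g r s = psgn e S p r * psgn e (S - {p, r}) q s * a p r * a q s * pf e a (?A - {r, s})" for r s
  have "g r s = - g s r" if "r \<in> ?A" "s \<in> ?A - {r}" for r s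
  proof -
    have d: "distinct [p, q, r, s]" "{p,q,r,s} \<subseteq> S" using that assms by auto
    have 1: "psgn e S p r = e p q * e r q * (e p s * e r s) * psgn e (S - {q, s}) p r"
      using d assms by (intro psgn_remove) auto
    have 2: "psgn e S p s = e p q * e s q * (e p r * e s r) * psgn e (S - {q, r}) p s"
      using d assms by (intro psgn_remove) auto
    let ?R = "S - {p,q,r,s}"
    have R: "S - {q, s} - {p, r} = ?R" "S - {q, r} - {p, s} = ?R"
       "S - {p, r} - {q, s} = ?R" "S - {p, s} - {q, r} = ?R" by auto
    have P1: "psgn e S p r * psgn e (S - {p, r}) q s =
       e p q * e r q * (e p s * e r s) * e p r * e q s * ((\<Prod>x\<in>?R. e p x * e r x) * (\<Prod>x\<in>?R. e q x * e s x))"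
      unfolding 1 unfolding psgn_def R by (simp only: mult_ac)
    have P2: "psgn e S p s * psgn e (S - {p, s}) q r =
       e p q * e s q * (e p r * e s r) * e p s * e q r * ((\<Prod>x\<in>?R. e p x * e s x) * (\<Prod>x\<in>?R. e q x * e r x))"
      unfolding 2 unfolding psgn_def R by (simp only: mult_ac)
    have Q: "(\<Prod>x\<in>?R. e p x * e s x) * (\<Prod>x\<in>?R. e q x * e r x)
       = (\<Prod>x\<in>?R. e p x * e r x) * (\<Prod>x\<in>?R. e q x * e s x)"
      by (simp only: prod.distrib mult_ac)
    have E: "e r q = - e q r" "e s q = - e q s" "e s r = - e r s"
      using d by (auto intro: e_anti)
    have "psgn e S p r * psgn e (S - {p, r}) q s = - (psgn e S p s * psgn e (S - {p, s}) q r)"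
      unfolding P1 P2 Q E by (simp only: mult_ac mult_minus_left mult_minus_right minus_minus)
    moreover have "a p r = a q r" "a p s = a q s" using eq that by auto
    ultimately show ?thesis unfolding g_def by (simp add: insert_commute)
  qed
  then have "(\<Sum>r\<in>?A. \<Sum>s\<in>?A - {r}. g r s) = - (\<Sum>r\<in>?A. \<Sum>s\<in>?A - {r}. g s r)"
    unfolding sum_negf[symmetric] by (intro sum.cong refl) auto
  also have "\<dots> = - (\<Sum>r\<in>?A. \<Sum>s\<in>?A - {r}. g r s)"
    by (subst sum_offdiag_swap) (use assms in auto)
  finally have "(\<Sum>r\<in>?A. \<Sum>s\<in>?A - {r}. g r s) = 0" by simp
  then show ?thesis using pf_expand2[OF assms(1-6)] assms(7) by (simp add: g_def)
qed

end

section \<open>Multilinearity, the Schur complement and relabelling\<close>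

context sign_function begin

lemma pf_cong:
  assumes "finite S" "even (card S)" "skew_on S a" "\<And>p q. p \<in> S \<Longrightarrow> q \<in> S \<Longrightarrow> p \<noteq> q \<Longrightarrow> a p q = b p q"
  shows "pf e a S = pf e b S"
  using assms
proof (induction "card S" arbitrary: S rule: less_induct)
  case less
  show ?case
  proof (cases "S = {}")
    case False
    then obtain p where p: "p \<in> S" by auto
    have b: "skew_on S b"
      by (rule skew_onI) (metis skew_onD less.prems(3,4))
    have "pf e a (S - {p, q}) = pf e b (S - {p, q})" if "q \<in> S - {p}" for q
    proof -
      have c: "card (S - {p, q}) = card S - 2" using that p less.prems by (intro card_minus_two) auto
      moreover have "card S - 2 < card S" using p less.prems(1,2) by (cases "card S") auto
      ultimately show ?thesis using less.prems(1,2,4) by (intro less.hyps skew_on_subset[OF less.prems(3)]) auto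
    qed
    then show ?thesis
      unfolding pf_expand[OF less.prems(1-3) p] pf_expand[OF less.prems(1,2) b p]
      by (intro sum.cong) (use less.prems p in auto)
  qed simp
qed

text \<open>Each term of the expansion along \<open>p\<close> contains exactly one entry of that
  row, and the smaller pfaffians do not see where the \<open>b j\<close> differ from
  \<open>a\<close>.\<close>

lemma pf_row_combination:
  assumes "finite S" "even (card S)" "skew_on S a" "p \<in> S" "finite J"
    and b: "\<And>j. j \<in> J \<Longrightarrow> skew_on S (b j)"
    and eq: "\<And>j s t. j \<in> J \<Longrightarrow> s \<in> S - {p} \<Longrightarrow> t \<in> S - {p} \<Longrightarrow> b j s t = a s t"
    and row: "\<And>s. s \<in> S - {p} \<Longrightarrow> a p s = (\<Sum>j\<in>J. c j * b j p s)"
  shows "pf e a S = (\<Sum>j\<in>J. c j * pf e (b j) S)"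
proof -
  have m: "pf e (b j) (S - {p, q}) = pf e a (S - {p, q})" if "j \<in> J" "q \<in> S - {p}" for j q
    using that assms by (intro pf_cong skew_on_subset[OF b])
     (auto simp: card_minus_two)
  have "pf e a S = (\<Sum>q\<in>S - {p}. \<Sum>j\<in>J. c j * (psgn e S p q * b j p q * pf e a (S - {p, q})))"
    unfolding pf_expand[OF assms(1-4)]
    by (rule sum.cong) (simp_all add: row sum_distrib_left sum_distrib_right algebra_simps)
  also have "\<dots> = (\<Sum>j\<in>J. \<Sum>q\<in>S - {p}. c j * (psgn e S p q * b j p q * pf e a (S - {p, q})))"
    by (rule sum.swap)
  also have "\<dots> = (\<Sum>j\<in>J. c j * pf e (b j) S)"
  proof (rule sum.cong)
    fix j assume j: "j \<in> J"
    show "(\<Sum>q\<in>S - {p}. c j * (psgn e S p q * b j p q * pf e a (S - {p, q}))) = c j * pf e (b j) S"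
      unfolding pf_expand[OF assms(1,2) b[OF j] assms(4)] sum_distrib_left
      by (rule sum.cong) (use j m in auto)
  qed simp
  finally show ?thesis .
qed

text \<open>Row and column \<open>p\<close> are overwritten by row and column \<open>i\<close>. The
  entry between \<open>p\<close> and \<open>i\<close> is set to 0 explicitly, because
  \<open>skew_on\<close> says nothing about \<open>a i i\<close>.\<close>

definition copy_row :: "('i \<Rightarrow> 'i \<Rightarrow> real) \<Rightarrow> 'i \<Rightarrow> 'i \<Rightarrow> 'i \<Rightarrow> 'i \<Rightarrow> real" where
  "copy_row a p i s t = (if s = p then (if t = i then 0 else a i t)
     else if t = p then (if s = i then 0 else a s i) else a s t)"

lemma copy_row_antisym: "skew_on S a \<Longrightarrow> i \<in> S \<Longrightarrow> skew_on S (copy_row a p i)"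
  by (rule skew_onI) (auto simp: copy_row_def intro: skew_onD)

lemma pf_copy_row:
  assumes "finite S" "even (card S)" "skew_on S a" "p \<in> S" "i \<in> S" "i \<noteq> p"
  shows "pf e (copy_row a p i) S = 0"
  by (rule pf_equal_rows[of S _ p i]) (use assms copy_row_antisym in \<open>auto simp: copy_row_def\<close>)

text \<open>Adding to a row \<open>r \<in> R\<close> the combination \<open>c r\<close> of the rows in \<open>S\<close> clears its entries in the
  columns of \<open>S\<close>.\<close>

theorem pf_schur:
  assumes "finite S" "finite R" "S \<inter> R = {}" "even (card S)" "even (card R)"
    and "skew_on (S \<union> R) a" and "skew_on R K"
    and a0: "\<And>i. i \<in> S \<Longrightarrow> a i i = 0"
    and c: "\<And>r j. r \<in> R \<Longrightarrow> j \<in> S \<Longrightarrow> a r j + (\<Sum>i\<in>S. c r i * a i j) = 0"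
    and K: "\<And>r r'. r \<in> R \<Longrightarrow> r' \<in> R \<Longrightarrow> r \<noteq> r' \<Longrightarrow> K r r' = a r r' + (\<Sum>i\<in>S. c r i * a i r')"
    and e_block: "\<And>s r r'. s \<in> S \<Longrightarrow> r \<in> R \<Longrightarrow> r' \<in> R \<Longrightarrow> e r s = e r' s"
  shows "pf e a (S \<union> R) = pf e a S * pf e K R"
  using assms(2,3,5-7) c K e_block
proof (induction "card R" arbitrary: R rule: less_induct)
  case less
  note prems = less.prems
  show ?case
  proof (cases "R = {}")
    case False
    then obtain r where r: "r \<in> R" by auto
    let ?U = "S \<union> R"
    have cU: "card ?U = card S + card R" using prems(1,2) assms(1) by (simp add: card_Un_disjoint)
    have U: "finite ?U" "even (card ?U)" "r \<in> ?U" using prems cU assms(1,4) r by auto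
    have rS: "r \<notin> S" using r prems by auto
    have IH: "pf e a (?U - {r, q}) = pf e a S * pf e K (R - {r, q})" if q: "q \<in> R - {r}" for q
    proof -
      have c: "card (R - {r, q}) = card R - 2" using that r prems by (intro card_minus_two) auto
      have "card R - 2 < card R" using r prems(1) by (cases "card R") auto
      then have "pf e a (S \<union> (R - {r, q})) = pf e a S * pf e K (R - {r, q})"
        using prems(1-3,6-) c by (intro less.hyps skew_on_subset[OF prems(4)] skew_on_subset[OF prems(5)]) auto
      moreover have "?U - {r, q} = S \<union> (R - {r, q})" using r q prems by auto
      ultimately show ?thesis by simp
    qed
    \<comment> \<open>This is the expansion along \<open>r\<close> after row \<open>i\<close> has
      been copied there, so multiples of it can be added without changing the pfaffian.\<close>
    have z: "(\<Sum>q\<in>?U - {r}. psgn e ?U r q * (if q = i then 0 else a i q) * pf e a (?U - {r, q})) = 0" if i: "i \<in> S" for i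
    proof -
      have "pf e (copy_row a r i) ?U = 0" using i rS U prems(4) by (intro pf_copy_row) auto
      moreover have "pf e (copy_row a r i) ?U = (\<Sum>q\<in>?U - {r}. psgn e ?U r q * copy_row a r i r q * pf e (copy_row a r i) (?U - {r, q}))"
        using i U prems(4) by (intro pf_expand copy_row_antisym) auto
      moreover have "pf e (copy_row a r i) (?U - {r, q}) = pf e a (?U - {r, q})" if "q \<in> ?U - {r}" for q
        using i U prems(4) that by (intro pf_cong skew_on_subset[OF copy_row_antisym[OF prems(4), of i r]])
           (auto simp: copy_row_def card_minus_two)
      ultimately show ?thesis by (simp add: copy_row_def)
    qed
    have "pf e a ?U = (\<Sum>q\<in>?U - {r}. psgn e ?U r q * a r q * pf e a (?U - {r, q}))"
      by (rule pf_expand) (use U prems in auto)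
    also have "\<dots> = \<dots> + (\<Sum>i\<in>S. c r i * (\<Sum>q\<in>?U - {r}. psgn e ?U r q * (if q = i then 0 else a i q) * pf e a (?U - {r, q})))"
      using z by simp
    also have "\<dots> = (\<Sum>q\<in>?U - {r}. psgn e ?U r q * (a r q + (\<Sum>i\<in>S. c r i * a i q)) * pf e a (?U - {r, q}))"
    proof -
      have "(\<Sum>i\<in>S. c r i * (\<Sum>q\<in>?U - {r}. psgn e ?U r q * (if q = i then 0 else a i q) * pf e a (?U - {r, q})))
        = (\<Sum>q\<in>?U - {r}. psgn e ?U r q * (\<Sum>i\<in>S. c r i * a i q) * pf e a (?U - {r, q}))"
        unfolding sum_distrib_left sum_distrib_right
        by (subst sum.swap, intro sum.cong refl) (auto simp: a0 algebra_simps)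
      then show ?thesis by (simp add: sum.distrib[symmetric] algebra_simps)
    qed
    also have "\<dots> = (\<Sum>q\<in>R - {r}. psgn e ?U r q * K r q * pf e a (?U - {r, q}))"
    proof -
      have "?U - {r} = S \<union> (R - {r})" using rS by auto
      moreover have "(\<Sum>q\<in>S. psgn e ?U r q * (a r q + (\<Sum>i\<in>S. c r i * a i q)) * pf e a (?U - {r, q})) = 0"
        by (rule sum.neutral) (use prems(6)[OF r] in auto)
      moreover have "(\<Sum>q\<in>R - {r}. psgn e ?U r q * (a r q + (\<Sum>i\<in>S. c r i * a i q)) * pf e a (?U - {r, q}))
         = (\<Sum>q\<in>R - {r}. psgn e ?U r q * K r q * pf e a (?U - {r, q}))"
        by (rule sum.cong) (use prems(7)[OF r] in auto)
      moreover have "S \<inter> (R - {r}) = {}" using prems by auto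
      ultimately show ?thesis
        using prems(1) assms(1) by (simp add: sum.union_disjoint)
    qed
    also have "\<dots> = (\<Sum>q\<in>R - {r}. pf e a S * (psgn e R r q * K r q * pf e K (R - {r, q})))"
    proof (rule sum.cong)
      fix q assume q: "q \<in> R - {r}"
      have "?U - {r, q} = S \<union> (R - {r, q})" using r q prems by auto
      then have "(\<Prod>s\<in>?U - {r, q}. e r s * e q s) = (\<Prod>s\<in>S. e r s * e q s) * (\<Prod>s\<in>R - {r, q}. e r s * e q s)"
        using prems assms(1) by (simp add: prod.union_disjoint Int_Diff[symmetric])
      \<comment> \<open>All of \<open>R\<close> lies on the same side of each \<open>s\<close> in
        \<open>S\<close>, so the factors are squares.\<close>
      moreover have "(\<Prod>s\<in>S. e r s * e q s) = 1"
      proof (rule prod.neutral, rule ballI)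
        fix s assume s: "s \<in> S"
        then have "s \<noteq> r" using rS by auto
        then show "e r s * e q s = 1" using prems(8)[OF s, of r q] r q e_sq[of r s] by auto
      qed
      ultimately have "psgn e ?U r q = psgn e R r q" by (simp add: psgn_def)
      then show "psgn e ?U r q * K r q * pf e a (?U - {r, q}) = pf e a S * (psgn e R r q * K r q * pf e K (R - {r, q}))"
        by (simp add: IH[OF q])
    qed simp
    also have "\<dots> = pf e a S * pf e K R"
      unfolding pf_expand[OF prems(1,3,5) r] by (simp add: sum_distrib_left)
    finally show ?thesis .
  qed simp
qed

lemma pf_relabel:
  assumes "bij_betw f S R" "finite S" "even (card S)" "skew_on R b" and "sign_function e'"
    and "\<And>p q. p \<in> S \<Longrightarrow> q \<in> S \<Longrightarrow> p \<noteq> q \<Longrightarrow> a p q = b (f p) (f q)"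
    and "\<And>p q. p \<in> S \<Longrightarrow> q \<in> S \<Longrightarrow> p \<noteq> q \<Longrightarrow> e p q = e' (f p) (f q)"
  shows "pf e a S = pf e' b R"
  using assms
proof (induction "card S" arbitrary: S R rule: less_induct)
  case less
  interpret s': sign_function e' by fact
  show ?case
  proof (cases "S = {}")
    case True
    then show ?thesis using less.prems by (auto simp: bij_betw_def)
  next
    case False
    then obtain p where p: "p \<in> S" by auto
    have inj: "inj_on f S" and R: "R = f ` S" using less.prems by (auto simp: bij_betw_def)
    have a: "skew_on S a" unfolding skew_on_def
    proof (intro ballI impI)
      fix s t assume st: "s \<in> S" "t \<in> S" "s \<noteq> t"
      then have "f s \<noteq> f t" using inj by (auto dest: inj_onD)
      then show "a t s = - a s t" using less.prems(6)[of s t] less.prems(6)[of t s] st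
          skew_onD[OF less.prems(4), of "f s" "f t"] R by auto
    qed
    have fR: "finite R" "card R = card S" using R inj less.prems by (auto simp: card_image)
    have sub: "R - {f p, f q} = f ` (S - {p, q})" if "q \<in> S" for q
      unfolding R using inj p that by (auto dest: inj_onD)
    have IH: "pf e a (S - {p, q}) = pf e' b (R - {f p, f q})" if q: "q \<in> S - {p}" for q
    proof -
      have c: "card (S - {p, q}) = card S - 2" using that p less.prems by (intro card_minus_two) auto
      have "card S - 2 < card S" using p less.prems(2) by (cases "card S") auto
      moreover have "bij_betw f (S - {p,q}) (R - {f p, f q})"
        using sub[of q] q inj by (auto simp: bij_betw_def intro: inj_on_subset)
      ultimately show ?thesis using c less.prems(2,3,6,7) q
        by (intro less.hyps skew_on_subset[OF less.prems(4)] less.prems(5)) auto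
    qed
    have "pf e' b R = (\<Sum>q\<in>R - {f p}. psgn e' R (f p) q * b (f p) q * pf e' b (R - {f p, q}))"
      by (rule s'.pf_expand) (use fR less.prems p R in auto)
    also have "R - {f p} = f ` (S - {p})" using inj p by (auto simp: R dest: inj_onD)
    also have "(\<Sum>q\<in>f ` (S - {p}). psgn e' R (f p) q * b (f p) q * pf e' b (R - {f p, q}))
      = (\<Sum>q\<in>S - {p}. psgn e' R (f p) (f q) * b (f p) (f q) * pf e' b (R - {f p, f q}))"
      by (subst sum.reindex) (use inj in \<open>auto intro: inj_on_subset\<close>)
    also have "\<dots> = (\<Sum>q\<in>S - {p}. psgn e S p q * a p q * pf e a (S - {p, q}))"
    proof (rule sum.cong)
      fix q assume q: "q \<in> S - {p}"
      have "psgn e' R (f p) (f q) = e' (f p) (f q) * (\<Prod>s\<in>S - {p, q}. e' (f p) (f s) * e' (f q) (f s))"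
        unfolding psgn_def using sub[of q] q inj
        by (simp add: prod.reindex[OF inj_on_subset[OF inj, of "S - {p, q}"]])
      also have "\<dots> = psgn e S p q" unfolding psgn_def
        using q p less.prems(7) by (auto intro!: arg_cong2[where f="(*)"] prod.cong)
      finally show "psgn e' R (f p) (f q) * b (f p) (f q) * pf e' b (R - {f p, f q}) = psgn e S p q * a p q * pf e a (S - {p, q})"
        using IH[OF q] less.prems(6)[of p q] q p by auto
    qed simp
    also have "\<dots> = pf e a S" by (rule pf_expand[symmetric]) (use less.prems a p in auto)
    finally show ?thesis by simp
  qed
qed

end

section \<open>Permutations and determinants\<close>

text \<open>The matrix factors into the triangular matrix of coefficients and the matrix of powers.
  The same factorization, read backwards for the Newton polynomials \<open>w i\<close>, whose own
  matrix is triangular at the nodes, evaluates the determinant of powers.\<close>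

lemma vandermonde_det_polys:
  fixes q :: "nat \<Rightarrow> real poly"
  assumes "\<And>i. i < N \<Longrightarrow> degree (q i) \<le> i"
  shows "Determinant.det (mat N N (\<lambda>(i, j). poly (q i) (x j))) = (\<Prod>i<N. coeff (q i) i) * vandermonde N x"
proof -
  let ?V = "mat N N (\<lambda>(i, j). x j ^ i)"
  have *: "Determinant.det (mat N N (\<lambda>(i, j). poly (q i) (x j))) = (\<Prod>i<N. coeff (q i) i) * Determinant.det ?V"
    if q: "\<And>i. i < N \<Longrightarrow> degree (q i) \<le> i" for q :: "nat \<Rightarrow> real poly"
  proof -
    let ?L = "mat N N (\<lambda>(i, k). coeff (q i) k)"
    have "mat N N (\<lambda>(i, j). poly (q i) (x j)) = ?L * ?V"
    proof (rule eq_matI)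
      fix i j assume ij: "i < dim_row (?L * ?V)" "j < dim_col (?L * ?V)"
      then have "poly (q i) (x j) = (\<Sum>k\<le>degree (q i). coeff (q i) k * x j ^ k)"
        by (simp add: poly_altdef)
      also have "\<dots> = (\<Sum>k<N. coeff (q i) k * x j ^ k)"
        using q[of i] ij by (intro sum.mono_neutral_left) (auto simp: coeff_eq_0)
      finally show "mat N N (\<lambda>(i, j). poly (q i) (x j)) $$ (i, j) = (?L * ?V) $$ (i, j)"
        using ij by (simp add: scalar_prod_def lessThan_atLeast0)
    qed auto
    moreover have "Determinant.det (?L * ?V) = Determinant.det ?L * Determinant.det ?V"
      by (rule det_mult) auto
    moreover have "Determinant.det ?L = prod_list (diag_mat ?L)"
      by (rule det_lower_triangular[where n = N]) (auto intro!: coeff_eq_0 order.strict_trans1[OF q])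
    moreover have "prod_list (diag_mat ?L) = (\<Prod>i<N. coeff (q i) i)"
      by (simp add: prod_list_diag_prod lessThan_atLeast0)
    ultimately show ?thesis by simp
  qed
  define w where "w i = (\<Prod>k<i. [:- x k, 1:])" for i :: nat
  have dw: "degree (w i) = i" "coeff (w i) i = 1" for i
  proof -
    have "degree (w i) = i \<and> lead_coeff (w i) = 1"
    proof (induction i)
      case (Suc i)
      have "coeff (w i * [:- x i, 1:]) (degree (w i) + degree [:- x i, 1:]) = lead_coeff (w i) * lead_coeff [:- x i, 1:]"
        by (rule coeff_mult_degree_sum)
      moreover have "w (Suc i) = w i * [:- x i, 1:]" by (simp add: w_def)
      moreover have d: "degree (w i) = i" and l: "lead_coeff (w i) = 1" using Suc by blast+
      moreover have "degree (w i * [:- x i, 1:]) = degree (w i) + degree [:- x i, 1:]"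
        using l by (intro degree_mult_eq) auto
      ultimately show ?case unfolding d by (simp del: mult_pCons_right)
    qed (simp add: w_def)
    then show "degree (w i) = i" "coeff (w i) i = 1" by auto
  qed
  have "Determinant.det ?V = Determinant.det (mat N N (\<lambda>(i, j). poly (w i) (x j)))"
    using *[of w] dw by simp
  also have "\<dots> = prod_list (diag_mat (mat N N (\<lambda>(i, j). poly (w i) (x j))))"
    by (rule det_upper_triangular[where n = N]) (auto simp: w_def poly_prod upper_triangular_def)
  also have "\<dots> = (\<Prod>j<N. poly (w j) (x j))"
    by (simp add: prod_list_diag_prod lessThan_atLeast0)
  also have "\<dots> = vandermonde N x" by (simp add: w_def poly_prod vandermonde_def)
  finally show ?thesis using *[OF assms] by simp
qed

lemma vandermonde_permute:
  assumes "\<sigma> permutes {..<N}"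
  shows "vandermonde N (x \<circ> \<sigma>) = of_int (sign \<sigma>) * vandermonde N x"
proof -
  let ?V = "\<lambda>x. mat N N (\<lambda>(i, j). x j ^ i) :: real mat"
  have V: "Determinant.det (transpose_mat (?V x)) = vandermonde N x" for x
    using vandermonde_det_polys[of N "\<lambda>i. monom 1 i" x]
    by (subst det_transpose[of _ N]) (simp_all add: poly_monom degree_monom_le)
  have "transpose_mat (?V (x \<circ> \<sigma>)) = mat N N (\<lambda>(i, j). transpose_mat (?V x) $$ (\<sigma> i, j))"
    using permutes_in_image[OF assms] by (intro eq_matI) auto
  then show ?thesis
    using V[of "x \<circ> \<sigma>"] V[of x] det_permute_rows[of "transpose_mat (?V x)" N \<sigma>] assms
    by (simp add: lessThan_atLeast0)
qed

lemma sgn_prod: "sgn (prod f A) = (\<Prod>i\<in>A. sgn (f i))" for f :: "'i \<Rightarrow> real"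
  by (induction A rule: infinite_finite_induct) (auto simp: sgn_mult)

section \<open>Signed sums over arrangements\<close>

primrec lsgn :: "('i \<Rightarrow> 'i \<Rightarrow> real) \<Rightarrow> 'i list \<Rightarrow> real" where
  "lsgn e [] = 1"
| "lsgn e (x # xs) = (\<Prod>y\<in>set xs. e x y) * lsgn e xs"

lemma lsgn_append1: "distinct (xs @ [y]) \<Longrightarrow> lsgn e (xs @ [y]) = lsgn e xs * (\<Prod>x\<in>set xs. e x y)"
  by (induction xs) (auto simp: algebra_simps)

definition nat_sgn :: "nat \<Rightarrow> nat \<Rightarrow> real" where
  "nat_sgn i j = (if i < j then 1 else -1)"

lemma nat_sgn_sign_function: "sign_function nat_sgn"
  by unfold_locales (auto simp: nat_sgn_def)

text \<open>Both signs are read off the Vandermonde product of the values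
  \<open>real (\<sigma> i)\<close>: its factors have the signs collected by \<open>lsgn\<close>, and
  permuting the positive product of the identity brings out \<open>sign \<sigma>\<close>.\<close>

lemma lsgn_permutation:
  assumes "\<sigma> permutes {..<N}"
  shows "lsgn nat_sgn (map \<sigma> [0..<N]) = of_int (sign \<sigma>)"
proof -
  have inj: "inj \<sigma>" using assms by (rule permutes_inj)
  have "lsgn nat_sgn (map \<sigma> [0..<n]) = (\<Prod>j<n. \<Prod>i<j. sgn (real (\<sigma> j) - real (\<sigma> i)))" for n
  proof (induction n)
    case (Suc n)
    have "distinct (map \<sigma> [0..<n] @ [\<sigma> n])" using inj_eq[OF inj] by (auto simp: distinct_map inj_on_def)
    then have "lsgn nat_sgn (map \<sigma> [0..<Suc n]) = lsgn nat_sgn (map \<sigma> [0..<n]) * (\<Prod>x\<in>\<sigma> ` {0..<n}. nat_sgn x (\<sigma> n))"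
      by (simp add: lsgn_append1)
    also have "(\<Prod>x\<in>\<sigma> ` {0..<n}. nat_sgn x (\<sigma> n)) = (\<Prod>i<n. sgn (real (\<sigma> n) - real (\<sigma> i)))"
      using inj_eq[OF inj] by (subst prod.reindex) (auto intro!: prod.cong simp: inj_on_def nat_sgn_def lessThan_atLeast0 sgn_if)
    finally show ?case using Suc by simp
  qed simp
  also have "(\<Prod>j<N. \<Prod>i<j. sgn (real (\<sigma> j) - real (\<sigma> i))) = sgn (vandermonde N (real \<circ> \<sigma>))"
    by (simp add: vandermonde_def sgn_prod)
  also have "\<dots> = sgn (of_int (sign \<sigma>)) * sgn (vandermonde N real)"
    by (simp only: vandermonde_permute[OF assms] sgn_mult)
  also have "vandermonde N real > 0" unfolding vandermonde_def by (intro prod_pos) auto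
  then have "sgn (vandermonde N real) = 1" by simp
  finally show ?thesis by (simp add: sign_def)
qed

text \<open>Lists can be taken apart at the head, which is what matches the recursive expansion of a
  pfaffian.\<close>

lemma sum_permutes_lists:
  fixes F :: "nat list \<Rightarrow> real"
  shows "(\<Sum>\<sigma> | \<sigma> permutes {..<m}. F (map \<sigma> [0..<m])) = (\<Sum>xs\<in>permutations_of_set {..<m}. F xs)"
proof (rule sum.reindex_bij_betw)
  show "bij_betw (\<lambda>\<sigma>. map \<sigma> [0..<m]) {\<sigma>. \<sigma> permutes {..<m}} (permutations_of_set {..<m})"
  proof (rule bij_betwI')
    fix \<sigma> \<tau> assume st: "\<sigma> \<in> {\<sigma>. \<sigma> permutes {..<m}}" "\<tau> \<in> {\<sigma>. \<sigma> permutes {..<m}}"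
    show "(map \<sigma> [0..<m] = map \<tau> [0..<m]) = (\<sigma> = \<tau>)"
    proof
      assume "map \<sigma> [0..<m] = map \<tau> [0..<m]"
      then have "\<sigma> i = \<tau> i" for i
        using st by (cases "i < m") (auto simp: permutes_def)
      then show "\<sigma> = \<tau>" by auto
    qed simp
  next
    fix \<sigma> assume "\<sigma> \<in> {\<sigma>. \<sigma> permutes {..<m}}"
    then show "map \<sigma> [0..<m] \<in> permutations_of_set {..<m}"
      using permutes_image[of \<sigma> "{..<m}"] permutes_inj[of \<sigma> "{..<m}"]
      by (auto simp: permutations_of_set_def distinct_map lessThan_atLeast0 intro: inj_on_subset)
  next
    fix xs assume xs: "xs \<in> permutations_of_set {..<m}"
    then have l: "length xs = m" "distinct xs" "set xs = {..<m}"
      by (auto simp: permutations_of_set_def distinct_card[symmetric])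
    define \<sigma> where "\<sigma> i = (if i < m then xs ! i else i)" for i
    have "bij_betw \<sigma> {..<m} {..<m} = bij_betw ((!) xs) {..<m} {..<m}"
      by (rule bij_betw_cong) (auto simp: \<sigma>_def)
    also have \<dots> by (rule bij_betw_nth) (simp_all only: l)
    finally have "\<sigma> permutes {..<m}" by (intro bij_imp_permutes) (auto simp: \<sigma>_def)
    moreover have "xs = map \<sigma> [0..<m]" using l(1) by (intro nth_equalityI) (simp_all add: \<sigma>_def)
    ultimately show "\<exists>\<sigma>\<in>{\<sigma>. \<sigma> permutes {..<m}}. xs = map \<sigma> [0..<m]" by blast
  qed
qed

lemma sum_permutations_of_set_Cons:
  fixes F :: "'i list \<Rightarrow> real"
  assumes "finite A" "A \<noteq> {}"
  shows "(\<Sum>xs\<in>permutations_of_set A. F xs) = (\<Sum>x\<in>A. \<Sum>xs\<in>permutations_of_set (A - {x}). F (x # xs))"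
proof -
  have "(\<Sum>xs\<in>permutations_of_set A. F xs) = (\<Sum>x\<in>A. \<Sum>xs\<in>(#) x ` permutations_of_set (A - {x}). F xs)"
    unfolding permutations_of_set_nonempty[OF assms(2)]
    by (rule sum.UNION_disjoint) (use assms in auto)
  also have "\<dots> = (\<Sum>x\<in>A. \<Sum>xs\<in>permutations_of_set (A - {x}). F (x # xs))"
    by (rule sum.cong) (simp_all add: sum.reindex)
  finally show ?thesis .
qed

text \<open>The relation \<open>r\<close> decides which of the two orders of each consecutive pair
  counts, as the condition \<open>\<sigma> (2 * k) < \<sigma> (2 * k + 1)\<close> does in
  \<open>pfaffian\<close>.\<close>

fun pair_weight :: "('i \<Rightarrow> 'i \<Rightarrow> bool) \<Rightarrow> ('i \<Rightarrow> 'i \<Rightarrow> real) \<Rightarrow> 'i list \<Rightarrow> real" where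
  "pair_weight r a (p # q # xs) = (if r p q then a p q * pair_weight r a xs else 0)"
| "pair_weight r a _ = 1"

context sign_function begin

text \<open>With \<open>n + 1\<close> pairs, summing over all first elements \<open>p\<close> gives
  \<open>2 * (n + 1)\<close> full expansions, of which \<open>r\<close> keeps half. The factor
  \<open>n + 1\<close> that remains turns \<open>fact n\<close> into the next factorial.\<close>

lemma sum_pair_weight:
  assumes "finite S" "card S = 2 * n" "skew_on S a"
    and r: "\<And>p q. p \<in> S \<Longrightarrow> q \<in> S \<Longrightarrow> p \<noteq> q \<Longrightarrow> r p q \<longleftrightarrow> \<not> r q p"
  shows "(\<Sum>xs\<in>permutations_of_set S. lsgn e xs * pair_weight r a xs) = fact n * pf e a S"
  using assms
proof (induction n arbitrary: S)
  case 0
  then show ?case by simp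
next
  case (Suc n)
  have ne: "S \<noteq> {}" using Suc.prems by auto
  define E where "E p q = psgn e S p q * a p q * pf e a (S - {p, q})" for p q
  have "(\<Sum>xs\<in>permutations_of_set S. lsgn e xs * pair_weight r a xs)
     = (\<Sum>p\<in>S. \<Sum>q\<in>S - {p}. \<Sum>xs\<in>permutations_of_set (S - {p} - {q}). lsgn e (p # q # xs) * pair_weight r a (p # q # xs))"
  proof -
    have "(\<Sum>xs\<in>permutations_of_set (S - {p}). lsgn e (p # xs) * pair_weight r a (p # xs))
      = (\<Sum>q\<in>S - {p}. \<Sum>xs\<in>permutations_of_set (S - {p} - {q}). lsgn e (p # q # xs) * pair_weight r a (p # q # xs))" if "p \<in> S" for p
    proof (rule sum_permutations_of_set_Cons)
      have "card (S - {p}) \<noteq> 0" using Suc.prems that by simp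
      then show "S - {p} \<noteq> {}" by (metis card.empty)
    qed (use Suc.prems in auto)
    then show ?thesis
      unfolding sum_permutations_of_set_Cons[OF Suc.prems(1) ne] by (rule sum.cong[OF refl])
  qed
  also have "\<dots> = (\<Sum>p\<in>S. \<Sum>q\<in>S - {p}. (if r p q then fact n * E p q else 0))"
  proof (intro sum.cong refl)
    fix p q assume pq: "p \<in> S" "q \<in> S - {p}"
    have R: "S - {p} - {q} = S - {p, q}" by auto
    have IH: "(\<Sum>xs\<in>permutations_of_set (S - {p, q}). lsgn e xs * pair_weight r a xs) = fact n * pf e a (S - {p, q})"
    proof (rule Suc.IH[OF _ _ skew_on_subset[OF Suc.prems(3)]])
      show "card (S - {p, q}) = 2 * n" using pq Suc.prems(1,2) by (auto simp: card_minus_two)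
      show "r p' q' \<longleftrightarrow> \<not> r q' p'" if "p' \<in> S - {p, q}" "q' \<in> S - {p, q}" "p' \<noteq> q'" for p' q'
        by (rule Suc.prems(4)) (use that in auto)
    qed (use Suc.prems in auto)
    have "(\<Sum>xs\<in>permutations_of_set (S - {p, q}). lsgn e (p # q # xs) * pair_weight r a (p # q # xs))
       = (\<Sum>xs\<in>permutations_of_set (S - {p, q}). (if r p q then psgn e S p q * a p q else 0) * (lsgn e xs * pair_weight r a xs))"
    proof (rule sum.cong)
      fix xs assume "xs \<in> permutations_of_set (S - {p, q})"
      then have xs: "set xs = S - {p, q}" by (rule permutations_of_setD)
      then have q: "q \<notin> set xs" by auto
      have "lsgn e (p # q # xs) = psgn e S p q * lsgn e xs"
        unfolding psgn_def xs[symmetric] prod.distrib using q by (simp add: mult_ac)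
      then show "lsgn e (p # q # xs) * pair_weight r a (p # q # xs)
        = (if r p q then psgn e S p q * a p q else 0) * (lsgn e xs * pair_weight r a xs)" by (simp del: lsgn.simps)
    qed simp
    also have "\<dots> = (if r p q then psgn e S p q * a p q else 0) * (fact n * pf e a (S - {p, q}))"
      unfolding sum_distrib_left[symmetric] IH ..
    finally show "(\<Sum>xs\<in>permutations_of_set (S - {p} - {q}). lsgn e (p # q # xs) * pair_weight r a (p # q # xs))
      = (if r p q then fact n * E p q else 0)" unfolding R by (simp add: E_def)
  qed
  also have "\<dots> = fact n * (\<Sum>p\<in>S. \<Sum>q\<in>S - {p}. if r p q then E p q else 0)" (is "_ = _ * ?X")
    unfolding sum_distrib_left by (intro sum.cong refl) auto
  \<comment> \<open>Exchanging \<open>p\<close> and \<open>q\<close> leaves \<open>E\<close>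
    unchanged, and \<open>r\<close> holds for exactly one of the two orders.\<close>
  also have "2 * ?X = (\<Sum>p\<in>S. \<Sum>q\<in>S - {p}. E p q)"
  proof -
    have "?X = (\<Sum>q\<in>S. \<Sum>p\<in>S - {q}. if r p q then E p q else 0)"
      by (rule sum_offdiag_swap) (use Suc.prems in auto)
    also have "\<dots> = (\<Sum>p\<in>S. \<Sum>q\<in>S - {p}. if r p q then 0 else E p q)"
    proof (intro sum.cong refl)
      fix p q assume pq: "p \<in> S" "q \<in> S - {p}"
      then have "E q p = E p q"
        using skew_onD[OF Suc.prems(3), of p q] psgn_anti[of p q S] by (auto simp: E_def insert_commute)
      then show "(if r q p then E q p else 0) = (if r p q then 0 else E p q)"
        using Suc.prems(4)[of p q] pq by auto
    qed
    finally have "2 * ?X = ?X + (\<Sum>p\<in>S. \<Sum>q\<in>S - {p}. if r p q then 0 else E p q)" by simp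
    also have "\<dots> = (\<Sum>p\<in>S. \<Sum>q\<in>S - {p}. E p q)"
      unfolding sum.distrib[symmetric] by (intro sum.cong refl) auto
    finally show ?thesis .
  qed
  then have "?X = (\<Sum>p\<in>S. \<Sum>q\<in>S - {p}. E p q) / 2" by simp
  also have "(\<Sum>p\<in>S. \<Sum>q\<in>S - {p}. E p q) = (\<Sum>p\<in>S. pf e a S)"
    by (rule sum.cong) (use pf_expand[OF Suc.prems(1) _ Suc.prems(3)] Suc.prems(2) in \<open>auto simp: E_def\<close>)
  finally show ?case using Suc.prems by (simp add: algebra_simps)
qed

text \<open>The rows in \<open>bs\<close> pair to zero with one another and with \<open>W\<close>,
  so each of them must be matched with some \<open>u i\<close>. Removing them one at a time produces
  a sum over all matchings.\<close>

lemma pf_extract: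
  assumes "finite W" "even (card W)" "finite I" "card I = length bs" "inj_on u I" "distinct bs"
    and disj: "u ` I \<inter> set bs = {}" "u ` I \<inter> W = {}" "set bs \<inter> W = {}"
    and anti: "skew_on (u ` I \<union> set bs \<union> W) a"
    and zero: "\<And>b w. b \<in> set bs \<Longrightarrow> w \<in> set bs \<union> W \<Longrightarrow> a b w = 0"
    and ord: "sorted_wrt (\<lambda>b b'. e b b' = 1) bs" "\<And>i b. i \<in> I \<Longrightarrow> b \<in> set bs \<Longrightarrow> e (u i) b = 1"
      "\<And>i w. i \<in> I \<Longrightarrow> w \<in> W \<Longrightarrow> e (u i) w = 1"
  shows "pf e a (u ` I \<union> set bs \<union> W) = (-1) ^ (length bs * (length bs - 1) div 2) * (\<Prod>b\<in>set bs. \<Prod>w\<in>W. e b w)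
     * (\<Sum>is\<in>permutations_of_set I. lsgn (\<lambda>i j. e (u i) (u j)) is * (\<Prod>(i, b)\<leftarrow>zip is bs. a (u i) b)) * pf e a W"
  using assms(3-)
proof (induction bs arbitrary: I)
  case Nil
  then show ?case by simp
next
  case (Cons b bs)
  let ?S = "u ` I \<union> set (b # bs) \<union> W"
  let ?k = "length bs"
  let ?c = "(-1) ^ (?k * (?k - 1) div 2) * (\<Prod>b\<in>set bs. \<Prod>w\<in>W. e b w) :: real"
  let ?s = "\<lambda>is bs. lsgn (\<lambda>i j. e (u i) (u j)) is * (\<Prod>(i, b)\<leftarrow>zip is bs. a (u i) b)"
  have I: "I \<noteq> {}" using Cons.prems by auto
  have b: "b \<notin> u ` I" "b \<notin> set bs" "b \<notin> W" using Cons.prems by auto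
  have cS: "card ?S = 2 * length (b # bs) + card W"
  proof -
    have "card ?S = card (u ` I \<union> set (b # bs)) + card W"
      using Cons.prems assms(1) by (intro card_Un_disjoint) auto
    also have "card (u ` I \<union> set (b # bs)) = card (u ` I) + card (set (b # bs))"
      using Cons.prems by (intro card_Un_disjoint) auto
    also have "card (set (b # bs)) = length (b # bs)" by (rule distinct_card) fact
    finally show ?thesis using Cons.prems(2,3) by (simp add: card_image)
  qed
  have IH: "pf e a (u ` (I - {i}) \<union> set bs \<union> W) = ?c * (\<Sum>is\<in>permutations_of_set (I - {i}). ?s is bs) * pf e a W"
    if "i \<in> I" for i
  proof (rule Cons.IH)
    show "inj_on u (I - {i})" using Cons.prems(3) by (rule inj_on_subset) auto
    show "skew_on (u ` (I - {i}) \<union> set bs \<union> W) a" by (rule skew_on_subset[OF Cons.prems(8)]) auto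
  qed (use Cons.prems that in auto)
  have "pf e a ?S = (\<Sum>q\<in>?S - {b}. psgn e ?S b q * a b q * pf e a (?S - {b, q}))"
    by (rule pf_expand) (use Cons.prems assms(1,2) cS in auto)
  also have "\<dots> = (\<Sum>q\<in>u ` I. psgn e ?S b q * a b q * pf e a (?S - {b, q}))"
    by (rule sum.mono_neutral_right) (use Cons.prems assms(1) b in auto)
  also have "\<dots> = (\<Sum>i\<in>I. psgn e ?S b (u i) * a b (u i) * pf e a (?S - {b, u i}))"
    by (subst sum.reindex) (use Cons.prems in auto)
  also have "\<dots> = (\<Sum>i\<in>I. (-1) ^ ?k * (\<Prod>w\<in>W. e b w) * (\<Prod>j\<in>I - {i}. e (u i) (u j)) * a (u i) b * (?c * (\<Sum>is\<in>permutations_of_set (I - {i}). ?s is bs) * pf e a W))"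
  proof (rule sum.cong)
    fix i assume i: "i \<in> I"
    have S: "?S - {b, u i} = u ` (I - {i}) \<union> set bs \<union> W"
      using Cons.prems(3,5,6) b i by (auto dest: inj_onD)
    have ub: "e b (u j) = -1" if "j \<in> I" for j
    proof -
      have "u j \<noteq> b" using b that by auto
      then show ?thesis using e_anti[of "u j" b] Cons.prems(11)[of j b] that by simp
    qed
    \<comment> \<open>As \<open>b\<close> lies behind all \<open>u j\<close> and before the rest of
      \<open>bs\<close>, the remaining \<open>u j\<close> contribute a power of -1, the rest of
      \<open>bs\<close> contributes 1, and \<open>W\<close> leaves the factors
      \<open>e b w\<close>.\<close>
    have "(\<Prod>s\<in>?S - {b, u i}. e b s * e (u i) s)
       = (\<Prod>s\<in>u ` (I - {i}). e b s * e (u i) s) * (\<Prod>s\<in>set bs. e b s * e (u i) s) * (\<Prod>s\<in>W. e b s * e (u i) s)"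
    proof -
      have "(\<Prod>s\<in>u ` (I - {i}) \<union> set bs \<union> W. e b s * e (u i) s)
        = (\<Prod>s\<in>u ` (I - {i}) \<union> set bs. e b s * e (u i) s) * (\<Prod>s\<in>W. e b s * e (u i) s)"
        by (rule prod.union_disjoint) (use Cons.prems(1,5-7) assms(1) in auto)
      moreover have "(\<Prod>s\<in>u ` (I - {i}) \<union> set bs. e b s * e (u i) s)
        = (\<Prod>s\<in>u ` (I - {i}). e b s * e (u i) s) * (\<Prod>s\<in>set bs. e b s * e (u i) s)"
        by (rule prod.union_disjoint) (use Cons.prems(1,5-7) assms(1) in auto)
      ultimately show ?thesis unfolding S by simp
    qed
    also have "(\<Prod>s\<in>set bs. e b s * e (u i) s) = 1"
      by (rule prod.neutral) (use Cons.prems(10,11) i in auto)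
    also have "(\<Prod>s\<in>W. e b s * e (u i) s) = (\<Prod>s\<in>W. e b s)"
      by (rule prod.cong) (use Cons.prems(12) i in auto)
    also have "(\<Prod>s\<in>u ` (I - {i}). e b s * e (u i) s) = (\<Prod>j\<in>I - {i}. e b (u j) * e (u i) (u j))"
      by (subst prod.reindex) (use Cons.prems(3) in \<open>auto intro: inj_on_subset\<close>)
    also have "\<dots> = (-1) ^ card (I - {i}) * (\<Prod>j\<in>I - {i}. e (u i) (u j))"
      unfolding prod.distrib by (simp add: ub)
    also have "card (I - {i}) = ?k" using Cons.prems(1,2) i by simp
    finally have "psgn e ?S b (u i) = - ((-1) ^ ?k * (\<Prod>j\<in>I - {i}. e (u i) (u j)) * (\<Prod>w\<in>W. e b w))"
      unfolding psgn_def ub[OF i] by simp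
    moreover have "a b (u i) = - a (u i) b"
      using skew_onD[OF Cons.prems(8), of "u i" b] i b by auto
    ultimately show "psgn e ?S b (u i) * a b (u i) * pf e a (?S - {b, u i})
      = (-1) ^ ?k * (\<Prod>w\<in>W. e b w) * (\<Prod>j\<in>I - {i}. e (u i) (u j)) * a (u i) b * (?c * (\<Sum>is\<in>permutations_of_set (I - {i}). ?s is bs) * pf e a W)"
      unfolding S IH[OF i] by simp
  qed simp
  also have "\<dots> = ((-1) ^ ?k * (\<Prod>w\<in>W. e b w) * ?c) * (\<Sum>i\<in>I. \<Sum>is\<in>permutations_of_set (I - {i}). (\<Prod>j\<in>I - {i}. e (u i) (u j)) * a (u i) b * ?s is bs) * pf e a W"
    by (simp add: sum_distrib_left sum_distrib_right mult_ac)
  also have "(\<Sum>i\<in>I. \<Sum>is\<in>permutations_of_set (I - {i}). (\<Prod>j\<in>I - {i}. e (u i) (u j)) * a (u i) b * ?s is bs)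
     = (\<Sum>is\<in>permutations_of_set I. ?s is (b # bs))"
    unfolding sum_permutations_of_set_Cons[OF Cons.prems(1) I]
    by (intro sum.cong refl) (auto simp: permutations_of_set_def)
  also have "(-1) ^ ?k * (\<Prod>w\<in>W. e b w) * ?c = (-1) ^ (length (b # bs) * (length (b # bs) - 1) div 2) * (\<Prod>b\<in>set (b # bs). \<Prod>w\<in>W. e b w)"
  proof -
    have "length (b # bs) * (length (b # bs) - 1) = ?k * (?k - 1) + 2 * ?k" by (cases ?k) auto
    then have "length (b # bs) * (length (b # bs) - 1) div 2 = ?k * (?k - 1) div 2 + ?k" by simp
    then show ?thesis using b(2) by (simp add: power_add)
  qed
  finally show ?case .
qed

end

text \<open>The ordering condition of \<open>pfaffian\<close> is moved into a weight that vanishes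
  when it fails. The sum then runs over all permutations, and \<open>sum_pair_weight\<close>
  produces the factorial that the definition divides out.\<close>

lemma pfaffian_eq_pf:
  assumes "dim_row A = 2 * n" and "skew_on {..<2 * n} (\<lambda>i j. A $$ (i, j))"
  shows "pfaffian A = pf nat_sgn (\<lambda>i j. A $$ (i, j)) {..<2 * n}"
proof -
  interpret sign_function nat_sgn by (rule nat_sgn_sign_function)
  let ?a = "\<lambda>i j. A $$ (i, j)"
  have w: "pair_weight (<) ?a (map \<sigma> [0..<2 * k]) =
      (if \<forall>j<k. \<sigma> (2 * j) < \<sigma> (2 * j + 1) then \<Prod>j<k. ?a (\<sigma> (2 * j)) (\<sigma> (2 * j + 1)) else 0)" for \<sigma> :: "nat \<Rightarrow> nat" and k
  proof (induction k arbitrary: \<sigma>)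
    case (Suc k)
    have "map \<sigma> [0..<2 * Suc k] = \<sigma> 0 # \<sigma> 1 # map (\<lambda>i. \<sigma> (i + 2)) [0..<2 * k]"
      by (intro nth_equalityI) (auto simp: nth_Cons split: nat.split simp del: upt_Suc)
    then show ?case using Suc[of "\<lambda>i. \<sigma> (i + 2)"]
      by (auto simp: prod.lessThan_Suc_shift All_less_Suc2 simp del: upt_Suc prod.lessThan_Suc)
  qed simp
  have "(\<Sum>\<sigma> | \<sigma> permutes {..<2 * n} \<and> (\<forall>k<n. \<sigma> (2 * k) < \<sigma> (2 * k + 1)).
          of_int (sign \<sigma>) * (\<Prod>k<n. A $$ (\<sigma> (2 * k), \<sigma> (2 * k + 1))))
     = (\<Sum>\<sigma> | \<sigma> permutes {..<2 * n}. lsgn nat_sgn (map \<sigma> [0..<2 * n]) * pair_weight (<) ?a (map \<sigma> [0..<2 * n]))"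
    by (rule sum.mono_neutral_cong_left) (auto simp: lsgn_permutation w finite_permutations)
  also have "\<dots> = fact n * pf nat_sgn ?a {..<2 * n}"
    unfolding sum_permutes_lists[of "\<lambda>xs. lsgn nat_sgn xs * pair_weight (<) ?a xs"]
    by (rule sum_pair_weight) (use assms in auto)
  finally show ?thesis using assms(1) by (simp add: pfaffian_def Let_def)
qed

section \<open>Integrating out a point\<close>

lemma lsgn_cong:
  assumes "distinct xs" "\<And>x y. x \<in> set xs \<Longrightarrow> y \<in> set xs \<Longrightarrow> x \<noteq> y \<Longrightarrow> e x y = e' x y"
  shows "lsgn e xs = lsgn e' xs"
  using assms
proof (induction xs)
  case (Cons x xs)
  have "(\<Prod>y\<in>set xs. e x y) = (\<Prod>y\<in>set xs. e' x y)"
    by (rule prod.cong) (use Cons.prems in auto)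
  moreover have "lsgn e xs = lsgn e' xs" by (rule Cons.IH) (use Cons.prems in auto)
  ultimately show ?case by simp
qed simp

context sign_function begin

text \<open>When the matched rows are numbered consistently with \<open>e\<close>, the sum over
  matchings in \<open>pf_extract\<close> is the Leibniz formula.\<close>

lemma pf_extract_det:
  assumes "finite W" "even (card W)" "inj_on u {..<N}" "inj_on b {..<N}"
    and disj: "u ` {..<N} \<inter> b ` {..<N} = {}" "u ` {..<N} \<inter> W = {}" "b ` {..<N} \<inter> W = {}"
    and anti: "skew_on (u ` {..<N} \<union> b ` {..<N} \<union> W) a"
    and zero: "\<And>j w. j < N \<Longrightarrow> w \<in> b ` {..<N} \<union> W \<Longrightarrow> a (b j) w = 0"
    and ord: "\<And>i j. i < j \<Longrightarrow> j < N \<Longrightarrow> e (b i) (b j) = 1" "\<And>i j. i < j \<Longrightarrow> j < N \<Longrightarrow> e (u i) (u j) = 1"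
      "\<And>i j. i < N \<Longrightarrow> j < N \<Longrightarrow> e (u i) (b j) = 1" "\<And>i w. i < N \<Longrightarrow> w \<in> W \<Longrightarrow> e (u i) w = 1"
  shows "pf e a (u ` {..<N} \<union> b ` {..<N} \<union> W) = (-1) ^ (N * (N - 1) div 2) * (\<Prod>j<N. \<Prod>w\<in>W. e (b j) w)
     * Determinant.det (mat N N (\<lambda>(i, j). a (u i) (b j))) * pf e a W"
proof -
  let ?bs = "map b [0..<N]"
  have bs: "set ?bs = b ` {..<N}" "length ?bs = N" by (auto simp: lessThan_atLeast0)
  have "pf e a (u ` {..<N} \<union> set ?bs \<union> W) = (-1) ^ (length ?bs * (length ?bs - 1) div 2) * (\<Prod>b\<in>set ?bs. \<Prod>w\<in>W. e b w)
     * (\<Sum>is\<in>permutations_of_set {..<N}. lsgn (\<lambda>i j. e (u i) (u j)) is * (\<Prod>(i, b)\<leftarrow>zip is ?bs. a (u i) b)) * pf e a W"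
  proof (rule pf_extract)
    show "distinct ?bs" using assms(4) by (simp add: distinct_map lessThan_atLeast0)
    show "sorted_wrt (\<lambda>b b'. e b b' = 1) ?bs"
      unfolding sorted_wrt_iff_nth_less using ord(1) by auto
  qed (use assms in \<open>auto simp: lessThan_atLeast0\<close>)
  also have "(\<Prod>b\<in>set ?bs. \<Prod>w\<in>W. e b w) = (\<Prod>j<N. \<Prod>w\<in>W. e (b j) w)"
    unfolding bs by (subst prod.reindex[OF assms(4)]) simp
  also have "(\<Sum>is\<in>permutations_of_set {..<N}. lsgn (\<lambda>i j. e (u i) (u j)) is * (\<Prod>(i, b)\<leftarrow>zip is ?bs. a (u i) b))
    = (\<Sum>is\<in>permutations_of_set {..<N}. lsgn nat_sgn is * (\<Prod>(i, b)\<leftarrow>zip is ?bs. a (u i) b))"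
  proof (rule sum.cong)
    fix xs assume xs: "xs \<in> permutations_of_set {..<N}"
    have "e (u i) (u j) = nat_sgn i j" if "i < N" "j < N" "i \<noteq> j" for i j
    proof (cases "i < j")
      case True
      then show ?thesis using ord(2)[of i j] that by (simp add: nat_sgn_def)
    next
      case False
      then have "u j \<noteq> u i" using assms(3) that by (auto dest: inj_onD)
      then show ?thesis using ord(2)[of j i] e_anti[of "u j" "u i"] that False by (simp add: nat_sgn_def)
    qed
    then have "lsgn (\<lambda>i j. e (u i) (u j)) xs = lsgn nat_sgn xs"
      using permutations_of_setD[OF xs] by (intro lsgn_cong) auto
    then show "lsgn (\<lambda>i j. e (u i) (u j)) xs * (\<Prod>(i, b)\<leftarrow>zip xs ?bs. a (u i) b)
      = lsgn nat_sgn xs * (\<Prod>(i, b)\<leftarrow>zip xs ?bs. a (u i) b)" by simp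
  qed simp
  also have "\<dots> = (\<Sum>\<sigma> | \<sigma> permutes {..<N}. lsgn nat_sgn (map \<sigma> [0..<N]) * (\<Prod>(i, b)\<leftarrow>zip (map \<sigma> [0..<N]) ?bs. a (u i) b))"
    by (rule sum_permutes_lists[symmetric])
  also have "\<dots> = (\<Sum>\<sigma> | \<sigma> permutes {..<N}. of_int (sign \<sigma>) * (\<Prod>j<N. a (u (\<sigma> j)) (b j)))"
  proof (rule sum.cong)
    fix \<sigma> assume "\<sigma> \<in> {\<sigma>. \<sigma> permutes {..<N}}"
    moreover have "(\<Prod>(i, b)\<leftarrow>zip (map \<sigma> [0..<N]) ?bs. a (u i) b) = (\<Prod>j<N. a (u (\<sigma> j)) (b j))"
      by (simp add: zip_map_map o_def zip_same_conv_map prod.list_conv_set_nth lessThan_atLeast0)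
    ultimately show "lsgn nat_sgn (map \<sigma> [0..<N]) * (\<Prod>(i, b)\<leftarrow>zip (map \<sigma> [0..<N]) ?bs. a (u i) b)
       = of_int (sign \<sigma>) * (\<Prod>j<N. a (u (\<sigma> j)) (b j))" by (simp add: lsgn_permutation)
  qed simp
  also have "\<dots> = Determinant.det (mat N N (\<lambda>(i, j). a (u i) (b j)))"
  proof -
    have "Determinant.det (mat N N (\<lambda>(i, j). a (u i) (b j)))
       = (\<Sum>\<sigma> | \<sigma> permutes {0..<N}. signof \<sigma> * (\<Prod>j<N. mat N N (\<lambda>(i, j). a (u i) (b j)) $$ (\<sigma> j, j)))"
      by (rule det_col) auto
    also have "\<dots> = (\<Sum>\<sigma> | \<sigma> permutes {..<N}. of_int (sign \<sigma>) * (\<Prod>j<N. a (u (\<sigma> j)) (b j)))"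
      unfolding lessThan_atLeast0
    proof (intro sum.cong refl arg_cong2[where f = "(*)"] prod.cong)
      fix \<sigma> j assume "\<sigma> \<in> {\<sigma>. \<sigma> permutes {0..<N}}" "j \<in> {0..<N}"
      moreover from this have "\<sigma> j < N" using permutes_in_image[of \<sigma> "{0..<N}" j] by simp
      ultimately show "mat N N (\<lambda>(i, j). a (u i) (b j)) $$ (\<sigma> j, j) = a (u (\<sigma> j)) (b j)" by simp
    qed
    finally show ?thesis ..
  qed
  finally show ?thesis unfolding bs .
qed

text \<open>Integrating out a point \<open>x\<close> that occurs in the two rows \<open>b\<close> and \<open>v\<close>: each row in \<open>A\<close> is
  reproduced by the integral, except for its pairings with \<open>B\<close>, and the rows in \<open>B\<close> use up
  \<open>card B\<close> of the rows in \<open>A\<close>.\<close>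

theorem pf_integrate_out:
  fixes a :: "real \<Rightarrow> 'i \<Rightarrow> 'i \<Rightarrow> real"
  assumes R: "finite R" "even (card R)" "b \<notin> R" "v \<notin> R" "b \<noteq> v"
    and e: "\<And>r. r \<in> R \<Longrightarrow> e b r = e v r" "e b v = 1"
    and anti: "\<And>x. skew_on (insert b (insert v R)) (a x)"
    and c: "\<And>x p q. p \<in> R \<Longrightarrow> q \<in> R \<Longrightarrow> p \<noteq> q \<Longrightarrow> a x p q = c p q"
    and bv: "\<And>x. a x b v = 0"
    and AB: "A \<subseteq> R" "B \<subseteq> R" "\<And>p q. p \<in> B \<Longrightarrow> q \<in> R - A \<Longrightarrow> p \<noteq> q \<Longrightarrow> c p q = 0"
    and int: "\<And>p q. p \<in> R \<Longrightarrow> q \<in> R \<Longrightarrow> p \<noteq> q \<Longrightarrow>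
       has_bochner_integral lborel (\<lambda>x. a x p b * a x v q) (if p \<in> A \<and> q \<notin> B then c p q else 0)"
  shows "has_bochner_integral lborel (\<lambda>x. pf e (a x) (insert b (insert v R))) ((real (card A) - real (card B)) * pf e c R)"
proof -
  let ?S = "insert b (insert v R)"
  define E where "E r s = psgn e R r s * c r s * pf e c (R - {r, s})" for r s
  have S: "finite ?S" "even (card ?S)" using R by auto
  have cR: "skew_on R c"
  proof (rule skew_onI)
    fix p q assume pq: "p \<in> R" "q \<in> R" "p \<noteq> q"
    then show "c q p = - c p q"
      using skew_onD[OF anti[of 0], of p q] c[of p q 0] c[of q p 0] by simp
  qed
  have Sbv: "?S - {b, v} = R" using R by auto
  \<comment> \<open>The indices \<open>b\<close> and \<open>v\<close> are neighbours in the order,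
    so their signs against \<open>R\<close> agree and cancel as squares. The minus sign left over is
    absorbed by \<open>a x b r = - a x r b\<close>.\<close>
  have sgn: "psgn e ?S b r * psgn e (?S - {b, r}) v s = - psgn e R r s" if rs: "r \<in> R" "s \<in> R - {r}" for r s
  proof -
    let ?T = "R - {r, s}"
    have d: "r \<noteq> b" "r \<noteq> v" "s \<noteq> b" "s \<noteq> v" "r \<noteq> s" "b \<notin> ?T" "v \<notin> ?T" "s \<notin> ?T" using R rs by auto
    have 1: "?S - {b, r} = insert v (insert s ?T)" using R rs by auto
    have 2: "?S - {b, r} - {v, s} = ?T" using R rs by auto
    define P where "P = (\<Prod>t\<in>?T. e b t * e r t)"
    define Q where "Q = (\<Prod>t\<in>?T. e v t * e s t)"
    have eb: "e b r = e v r" "e b s = e v s" using e(1) rs by auto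
    have rv: "e r v = - e v r" using d by (intro e_anti) auto
    have sq: "e v r * e v r = 1" "e v s * e v s = 1" using d by (auto intro!: e_sq)
    have p1: "psgn e ?S b r = e b r * (e b v * e r v * ((e b s * e r s) * P))"
      unfolding psgn_def 1 P_def using d R(1) by simp
    have p2: "psgn e (?S - {b, r}) v s = e v s * Q"
      unfolding psgn_def 2 Q_def ..
    have PQ: "P * Q = (\<Prod>t\<in>?T. e r t * e s t)"
      unfolding P_def Q_def prod.distrib[symmetric]
    proof (rule prod.cong)
      fix t assume t: "t \<in> ?T"
      then have "v \<noteq> t" using d by auto
      then have "e v t * e v t = 1" by (rule e_sq)
      moreover have "e b t = e v t" using t e by auto
      ultimately show "e b t * e r t * (e v t * e s t) = e r t * e s t"
        by (metis mult.assoc mult.commute mult_1)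
    qed simp
    have "psgn e ?S b r * psgn e (?S - {b, r}) v s = - ((e v r * e v r) * (e v s * e v s) * (e r s * (P * Q)))"
      unfolding p1 p2 eb rv e(2) by (simp only: mult_ac mult_minus_left mult_minus_right mult_1)
    then show ?thesis unfolding sq PQ by (simp add: psgn_def)
  qed
  have ex: "pf e (a x) ?S = (\<Sum>r\<in>R. \<Sum>s\<in>R - {r}. (psgn e R r s * pf e c (R - {r, s})) * (a x r b * a x v s))" for x
  proof -
    have "pf e (a x) ?S = psgn e ?S b v * a x b v * pf e (a x) (?S - {b, v})
      + (\<Sum>r\<in>?S - {b, v}. \<Sum>s\<in>?S - {b, v} - {r}. psgn e ?S b r * psgn e (?S - {b, r}) v s * a x b r * a x v s * pf e (a x) (?S - {b, v} - {r, s}))"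
      by (rule pf_expand2[OF S anti]) (use R in auto)
    also have "\<dots> = (\<Sum>r\<in>R. \<Sum>s\<in>R - {r}. psgn e ?S b r * psgn e (?S - {b, r}) v s * a x b r * a x v s * pf e (a x) (R - {r, s}))"
      unfolding Sbv bv by simp
    also have "\<dots> = (\<Sum>r\<in>R. \<Sum>s\<in>R - {r}. (psgn e R r s * pf e c (R - {r, s})) * (a x r b * a x v s))"
    proof (intro sum.cong refl)
      fix r s assume rs: "r \<in> R" "s \<in> R - {r}"
      have "pf e (a x) (R - {r, s}) = pf e c (R - {r, s})"
        by (rule pf_cong[OF _ _ skew_on_subset[OF anti[of x]]]) (use R rs c in \<open>auto simp: card_minus_two\<close>)
      moreover have "a x b r = - a x r b" using rs R by (intro skew_onD[OF anti]) auto
      ultimately show "psgn e ?S b r * psgn e (?S - {b, r}) v s * a x b r * a x v s * pf e (a x) (R - {r, s})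
        = (psgn e R r s * pf e c (R - {r, s})) * (a x r b * a x v s)"
        unfolding sgn[OF rs] by simp
    qed
    finally show ?thesis .
  qed
  have "has_bochner_integral lborel (\<lambda>x. pf e (a x) ?S)
      (\<Sum>r\<in>R. \<Sum>s\<in>R - {r}. (psgn e R r s * pf e c (R - {r, s})) * (if r \<in> A \<and> s \<notin> B then c r s else 0))"
    unfolding ex
    by (intro has_bochner_integral_sum has_bochner_integral_mult_right int) auto
  also have "(\<Sum>r\<in>R. \<Sum>s\<in>R - {r}. (psgn e R r s * pf e c (R - {r, s})) * (if r \<in> A \<and> s \<notin> B then c r s else 0))
     = (\<Sum>r\<in>R. \<Sum>s\<in>R - {r}. if r \<in> A \<and> s \<notin> B then E r s else 0)"
    by (intro sum.cong refl) (simp add: E_def)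
  also have "\<dots> = (\<Sum>r\<in>R. \<Sum>s\<in>R - {r}. if r \<in> A then E r s else 0)
      - (\<Sum>r\<in>R. \<Sum>s\<in>R - {r}. if r \<in> A \<and> s \<in> B then E r s else 0)"
    unfolding sum_subtractf[symmetric] by (intro sum.cong refl) auto
  also have "(\<Sum>r\<in>R. \<Sum>s\<in>R - {r}. if r \<in> A then E r s else 0) = (\<Sum>r\<in>R. if r \<in> A then pf e c R else 0)"
  proof (rule sum.cong)
    fix r assume r: "r \<in> R"
    have "pf e c R = (\<Sum>s\<in>R - {r}. E r s)" unfolding E_def by (rule pf_expand[OF R(1,2) cR r])
    then show "(\<Sum>s\<in>R - {r}. if r \<in> A then E r s else 0) = (if r \<in> A then pf e c R else 0)" by simp
  qed simp
  also have "\<dots> = real (card A) * pf e c R"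
    using AB(1) R(1) by (simp add: sum.If_cases Int_absorb1)
  \<comment> \<open>The lost terms are regrouped by \<open>s\<close>. A row in \<open>B\<close>
    pairs to zero with everything outside \<open>A\<close>, so the restriction to \<open>A\<close>
    is harmless and each \<open>s\<close> in \<open>B\<close> contributes a complete expansion along
    its row.\<close>
  also have "(\<Sum>r\<in>R. \<Sum>s\<in>R - {r}. if r \<in> A \<and> s \<in> B then E r s else 0)
     = (\<Sum>s\<in>R. \<Sum>r\<in>R - {s}. if r \<in> A \<and> s \<in> B then E r s else 0)"
    by (rule sum_offdiag_swap[OF R(1)])
  also have "\<dots> = (\<Sum>s\<in>R. if s \<in> B then pf e c R else 0)"
  proof (rule sum.cong)
    fix s assume s: "s \<in> R"
    show "(\<Sum>r\<in>R - {s}. if r \<in> A \<and> s \<in> B then E r s else 0) = (if s \<in> B then pf e c R else 0)"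
    proof (cases "s \<in> B")
      case True
      have "pf e c R = (\<Sum>r\<in>R - {s}. E s r)" unfolding E_def by (rule pf_expand[OF R(1,2) cR s])
      also have "\<dots> = (\<Sum>r\<in>R - {s}. if r \<in> A \<and> s \<in> B then E r s else 0)"
      proof (rule sum.cong)
        fix r assume r: "r \<in> R - {s}"
        then have "s \<noteq> r" by auto
        moreover have "c r s = - c s r" using skew_onD[OF cR] r s by blast
        ultimately have "E s r = E r s" unfolding E_def psgn_anti[OF \<open>s \<noteq> r\<close>] by (simp add: insert_commute)
        moreover have "r \<notin> A \<Longrightarrow> E s r = 0" using AB(3)[of s r] True r by (auto simp: E_def)
        ultimately show "E s r = (if r \<in> A \<and> s \<in> B then E r s else 0)" using True by auto
      qed simp
      finally show ?thesis using True by simp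
    qed simp
  qed simp
  also have "\<dots> = real (card B) * pf e c R"
    using AB(2) R(1) by (simp add: sum.If_cases Int_absorb1)
  finally show ?thesis by (simp add: algebra_simps)
qed

text \<open>A linear relation between the rows makes row \<open>p\<close> a combination of the
  others, and each of those copied into row \<open>p\<close> gives zero. This links the pfaffian of
  \<open>A0\<close> to the invertibility of \<open>A0\<close>.\<close>

lemma pf_degenerate:
  assumes "finite S" "even (card S)" "skew_on S a" "\<And>i. i \<in> S \<Longrightarrow> a i i = 0"
    and "p \<in> S" "v p \<noteq> 0" "\<And>s. s \<in> S \<Longrightarrow> (\<Sum>j\<in>S. v j * a j s) = 0"
  shows "pf e a S = 0"
proof -
  have "pf e a S = (\<Sum>j\<in>S - {p}. - (v j / v p) * pf e (copy_row a p j) S)"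
  proof (rule pf_row_combination[OF assms(1-3,5)])
    fix s assume s: "s \<in> S - {p}"
    have "0 = v p * a p s + (\<Sum>j\<in>S - {p}. v j * a j s)"
      using assms(7)[of s] s sum.remove[OF assms(1,5), of "\<lambda>j. v j * a j s"] by simp
    then have "a p s = - (\<Sum>j\<in>S - {p}. v j * a j s) / v p"
      using assms(6) by (simp add: field_simps)
    also have "\<dots> = (\<Sum>j\<in>S - {p}. - (v j / v p) * a j s)"
      by (simp add: sum_divide_distrib sum_negf)
    also have "\<dots> = (\<Sum>j\<in>S - {p}. - (v j / v p) * copy_row a p j p s)"
      by (rule sum.cong) (use s assms(4) in \<open>auto simp: copy_row_def\<close>)
    finally show "a p s = (\<Sum>j\<in>S - {p}. - (v j / v p) * copy_row a p j p s)" .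
  qed (use assms(1) in \<open>auto intro: copy_row_antisym[OF assms(3)] simp: copy_row_def\<close>)
  also have "\<dots> = 0"
    by (intro sum.neutral ballI) (use pf_copy_row[OF assms(1-3,5)] in auto)
  finally show ?thesis .
qed

end

section \<open>The pfaffian of a matrix of signs\<close>

lemma ex_strict_argmax:
  fixes y :: "'i \<Rightarrow> real"
  assumes "finite Q" "Q \<noteq> {}" "inj_on y Q"
  shows "\<exists>p\<in>Q. \<forall>q\<in>Q - {p}. y q < y p"
proof -
  have "Max (y ` Q) \<in> y ` Q" using assms by (intro Max_in) auto
  then obtain p where p: "p \<in> Q" "Max (y ` Q) = y p" by blast
  have "y q < y p" if q: "q \<in> Q - {p}" for q
  proof -
    have "y q \<le> y p" unfolding p(2)[symmetric] using q assms(1) by (intro Max_ge) auto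
    moreover have "y q \<noteq> y p" using inj_on_eq_iff[OF assms(3)] q p(1) by simp
    ultimately show ?thesis by simp
  qed
  then show ?thesis using p(1) by blast
qed

text \<open>The identity behind the expansion of the pfaffian of signs along the row of the largest \<open>y p\<close>.\<close>

lemma sum_prod_sgn:
  fixes y :: "'i \<Rightarrow> real"
  assumes "finite Q" "inj_on y Q"
  shows "(\<Sum>q\<in>Q. \<Prod>s\<in>Q - {q}. sgn (y s - y q)) = (if odd (card Q) then 1 else 0)"
  using assms
proof (induction "card Q" arbitrary: Q)
  case (Suc n)
  have ne: "Q \<noteq> {}" using Suc.hyps by auto
  obtain p where p: "p \<in> Q" and lt: "\<And>q. q \<in> Q - {p} \<Longrightarrow> y q < y p"
    using ex_strict_argmax[OF Suc.prems(1) ne Suc.prems(2)] by blast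
  have c: "card (Q - {p}) = n" using p Suc by simp
  have "(\<Sum>q\<in>Q. \<Prod>s\<in>Q - {q}. sgn (y s - y q))
     = (\<Prod>s\<in>Q - {p}. sgn (y s - y p)) + (\<Sum>q\<in>Q - {p}. \<Prod>s\<in>Q - {q}. sgn (y s - y q))"
    using p Suc.prems by (subst sum.remove) auto
  also have "(\<Prod>s\<in>Q - {p}. sgn (y s - y p)) = (\<Prod>s\<in>Q - {p}. -1)"
    by (rule prod.cong) (use lt in auto)
  also have "(\<Sum>q\<in>Q - {p}. \<Prod>s\<in>Q - {q}. sgn (y s - y q)) = (\<Sum>q\<in>Q - {p}. \<Prod>s\<in>Q - {p} - {q}. sgn (y s - y q))"
  proof (rule sum.cong)
    fix q assume q: "q \<in> Q - {p}"
    have "(\<Prod>s\<in>Q - {q}. sgn (y s - y q)) = sgn (y p - y q) * (\<Prod>s\<in>Q - {q} - {p}. sgn (y s - y q))"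
      using p q Suc.prems by (intro prod.remove) auto
    moreover have "Q - {q} - {p} = Q - {p} - {q}" by auto
    ultimately show "(\<Prod>s\<in>Q - {q}. sgn (y s - y q)) = (\<Prod>s\<in>Q - {p} - {q}. sgn (y s - y q))"
      using lt[OF q] by simp
  qed simp
  also have "\<dots> = (if odd (card (Q - {p})) then 1 else 0)"
    using c Suc.prems by (intro Suc.hyps(1)) (auto intro: inj_on_subset)
  finally show ?case using c Suc.hyps(2)[symmetric] by auto
qed simp

lemma prod_pairs_insert:
  fixes h :: "nat \<Rightarrow> nat \<Rightarrow> real"
  assumes "finite S" "p \<notin> S" "\<And>i j. h i j = h j i"
  shows "(\<Prod>j\<in>insert p S. \<Prod>i | i \<in> insert p S \<and> i < j. h i j) = (\<Prod>j\<in>S. \<Prod>i | i \<in> S \<and> i < j. h i j) * (\<Prod>s\<in>S. h p s)"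
proof -
  have 1: "(\<Prod>i | i \<in> insert p S \<and> i < p. h i p) = (\<Prod>s\<in>S. if s < p then h p s else 1)"
  proof -
    have "{i. i \<in> insert p S \<and> i < p} = {s \<in> S. s < p}" by auto
    moreover have "(\<Prod>i\<in>{s \<in> S. s < p}. h i p) = (\<Prod>s\<in>S. if s < p then h s p else 1)"
      by (rule prod.inter_filter[OF assms(1)])
    moreover have "\<dots> = (\<Prod>s\<in>S. if s < p then h p s else 1)"
      by (rule prod.cong) (simp_all add: assms(3)[of _ p])
    ultimately show ?thesis by simp
  qed
  have 2: "(\<Prod>i | i \<in> insert p S \<and> i < j. h i j) = (\<Prod>i | i \<in> S \<and> i < j. h i j) * (if p < j then h p j else 1)" for j
  proof (cases "p < j")
    case True
    then have "{i. i \<in> insert p S \<and> i < j} = insert p {i. i \<in> S \<and> i < j}" by auto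
    then show ?thesis using True assms by simp
  next
    case False
    then have "{i. i \<in> insert p S \<and> i < j} = {i. i \<in> S \<and> i < j}" by auto
    then show ?thesis using False by simp
  qed
  have "(\<Prod>j\<in>insert p S. \<Prod>i | i \<in> insert p S \<and> i < j. h i j)
     = (\<Prod>s\<in>S. if s < p then h p s else 1) * ((\<Prod>j\<in>S. \<Prod>i | i \<in> S \<and> i < j. h i j) * (\<Prod>j\<in>S. if p < j then h p j else 1))"
    unfolding prod.insert[OF assms(1,2)] 1 unfolding 2 prod.distrib ..
  also have "\<dots> = (\<Prod>j\<in>S. \<Prod>i | i \<in> S \<and> i < j. h i j) * (\<Prod>s\<in>S. (if s < p then h p s else 1) * (if p < s then h p s else 1))"
    by (simp add: prod.distrib)
  also have "(\<Prod>s\<in>S. (if s < p then h p s else 1) * (if p < s then h p s else 1)) = (\<Prod>s\<in>S. h p s)"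
    by (rule prod.cong) (use assms(2) in \<open>auto simp: neq_iff\<close>)
  finally show ?thesis .
qed

lemma pf_sgn_inj:
  fixes y :: "nat \<Rightarrow> real"
  assumes "finite S" "even (card S)" "inj_on y S"
  shows "pf nat_sgn (\<lambda>i j. sgn (y j - y i)) S = (\<Prod>j\<in>S. \<Prod>i | i \<in> S \<and> i < j. sgn (y j - y i))"
  using assms
proof (induction "card S" arbitrary: S rule: less_induct)
  case less
  interpret sign_function nat_sgn by (rule nat_sgn_sign_function)
  let ?a = "\<lambda>i j. sgn (y j - y i)"
  \<comment> \<open>The factor \<open>nat_sgn i j\<close> makes the pair weight symmetric, so that
    \<open>prod_pairs_insert\<close> can split off any index, whatever its position.\<close>
  define h where "h i j = nat_sgn i j * sgn (y j - y i)" for i j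
  define H where "H S = (\<Prod>j\<in>S. \<Prod>i | i \<in> S \<and> i < j. h i j)" for S
  have H: "(\<Prod>j\<in>S. \<Prod>i | i \<in> S \<and> i < j. sgn (y j - y i)) = H S" for S
    unfolding H_def by (intro prod.cong refl) (auto simp: h_def nat_sgn_def)
  have h: "h i j = h j i" for i j
    by (cases "i = j") (auto simp: h_def nat_sgn_def sgn_if)
  have anti: "skew_on T ?a" for T by (rule skew_onI) (auto simp: sgn_if)
  show ?case
  proof (cases "S = {}")
    case False
    obtain p where p: "p \<in> S" and lt: "\<And>q. q \<in> S - {p} \<Longrightarrow> y q < y p"
      using ex_strict_argmax[OF less.prems(1) False less.prems(3)] by blast
    have c0: "card S > 0" using p less.prems(1) by (auto simp: card_gt_0_iff)
    then have odd: "odd (card (S - {p}))" and c2: "card S - 2 < card S"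
      using p less.prems(1,2) by auto
    have IH: "pf nat_sgn ?a (S - {p, q}) = H (S - {p, q})" if "q \<in> S - {p}" for q
    proof -
      have c: "card (S - {p, q}) = card S - 2" using that p less.prems(1) by (intro card_minus_two) auto
      show ?thesis unfolding H[symmetric]
        by (rule less.hyps) (use c c2 less.prems in \<open>auto intro: inj_on_subset\<close>)
    qed
    have "pf nat_sgn ?a S = (\<Sum>q\<in>S - {p}. psgn nat_sgn S p q * ?a p q * H (S - {p, q}))"
      unfolding pf_expand[OF less.prems(1,2) anti p] by (rule sum.cong) (auto simp: IH)
    also have "\<dots> = (\<Sum>q\<in>S - {p}. H S * (\<Prod>s\<in>S - {p} - {q}. sgn (y s - y q)))"
    proof (rule sum.cong)
      fix q assume q: "q \<in> S - {p}"
      let ?T = "S - {p, q}"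
      have fT: "finite ?T" "finite (insert q ?T)" "p \<notin> insert q ?T" "q \<notin> ?T" using less.prems(1) q by auto
      have S: "insert p (insert q ?T) = S" and T: "S - {p} - {q} = ?T" using p q by auto
      have "H (insert q ?T) = H ?T * (\<Prod>s\<in>?T. h q s)"
        unfolding H_def by (rule prod_pairs_insert[OF fT(1,4) h])
      moreover have "H (insert p (insert q ?T)) = H (insert q ?T) * (\<Prod>s\<in>insert q ?T. h p s)"
        unfolding H_def by (rule prod_pairs_insert[OF fT(2,3) h])
      ultimately have HS: "H S = H ?T * (\<Prod>s\<in>?T. h q s) * (h p q * (\<Prod>s\<in>?T. h p s))"
        unfolding S prod.insert[OF fT(1,4)] by simp
      have "card ?T = card S - 2" using p q less.prems(1) by (intro card_minus_two) auto
      then have "even (card ?T)" using less.prems(2) by simp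
      moreover have "(\<Prod>s\<in>?T. sgn (y s - y p)) = (\<Prod>s\<in>?T. -1)"
        by (rule prod.cong) (use lt in auto)
      ultimately have one: "(\<Prod>s\<in>?T. sgn (y s - y p)) = 1" by simp
      have "(\<Prod>s\<in>?T. h q s) * (\<Prod>s\<in>?T. h p s) * (\<Prod>s\<in>?T. sgn (y s - y q))
         = (\<Prod>s\<in>?T. nat_sgn p s * nat_sgn q s * sgn (y s - y p))"
        unfolding prod.distrib[symmetric]
      proof (rule prod.cong)
        fix s assume s: "s \<in> ?T"
        then have "y s \<noteq> y q" using inj_on_eq_iff[OF less.prems(3)] q by simp
        then have one: "sgn (y s - y q) * sgn (y s - y q) = 1" by (simp add: sgn_if)
        have "h q s * h p s * sgn (y s - y q) = nat_sgn p s * nat_sgn q s * sgn (y s - y p) * (sgn (y s - y q) * sgn (y s - y q))"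
          unfolding h_def by (simp only: mult_ac)
        then show "h q s * h p s * sgn (y s - y q) = nat_sgn p s * nat_sgn q s * sgn (y s - y p)"
          unfolding one by simp
      qed simp
      also have "\<dots> = (\<Prod>s\<in>?T. nat_sgn p s * nat_sgn q s)" by (simp add: prod.distrib[of _ "\<lambda>s. sgn (y s - y p)"] one)
      finally show "psgn nat_sgn S p q * ?a p q * H ?T = H S * (\<Prod>s\<in>S - {p} - {q}. sgn (y s - y q))"
        unfolding HS T psgn_def h_def[of p q] by (simp only: mult_ac)
    qed simp
    also have "\<dots> = H S"
      unfolding sum_distrib_left[symmetric]
      using sum_prod_sgn[of "S - {p}" y] odd less.prems(1,3) by (auto intro: inj_on_subset)
    finally show ?thesis unfolding H .
  qed simp
qed

lemma pf_sgn:
  assumes "even N"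
  shows "pf nat_sgn (\<lambda>i j. sgn (y j - y i)) {..<N} = sgn (vandermonde N y)"
proof -
  interpret sign_function nat_sgn by (rule nat_sgn_sign_function)
  let ?a = "\<lambda>i j. sgn (y j - y i) :: real"
  have V: "sgn (vandermonde N y) = (\<Prod>j<N. \<Prod>i<j. sgn (y j - y i))"
    by (simp add: vandermonde_def sgn_prod)
  show ?thesis
  proof (cases "inj_on y {..<N}")
    case True
    have "{i. i \<in> {..<N} \<and> i < j} = {..<j}" if "j < N" for j using that by auto
    then show ?thesis unfolding V using pf_sgn_inj[OF _ _ True] assms by simp
  next
    case False
    then obtain i j where ij: "i < j" "j < N" "y i = y j"
      unfolding inj_on_def by (metis lessThan_iff linorder_neqE_nat)
    have "skew_on {..<N} ?a" by (rule skew_onI) (auto simp: sgn_if)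
    then have "pf nat_sgn ?a {..<N} = 0"
      by (rule pf_equal_rows[where p = i and q = j, rotated 2]) (use ij assms in auto)
    moreover have "(\<Prod>i<j. sgn (y j - y i)) = 0"
      by (rule prod_zero) (use ij in \<open>auto intro!: bexI[of _ i]\<close>)
    then have "(\<Prod>j<N. \<Prod>i<j. sgn (y j - y i)) = 0"
      using ij(2) by (intro prod_zero) auto
    ultimately show ?thesis unfolding V by simp
  qed
qed

section \<open>Pfaffians of triangular and block form\<close>

text \<open>Polynomials are replaced by monomials in order of degree. The lower monomials of
  \<open>q k\<close> repeat rows that have already been replaced, so only the leading coefficient
  survives.\<close>

lemma pf_polynomial_form:
  fixes B :: "real poly \<Rightarrow> real poly \<Rightarrow> real"
  assumes "even N" and anti: "\<And>p q. B q p = - B p q"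
    and lin: "\<And>p q k. degree p \<le> k \<Longrightarrow> B p q = (\<Sum>j\<le>k. coeff p j * B (monom 1 j) q)"
    and deg: "\<And>i. i < N \<Longrightarrow> degree (q i) \<le> i"
  shows "pf nat_sgn (\<lambda>i j. B (q i) (q j)) {..<N}
    = (\<Prod>i<N. coeff (q i) i) * pf nat_sgn (\<lambda>i j. B (monom 1 i) (monom 1 j)) {..<N}"
proof -
  interpret sign_function nat_sgn by (rule nat_sgn_sign_function)
  \<comment> \<open>The intermediate families: monomials below \<open>k\<close>, the given
    polynomials from \<open>k\<close> on.\<close>
  define Q where "Q k i = (if i < k then monom 1 i else q i)" for k i
  let ?a = "\<lambda>Q i j. B (Q i) (Q j)"
  have A: "skew_on S (?a Q)" for S and Q :: "nat \<Rightarrow> real poly" by (rule skew_onI) (rule anti)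
  have zero: "B p p = 0" for p using anti[of p p] by simp
  have "pf nat_sgn (?a (Q 0)) {..<N} = (\<Prod>i<k. coeff (q i) i) * pf nat_sgn (?a (Q k)) {..<N}" if "k \<le> N" for k
    using that
  proof (induction k)
    case (Suc k)
    have "pf nat_sgn (?a (Q k)) {..<N} = (\<Sum>j\<le>k. coeff (q k) j * pf nat_sgn (?a ((Q k)(k := monom 1 j))) {..<N})"
    proof (rule pf_row_combination)
      show "?a (Q k) k s = (\<Sum>j\<le>k. coeff (q k) j * ?a ((Q k)(k := monom 1 j)) k s)" if "s \<in> {..<N} - {k}" for s
      proof -
        have "Q k k = q k" by (simp add: Q_def)
        then show ?thesis using lin[OF deg, of k "Q k s"] Suc.prems that by simp
      qed
    qed (use Suc.prems assms(1) A in auto)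
    also have "\<dots> = (\<Sum>j\<le>k. if j = k then coeff (q k) k * pf nat_sgn (?a (Q (Suc k))) {..<N} else 0)"
    proof (rule sum.cong)
      fix j assume j: "j \<in> {..k}"
      show "coeff (q k) j * pf nat_sgn (?a ((Q k)(k := monom 1 j))) {..<N} = (if j = k then coeff (q k) k * pf nat_sgn (?a (Q (Suc k))) {..<N} else 0)"
      proof (cases "j = k")
        case True
        have "(Q k)(k := monom 1 k) = Q (Suc k)" by (auto simp: Q_def fun_eq_iff)
        then show ?thesis using True by simp
      next
        case False
        have "pf nat_sgn (?a ((Q k)(k := monom 1 j))) {..<N} = 0"
          by (rule pf_equal_rows[OF _ _ A, where p = k and q = j]) (use j False Suc.prems assms(1) in \<open>auto simp: Q_def zero\<close>)
        then show ?thesis using False by simp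
      qed
    qed simp
    also have "\<dots> = coeff (q k) k * pf nat_sgn (?a (Q (Suc k))) {..<N}" by simp
    finally show ?case using Suc by simp
  qed simp
  from this[of N] have "pf nat_sgn (?a (Q 0)) {..<N} = (\<Prod>i<N. coeff (q i) i) * pf nat_sgn (?a (Q N)) {..<N}" by simp
  moreover have "Q 0 = q" by (auto simp: Q_def)
  moreover have "pf nat_sgn (?a (Q N)) {..<N} = pf nat_sgn (?a (monom 1)) {..<N}"
    by (rule pf_cong[OF _ _ A]) (use assms(1) in \<open>auto simp: Q_def\<close>)
  ultimately show ?thesis by simp
qed

text \<open>The last row vanishes to the left of its block, so expanding along it leaves one term
  and a smaller matrix of the same shape.\<close>

lemma pf_block_diagonal:
  assumes anti: "skew_on {..<2 * n} a"
    and zero: "\<And>k j. k < n \<Longrightarrow> j < 2 * k \<Longrightarrow> a (2 * k + 1) j = 0"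
  shows "pf nat_sgn a {..<2 * n} = (\<Prod>k<n. a (2 * k) (2 * k + 1))"
  using assms
proof (induction n)
  case (Suc n)
  interpret sign_function nat_sgn by (rule nat_sgn_sign_function)
  have "pf nat_sgn a {..<2 * Suc n} = (\<Sum>q\<in>{..<2 * Suc n} - {2 * n + 1}. psgn nat_sgn {..<2 * Suc n} (2 * n + 1) q * a (2 * n + 1) q * pf nat_sgn a ({..<2 * Suc n} - {2 * n + 1, q}))"
    by (rule pf_expand) (use Suc.prems(1) in auto)
  also have "\<dots> = (\<Sum>q\<in>{2 * n}. psgn nat_sgn {..<2 * Suc n} (2 * n + 1) q * a (2 * n + 1) q * pf nat_sgn a ({..<2 * Suc n} - {2 * n + 1, q}))"
  proof (rule sum.mono_neutral_right)
    show "\<forall>i\<in>{..<2 * Suc n} - {2 * n + 1} - {2 * n}. psgn nat_sgn {..<2 * Suc n} (2 * n + 1) i * a (2 * n + 1) i * pf nat_sgn a ({..<2 * Suc n} - {2 * n + 1, i}) = 0"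
    proof
      fix i assume "i \<in> {..<2 * Suc n} - {2 * n + 1} - {2 * n}"
      then have "i < 2 * n" by auto
      then show "psgn nat_sgn {..<2 * Suc n} (2 * n + 1) i * a (2 * n + 1) i * pf nat_sgn a ({..<2 * Suc n} - {2 * n + 1, i}) = 0"
        using Suc.prems(2)[of n i] by simp
    qed
  qed auto
  also have "{..<2 * Suc n} - {2 * n + 1, 2 * n} = {..<2 * n}" by auto
  moreover have "psgn nat_sgn {..<2 * Suc n} (2 * n + 1) (2 * n) = -1"
  proof -
    have "(\<Prod>s\<in>{..<2 * Suc n} - {2 * n + 1, 2 * n}. nat_sgn (2 * n + 1) s * nat_sgn (2 * n) s) = 1"
      by (rule prod.neutral) (auto simp: nat_sgn_def)
    then show ?thesis unfolding psgn_def by (simp add: nat_sgn_def)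
  qed
  moreover have "a (2 * n + 1) (2 * n) = - a (2 * n) (2 * n + 1)"
    by (rule skew_onD[OF Suc.prems(1)]) auto
  moreover have "pf nat_sgn a {..<2 * n} = (\<Prod>k<n. a (2 * k) (2 * k + 1))"
    by (rule Suc.IH[OF skew_on_subset[OF Suc.prems(1)]]) (use Suc.prems(2) in auto)
  ultimately show ?case by simp
qed simp

section \<open>The heat semigroup\<close>

lemma heat_kernel_normal: "0 < t \<Longrightarrow> heat_kernel t x y = normal_density x (sqrt t) y"
  by (simp add: heat_kernel_def normal_density_def power2_commute)

lemma heat_kernel_commute: "heat_kernel t x y = heat_kernel t y x"
  by (simp add: heat_kernel_def power2_commute)

lemma heat_kernel_pos: "0 < t \<Longrightarrow> 0 < heat_kernel t x y"
  by (simp add: heat_kernel_def)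

lemma heat_kernel_nonneg: "0 < t \<Longrightarrow> 0 \<le> heat_kernel t x y"
  using heat_kernel_pos by (rule less_imp_le)

lemma heat_kernel_measurable [measurable]:
  assumes [measurable]: "f \<in> borel_measurable N" "g \<in> borel_measurable N"
  shows "(\<lambda>x. heat_kernel t (f x) (g x)) \<in> borel_measurable N"
  unfolding heat_kernel_def by measurable

lemma integrable_heat_kernel: "0 < t \<Longrightarrow> integrable lborel (\<lambda>y. heat_kernel t x y)"
  using integrable_normal_density[of "sqrt t" x] by (simp add: heat_kernel_normal)

lemma integral_heat_kernel: "0 < t \<Longrightarrow> (\<integral>y. heat_kernel t x y \<partial>lborel) = 1"
  using integral_normal_density[of "sqrt t" x] by (simp add: heat_kernel_normal)

text \<open>Completing the square.\<close>

lemma heat_kernel_mult: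
  assumes "0 < s" "0 < u"
  shows "heat_kernel s x y * heat_kernel u y z
    = heat_kernel (s + u) x z * heat_kernel (s * u / (s + u)) ((u * x + s * z) / (s + u)) y"
proof -
  define c where "c = s + u"
  have su: "c > 0" using assms by (simp add: c_def)
  define w where "w = u * x + s * z"
  have "(x - y)\<^sup>2 / (2 * s) + (y - z)\<^sup>2 / (2 * u)
    = (x - z)\<^sup>2 / (2 * c) + (w / c - y)\<^sup>2 / (2 * (s * u / c))" (is "?L = ?R")
  proof -
    have "w / c - y = (w - c * y) / c" using su by (simp add: field_simps)
    then have "(w / c - y)\<^sup>2 / (2 * (s * u / c)) = (w - c * y)\<^sup>2 / (2 * s * u * c)"
      using su assms by (simp add: power_divide power2_eq_square)
    then have "?R = ((x - z)\<^sup>2 * (s * u) + (w - c * y)\<^sup>2) / (2 * s * u * c)"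
      using su assms by (simp add: add_divide_distrib)
    also have "(x - z)\<^sup>2 * (s * u) + (w - c * y)\<^sup>2 = ((x - y)\<^sup>2 * u + (y - z)\<^sup>2 * s) * c"
      unfolding w_def c_def by (simp add: power2_eq_square algebra_simps)
    also have "\<dots> / (2 * s * u * c) = ((x - y)\<^sup>2 * u + (y - z)\<^sup>2 * s) / (2 * s * u)"
      using su by simp
    also have "\<dots> = ?L" using assms by (simp add: add_divide_distrib)
    finally show ?thesis by simp
  qed
  then have "exp (- ((x - y)\<^sup>2 / (2 * s))) * exp (- ((y - z)\<^sup>2 / (2 * u)))
    = exp (- ((x - z)\<^sup>2 / (2 * c))) * exp (- ((w / c - y)\<^sup>2 / (2 * (s * u / c))))"
    unfolding exp_add[symmetric] by (intro arg_cong[of _ _ exp]) simp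
  moreover have "sqrt (2 * pi * s) * sqrt (2 * pi * u) = sqrt (2 * pi * c) * sqrt (2 * pi * (s * u / c))"
    unfolding real_sqrt_mult[symmetric] using su by (intro arg_cong[of _ _ sqrt]) (simp add: field_simps)
  ultimately show ?thesis unfolding heat_kernel_def times_divide_times_eq c_def w_def by simp
qed

text \<open>After completing the square, the integration variable occurs only in a normalized
  Gaussian.\<close>

lemma heat_kernel_convolution:
  assumes "0 < s" "0 < u"
  shows "has_bochner_integral lborel (\<lambda>y. heat_kernel s x y * heat_kernel u y z) (heat_kernel (s + u) x z)"
proof -
  have v: "s * u / (s + u) > 0" using assms by simp
  show ?thesis
    unfolding heat_kernel_mult[OF assms] has_bochner_integral_iff
    using integrable_heat_kernel[OF v] integral_heat_kernel[OF v] by auto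
qed

section \<open>Heat integrals of bounded functions\<close>

text \<open>Signs and sign integrals are bounded but need not be integrable. This class contains
  them, is preserved by heat integrals, and may be multiplied by integrable functions.\<close>

definition bmeas :: "(real \<Rightarrow> real) \<Rightarrow> bool" where
  "bmeas H \<longleftrightarrow> H \<in> borel_measurable borel \<and> (\<exists>B. \<forall>x. \<bar>H x\<bar> \<le> B)"

lemma bmeas_measurable: "bmeas H \<Longrightarrow> H \<in> borel_measurable borel"
  by (simp add: bmeas_def)

lemma bmeas_bound: "bmeas H \<Longrightarrow> \<exists>B\<ge>0. \<forall>x. \<bar>H x\<bar> \<le> B"
  unfolding bmeas_def by (metis abs_ge_zero order.trans)

lemma integrable_mult_bmeas:
  assumes "integrable lborel f" "bmeas H"
  shows "integrable lborel (\<lambda>x. f x * H x :: real)"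
proof -
  obtain B where B: "0 \<le> B" "\<And>x. \<bar>H x\<bar> \<le> B" using bmeas_bound[OF assms(2)] by blast
  have [measurable]: "H \<in> borel_measurable borel" by (rule bmeas_measurable) fact
  show ?thesis
  proof (rule Bochner_Integration.integrable_bound)
    show "integrable lborel (\<lambda>x. B * f x)" using assms by simp
    show "AE x in lborel. norm (f x * H x) \<le> norm (B * f x)"
      using B by (intro AE_I2) (simp add: abs_mult mult.commute mult_right_mono)
  qed (use assms in measurable)
qed

text \<open>A bound on the integrals of \<open>\<bar>k x y\<bar>\<close> over y that is uniform in x
  makes Fubini's theorem applicable.\<close>

lemma pair_integrable:
  fixes f :: "real \<Rightarrow> real" and k :: "real \<Rightarrow> real \<Rightarrow> real"
  assumes f: "integrable lborel f" and k [measurable]: "case_prod k \<in> borel_measurable (borel \<Otimes>\<^sub>M borel)"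
    and "\<And>x. integrable lborel (k x)" and C: "\<And>x. (\<integral>y. \<bar>k x y\<bar> \<partial>lborel) \<le> C"
  shows "integrable (lborel \<Otimes>\<^sub>M lborel) (\<lambda>(x, y). f x * k x y)"
proof (rule lborel_pair.Fubini_integrable)
  have [measurable]: "f \<in> borel_measurable borel" using f by auto
  show "(\<lambda>(x, y). f x * k x y) \<in> borel_measurable (lborel \<Otimes>\<^sub>M lborel)" by measurable
  have "0 \<le> (\<integral>y. \<bar>k 0 y\<bar> \<partial>lborel)" by (rule Bochner_Integration.integral_nonneg) auto
  then have C0: "0 \<le> C" using C[of 0] by linarith
  have "integrable lborel (\<lambda>x. \<bar>f x\<bar> * (\<integral>y. \<bar>k x y\<bar> \<partial>lborel))"
  proof (rule Bochner_Integration.integrable_bound)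
    show "integrable lborel (\<lambda>x. C * f x)" using f by simp
    have "\<bar>f x\<bar> * \<bar>\<integral>y. \<bar>k x y\<bar> \<partial>lborel\<bar> \<le> \<bar>f x\<bar> * \<bar>C\<bar>" for x
      by (intro mult_left_mono) (use C[of x] C0 in \<open>auto simp: abs_of_nonneg\<close>)
    then show "AE x in lborel. norm (\<bar>f x\<bar> * (\<integral>y. \<bar>k x y\<bar> \<partial>lborel)) \<le> norm (C * f x)"
      by (intro AE_I2) (simp add: abs_mult mult.commute)
  qed measurable
  then show "integrable lborel (\<lambda>x. \<integral>y. norm (case (x, y) of (x, y) \<Rightarrow> f x * k x y) \<partial>lborel)"
    by (simp add: abs_mult)
  show "AE x in lborel. integrable lborel (\<lambda>y. case (x, y) of (x, y) \<Rightarrow> f x * k x y)"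
    using assms(3) by simp
qed

lemma integral_swap:
  fixes f :: "real \<Rightarrow> real" and k :: "real \<Rightarrow> real \<Rightarrow> real"
  assumes "integrable lborel f" "case_prod k \<in> borel_measurable (borel \<Otimes>\<^sub>M borel)"
    and "\<And>x. integrable lborel (k x)" "\<And>x. (\<integral>y. \<bar>k x y\<bar> \<partial>lborel) \<le> C"
  shows "(\<integral>x. f x * (\<integral>y. k x y \<partial>lborel) \<partial>lborel) = (\<integral>y. (\<integral>x. f x * k x y \<partial>lborel) \<partial>lborel)"
  using lborel_pair.Fubini_integral[OF pair_integrable[OF assms]] by simp

lemma heat_integral_0 [simp]: "heat_integral 0 x H = H x"
  by (simp add: heat_integral_def)

lemma heat_integral_pos: "0 < t \<Longrightarrow> heat_integral t x H = (\<integral>y. heat_kernel t x y * H y \<partial>lborel)"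
  by (simp add: heat_integral_def)

lemma integrable_heat_kernel_mult: "0 < t \<Longrightarrow> bmeas H \<Longrightarrow> integrable lborel (\<lambda>y. heat_kernel t x y * H y)"
  by (intro integrable_mult_bmeas integrable_heat_kernel)

lemma abs_integral_heat_kernel_le:
  assumes "0 < t" "bmeas H" "\<And>x. \<bar>H x\<bar> \<le> B"
  shows "(\<integral>y. \<bar>heat_kernel t x y * H y\<bar> \<partial>lborel) \<le> B"
proof -
  have "(\<integral>y. \<bar>heat_kernel t x y * H y\<bar> \<partial>lborel) \<le> (\<integral>y. heat_kernel t x y * B \<partial>lborel)"
  proof (rule integral_mono)
    show "integrable lborel (\<lambda>y. \<bar>heat_kernel t x y * H y\<bar>)"
      using integrable_heat_kernel_mult[OF assms(1,2)] by (rule integrable_abs)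
    show "integrable lborel (\<lambda>y. heat_kernel t x y * B)" using integrable_heat_kernel[OF assms(1)] by simp
    show "\<bar>heat_kernel t x y * H y\<bar> \<le> heat_kernel t x y * B" for y
      using assms(3) heat_kernel_nonneg[OF assms(1)] by (simp add: abs_mult mult_left_mono)
  qed
  also have "\<dots> = B" using integral_heat_kernel[OF assms(1)] by simp
  finally show ?thesis .
qed

lemma bmeas_heat_integral:
  assumes "0 \<le> t" "bmeas H"
  shows "bmeas (\<lambda>x. heat_integral t x H)"
proof (cases "t = 0")
  case False
  then have t: "0 < t" using assms by simp
  obtain B where B: "0 \<le> B" "\<And>x. \<bar>H x\<bar> \<le> B" using bmeas_bound[OF assms(2)] by blast
  have [measurable]: "H \<in> borel_measurable borel" by (rule bmeas_measurable) fact
  show ?thesis unfolding bmeas_def heat_integral_pos[OF t]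
  proof (intro conjI exI allI)
    show "(\<lambda>x. \<integral>y. heat_kernel t x y * H y \<partial>lborel) \<in> borel_measurable borel" by measurable
    show "\<bar>\<integral>y. heat_kernel t x y * H y \<partial>lborel\<bar> \<le> B" for x
      using integral_abs_bound[of lborel "\<lambda>y. heat_kernel t x y * H y"] abs_integral_heat_kernel_le[OF t assms(2) B(2), of x]
      by linarith
  qed
qed (use assms in simp)

text \<open>The heat operator is self-adjoint because its kernel is symmetric; Fubini's theorem
  exchanges the integrals.\<close>

lemma integral_heat_integral:
  assumes "0 \<le> s" "integrable lborel f" "bmeas f" "bmeas H"
  shows "(\<integral>x. f x * heat_integral s x H \<partial>lborel) = (\<integral>y. heat_integral s y f * H y \<partial>lborel)"
proof (cases "s = 0")
  case False
  then have s: "0 < s" using assms by simp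
  obtain B where B: "0 \<le> B" "\<And>x. \<bar>H x\<bar> \<le> B" using bmeas_bound[OF assms(4)] by blast
  have [measurable]: "H \<in> borel_measurable borel" by (rule bmeas_measurable) fact
  have "(\<integral>x. f x * (\<integral>y. heat_kernel s x y * H y \<partial>lborel) \<partial>lborel)
     = (\<integral>y. (\<integral>x. f x * (heat_kernel s x y * H y) \<partial>lborel) \<partial>lborel)"
    by (rule integral_swap[OF assms(2) _ integrable_heat_kernel_mult[OF s assms(4)] abs_integral_heat_kernel_le[OF s assms(4) B(2)]])
      measurable
  also have "\<dots> = (\<integral>y. (\<integral>x. heat_kernel s y x * f x * H y \<partial>lborel) \<partial>lborel)"
    by (simp add: heat_kernel_commute[of s _ "_ :: real"] mult_ac)
  finally show ?thesis unfolding heat_integral_pos[OF s] by simp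
qed simp

text \<open>For positive times the kernel \<open>heat_kernel s x\<close> is itself bounded and
  integrable, so self-adjointness moves the second operator onto it, where the convolution identity
  applies.\<close>

lemma heat_integral_semigroup:
  assumes "0 \<le> s" "0 \<le> u" "bmeas H"
  shows "heat_integral s x (\<lambda>y. heat_integral u y H) = heat_integral (s + u) x H"
proof (cases "s = 0 \<or> u = 0")
  case False
  then have s: "0 < s" "0 < u" using assms by auto
  have k: "bmeas (heat_kernel s x)"
  proof -
    have "heat_kernel s x y \<le> 1 / sqrt (2 * pi * s)" for y
      unfolding heat_kernel_def using s by (intro divide_right_mono) auto
    then show ?thesis using heat_kernel_nonneg[OF s(1)] unfolding bmeas_def
      by (intro conjI exI[of _ "1 / sqrt (2 * pi * s)"]) (auto simp: abs_of_nonneg)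
  qed
  have "heat_integral s x (\<lambda>y. heat_integral u y H) = (\<integral>y. heat_kernel s x y * heat_integral u y H \<partial>lborel)"
    by (rule heat_integral_pos) fact
  also have "\<dots> = (\<integral>y. heat_integral u y (heat_kernel s x) * H y \<partial>lborel)"
    by (rule integral_heat_integral[OF assms(2) integrable_heat_kernel[OF s(1)] k assms(3)])
  also have "(\<lambda>y. heat_integral u y (heat_kernel s x)) = heat_kernel (s + u) x"
  proof
    fix y show "heat_integral u y (heat_kernel s x) = heat_kernel (s + u) x y"
    using heat_kernel_convolution[OF s, of x y, THEN has_bochner_integral_integral_eq]
    unfolding heat_integral_pos[OF s(2)] by (simp add: heat_kernel_commute[of u y] mult.commute)
  qed
  finally show ?thesis using s by (simp add: heat_integral_pos)
qed auto

lemma integrable_heat_integral: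
  assumes "0 \<le> s" "integrable lborel f" "bmeas f"
  shows "integrable lborel (\<lambda>x. heat_integral s x f)"
proof (cases "s = 0")
  case False
  then have s: "0 < s" using assms by simp
  have "integrable (lborel \<Otimes>\<^sub>M lborel) (\<lambda>(x, y). f x * heat_kernel s x y)"
    by (rule pair_integrable[of _ _ 1]) (use assms s integrable_heat_kernel integral_heat_kernel heat_kernel_nonneg[OF s] in \<open>auto simp: abs_of_nonneg\<close>)
  then have "integrable (lborel \<Otimes>\<^sub>M lborel) (\<lambda>(y, x). f x * heat_kernel s x y)"
    using lborel_pair.integrable_product_swap[of "\<lambda>(x, y). f x * heat_kernel s x y"] by simp
  then have "integrable lborel (\<lambda>y. \<integral>x. f x * heat_kernel s x y \<partial>lborel)"
    using lborel_pair.integrable_fst'[of "\<lambda>(y, x). f x * heat_kernel s x y"] by simp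
  then show ?thesis unfolding heat_integral_pos[OF s] by (simp add: heat_kernel_commute[of s _ "_ :: real"] mult.commute)
qed (use assms in simp)

lemma has_integral_heat_heat_integral:
  assumes "0 < s" "0 \<le> u" "bmeas H"
  shows "has_bochner_integral lborel (\<lambda>x. heat_kernel s y x * heat_integral u x H) (heat_integral (s + u) y H)"
  unfolding has_bochner_integral_iff
  using integrable_heat_kernel_mult[OF assms(1) bmeas_heat_integral[OF assms(2,3)]]
    heat_integral_semigroup[OF _ assms(2,3), of s y] assms(1) by (simp add: heat_integral_pos)

section \<open>Pairing through the sign of a difference\<close>

definition sgn_integral :: "(real \<Rightarrow> real) \<Rightarrow> real \<Rightarrow> real" where
  "sgn_integral f z = (\<integral>w. sgn (w - z) * f w \<partial>lborel)"

lemma bmeas_sgn: "bmeas (\<lambda>w. sgn (w - z))" "bmeas (\<lambda>z. sgn (w - z))"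
  unfolding bmeas_def by (auto intro!: exI[of _ 1] simp: sgn_if)

lemma integrable_sgn_mult: "integrable lborel f \<Longrightarrow> integrable lborel (\<lambda>w. sgn (w - z) * f w)" for z :: real
  using integrable_mult_bmeas[OF _ bmeas_sgn(1)[of z], of f] by (simp add: mult.commute)

lemma abs_sgn_integral_le:
  fixes z :: real
  assumes "integrable lborel f"
  shows "(\<integral>w. \<bar>sgn (w - z) * f w\<bar> \<partial>lborel) \<le> (\<integral>w. \<bar>f w\<bar> \<partial>lborel)"
  using assms integrable_sgn_mult[OF assms, of z]
  by (intro Bochner_Integration.integral_mono integrable_abs) (auto simp: abs_mult sgn_if)

lemma bmeas_sgn_integral:
  assumes "integrable lborel f"
  shows "bmeas (sgn_integral f)"
  unfolding bmeas_def
proof (intro conjI exI allI)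
  have [measurable]: "f \<in> borel_measurable borel" using assms by auto
  show "sgn_integral f \<in> borel_measurable borel" unfolding sgn_integral_def by measurable
  show "\<bar>sgn_integral f z\<bar> \<le> (\<integral>w. \<bar>f w\<bar> \<partial>lborel)" for z
    using integral_abs_bound[of lborel "\<lambda>w. sgn (w - z) * f w"] abs_sgn_integral_le[OF assms, of z]
    unfolding sgn_integral_def by linarith
qed

lemma abs_integral_heat_kernel_sgn_le:
  "0 < s \<Longrightarrow> (\<integral>y. \<bar>heat_kernel s x y * sgn (y - z)\<bar> \<partial>lborel) \<le> 1"
  by (rule abs_integral_heat_kernel_le[OF _ bmeas_sgn(1)]) (auto simp: sgn_if)

lemma sgn_integral_antisym:
  assumes "integrable lborel f" "integrable lborel g"
  shows "(\<integral>x. f x * sgn_integral g x \<partial>lborel) = - (\<integral>x. g x * sgn_integral f x \<partial>lborel)"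
proof -
  have [measurable]: "f \<in> borel_measurable borel" "g \<in> borel_measurable borel" using assms by auto
  have "(\<integral>x. f x * sgn_integral g x \<partial>lborel) = (\<integral>y. (\<integral>x. f x * (sgn (y - x) * g y) \<partial>lborel) \<partial>lborel)"
    unfolding sgn_integral_def
    by (rule integral_swap[OF assms(1) _ integrable_sgn_mult[OF assms(2)] abs_sgn_integral_le[OF assms(2)]]) measurable
  also have "\<dots> = (\<integral>y. - (g y * (\<integral>x. sgn (x - y) * f x \<partial>lborel)) \<partial>lborel)"
  proof (rule Bochner_Integration.integral_cong)
    fix y
    have "(\<integral>x. f x * (sgn (y - x) * g y) \<partial>lborel) = (\<integral>x. - (g y) * (sgn (x - y) * f x) \<partial>lborel)"
      by (rule Bochner_Integration.integral_cong) (auto simp: sgn_if)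
    then show "(\<integral>x. f x * (sgn (y - x) * g y) \<partial>lborel) = - (g y * (\<integral>x. sgn (x - y) * f x \<partial>lborel))" by simp
  qed simp
  finally show ?thesis by (simp add: sgn_integral_def)
qed

text \<open>The minus sign comes from exchanging the arguments of \<open>sgn\<close>; it is the one
  in the entry of \<open>form\<close> between \<open>Phi\<close> and \<open>Pt\<close>.\<close>

lemma integral_heat_integral_sgn:
  assumes "0 \<le> s" "integrable lborel f"
  shows "(\<integral>z. f z * heat_integral s y (\<lambda>w. sgn (w - z)) \<partial>lborel) = - heat_integral s y (sgn_integral f)"
proof -
  have [measurable]: "f \<in> borel_measurable borel" using assms by auto
  have flip: "(\<integral>z. f z * sgn (w - z) \<partial>lborel) = - sgn_integral f w" for w
  proof -
    have "(\<integral>z. f z * sgn (w - z) \<partial>lborel) = (\<integral>z. - (sgn (z - w) * f z) \<partial>lborel)"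
      by (rule Bochner_Integration.integral_cong) (auto simp: sgn_if)
    then show ?thesis by (simp add: sgn_integral_def)
  qed
  show ?thesis
  proof (cases "s = 0")
    case False
    then have s: "0 < s" using assms by simp
    have "(\<integral>z. f z * (\<integral>w. heat_kernel s y w * sgn (w - z) \<partial>lborel) \<partial>lborel)
       = (\<integral>w. (\<integral>z. f z * (heat_kernel s y w * sgn (w - z)) \<partial>lborel) \<partial>lborel)"
      by (rule integral_swap[OF assms(2) _ integrable_heat_kernel_mult[OF s bmeas_sgn(1)] abs_integral_heat_kernel_sgn_le[OF s]])
        measurable
    also have "\<dots> = (\<integral>w. heat_kernel s y w * (\<integral>z. f z * sgn (w - z) \<partial>lborel) \<partial>lborel)"
    proof (rule Bochner_Integration.integral_cong)
      fix w
      have "(\<integral>z. f z * (heat_kernel s y w * sgn (w - z)) \<partial>lborel) = (\<integral>z. heat_kernel s y w * (f z * sgn (w - z)) \<partial>lborel)"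
        by (simp add: mult_ac)
      then show "(\<integral>z. f z * (heat_kernel s y w * sgn (w - z)) \<partial>lborel) = heat_kernel s y w * (\<integral>z. f z * sgn (w - z) \<partial>lborel)"
        by simp
    qed simp
    finally show ?thesis unfolding heat_integral_pos[OF s] flip by simp
  qed (simp add: flip)
qed

lemma bmeas_heat_integral_sgn:
  assumes "0 \<le> s"
  shows "bmeas (\<lambda>z. heat_integral s y (\<lambda>w. sgn (w - z)))"
proof (cases "s = 0")
  case False
  then have s: "0 < s" using assms by simp
  show ?thesis unfolding bmeas_def heat_integral_pos[OF s]
  proof (intro conjI exI allI)
    show "(\<lambda>z. \<integral>w. heat_kernel s y w * sgn (w - z) \<partial>lborel) \<in> borel_measurable borel" by measurable
    show "\<bar>\<integral>w. heat_kernel s y w * sgn (w - z) \<partial>lborel\<bar> \<le> 1" for z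
      by (rule order.trans[OF integral_abs_bound abs_integral_heat_kernel_sgn_le[OF s]])
  qed
qed (simp add: bmeas_sgn)

text \<open>This makes the pairing of two \<open>Pt\<close> indices antisymmetric. For
  \<open>s > 0\<close> it is the preceding exchange of integrals with a heat kernel as
  \<open>f\<close>; at time 0 there is only one integral and the oddness of \<open>sgn\<close>
  suffices.\<close>

lemma heat_integral_sgn_antisym:
  assumes "0 \<le> s" "0 \<le> u"
  shows "heat_integral s x (\<lambda>z. heat_integral u y (\<lambda>w. sgn (w - z)))
    = - heat_integral u y (\<lambda>z. heat_integral s x (\<lambda>w. sgn (w - z)))"
proof (cases "s = 0")
  case True
  have "heat_integral u y (\<lambda>w. sgn (w - x)) = - heat_integral u y (\<lambda>z. sgn (x - z))"
  proof (cases "u = 0")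
    case False
    have "(\<integral>w. heat_kernel u y w * sgn (w - x) \<partial>lborel) = (\<integral>w. - (heat_kernel u y w * sgn (x - w)) \<partial>lborel)"
      by (rule Bochner_Integration.integral_cong) (auto simp: sgn_if)
    then show ?thesis using False by (simp add: heat_integral_def)
  qed (auto simp: sgn_if)
  then show ?thesis using True by simp
next
  case False
  then have s: "0 < s" using assms by simp
  have "sgn_integral (heat_kernel s x) z = heat_integral s x (\<lambda>w. sgn (w - z))" for z
    by (simp add: sgn_integral_def heat_integral_pos[OF s] mult.commute)
  then show ?thesis
    using integral_heat_integral_sgn[OF assms(2) integrable_heat_kernel[OF s], of x y]
    by (simp add: heat_integral_pos[OF s] heat_integral_def[of u])
qed

section \<open>The pfaffian form of the process\<close>

lemma power_le_fact_exp: "0 \<le> x \<Longrightarrow> x ^ k \<le> fact k * exp x" for x :: real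
proof -
  assume x: "0 \<le> x"
  have "(\<Sum>n\<in>{k}. x ^ n /\<^sub>R fact n) \<le> (\<Sum>n. x ^ n /\<^sub>R fact n)"
    by (rule sum_le_suminf[OF summable_exp_generic]) (use x in auto)
  then have "x ^ k / fact k \<le> exp x" by (simp add: exp_def divide_inverse mult.commute)
  then show ?thesis by (simp add: field_simps)
qed

lemma poly_gaussian_bound:
  fixes p :: "real poly"
  assumes "0 < d"
  shows "\<exists>C\<ge>0. \<forall>x. \<bar>poly p x\<bar> * exp (- (d * x\<^sup>2)) \<le> C"
proof -
  define C where "C = (\<Sum>k\<le>degree p. \<bar>coeff p k\<bar> * (fact k * exp (1 / (4 * d))))"
  have "\<bar>poly p x\<bar> * exp (- (d * x\<^sup>2)) \<le> C" for x
  proof -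
    \<comment> \<open>Completing the square bounds \<open>\<bar>x\<bar>\<close> by the Gaussian
      exponent plus a constant, and \<open>exp \<bar>x\<bar>\<close> dominates every power.\<close>
    have "0 \<le> (2 * d * \<bar>x\<bar> - 1)\<^sup>2" by simp
    then have "\<bar>x\<bar> \<le> 1 / (4 * d) + d * x\<^sup>2"
      using assms by (simp add: power2_diff power_mult_distrib field_simps power2_eq_square)
    then have e: "exp \<bar>x\<bar> * exp (- (d * x\<^sup>2)) \<le> exp (1 / (4 * d))"
      unfolding exp_add[symmetric] by simp
    have "\<bar>poly p x\<bar> \<le> (\<Sum>k\<le>degree p. \<bar>coeff p k\<bar> * \<bar>x\<bar> ^ k)"
      unfolding poly_altdef by (rule order.trans[OF sum_abs]) (simp add: abs_mult power_abs)
    then have "\<bar>poly p x\<bar> * exp (- (d * x\<^sup>2)) \<le> (\<Sum>k\<le>degree p. \<bar>coeff p k\<bar> * \<bar>x\<bar> ^ k) * exp (- (d * x\<^sup>2))"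
      by (rule mult_right_mono) simp
    also have "\<dots> \<le> C" unfolding C_def sum_distrib_right
    proof (rule sum_mono)
      fix k
      have "\<bar>x\<bar> ^ k * exp (- (d * x\<^sup>2)) \<le> fact k * exp \<bar>x\<bar> * exp (- (d * x\<^sup>2))"
        by (intro mult_right_mono power_le_fact_exp) auto
      also have "\<dots> = fact k * (exp \<bar>x\<bar> * exp (- (d * x\<^sup>2)))" by simp
      also have "\<dots> \<le> fact k * exp (1 / (4 * d))" by (intro mult_left_mono e) auto
      finally show "\<bar>coeff p k\<bar> * \<bar>x\<bar> ^ k * exp (- (d * x\<^sup>2)) \<le> \<bar>coeff p k\<bar> * (fact k * exp (1 / (4 * d)))"
        unfolding mult.assoc by (rule mult_left_mono) simp
    qed
    finally show ?thesis .
  qed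
  moreover have "0 \<le> C" unfolding C_def by (intro sum_nonneg) auto
  ultimately show ?thesis by blast
qed

text \<open>Half of the exponent of the heat kernel absorbs the polynomial, the other half is kept
  as decay.\<close>

lemma poly_heat_kernel_bound:
  assumes "0 < s"
  shows "\<exists>C\<ge>0. \<forall>x. \<bar>poly p x * heat_kernel s 0 x\<bar> \<le> C * exp (- (x\<^sup>2 / (4 * s)))"
proof -
  obtain C where C: "0 \<le> C" "\<And>x. \<bar>poly p x\<bar> * exp (- (1 / (4 * s) * x\<^sup>2)) \<le> C"
    using poly_gaussian_bound[of "1 / (4 * s)" p] assms by auto
  have "\<bar>poly p x * heat_kernel s 0 x\<bar> \<le> C / sqrt (2 * pi * s) * exp (- (x\<^sup>2 / (4 * s)))" for x
  proof -
    have "exp (- (x\<^sup>2 / (2 * s))) = exp (- (1 / (4 * s) * x\<^sup>2)) * exp (- (x\<^sup>2 / (4 * s)))"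
      unfolding exp_add[symmetric] using assms by (intro arg_cong[of _ _ exp]) (simp add: field_simps)
    then have "\<bar>poly p x * heat_kernel s 0 x\<bar> = \<bar>poly p x\<bar> * exp (- (1 / (4 * s) * x\<^sup>2)) * exp (- (x\<^sup>2 / (4 * s))) / sqrt (2 * pi * s)"
      using assms by (simp add: heat_kernel_def abs_mult)
    also have "\<dots> \<le> C * exp (- (x\<^sup>2 / (4 * s))) / sqrt (2 * pi * s)"
      using assms C(2)[of x] by (intro divide_right_mono mult_right_mono) auto
    finally show ?thesis by simp
  qed
  moreover have "0 \<le> C / sqrt (2 * pi * s)" using C assms by simp
  ultimately show ?thesis by blast
qed

lemma integrable_gaussian:
  assumes "0 < d"
  shows "integrable lborel (\<lambda>x::real. exp (- (d * x\<^sup>2)))"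
proof -
  let ?s = "1 / (2 * d)"
  have "integrable lborel (\<lambda>x. sqrt (2 * pi * ?s) * heat_kernel ?s 0 x)"
    using assms by (intro integrable_mult_right integrable_heat_kernel) auto
  moreover have "(\<lambda>x. sqrt (2 * pi * ?s) * heat_kernel ?s 0 x) = (\<lambda>x. exp (- (d * x\<^sup>2)))"
    using assms by (auto simp: heat_kernel_def fun_eq_iff)
  ultimately show ?thesis by metis
qed

lemma poly_heat_kernel_measurable [measurable]: "(\<lambda>x. poly p x * heat_kernel s 0 x) \<in> borel_measurable borel"
proof -
  have "continuous_on UNIV (poly p)" by (intro continuous_intros)
  then have [measurable]: "poly p \<in> borel_measurable borel" by (rule borel_measurable_continuous_onI)
  show ?thesis by measurable
qed

lemma integrable_poly_heat_kernel:
  assumes "0 < s"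
  shows "integrable lborel (\<lambda>x. poly p x * heat_kernel s 0 x)"
proof -
  obtain C where C: "0 \<le> C" "\<And>x. \<bar>poly p x * heat_kernel s 0 x\<bar> \<le> C * exp (- (x\<^sup>2 / (4 * s)))"
    using poly_heat_kernel_bound[OF assms, of p] by blast
  show ?thesis
  proof (rule Bochner_Integration.integrable_bound)
    show "integrable lborel (\<lambda>x. C * exp (- (x\<^sup>2 / (4 * s))))"
      using integrable_gaussian[of "1 / (4 * s)"] assms by simp
    show "AE x in lborel. norm (poly p x * heat_kernel s 0 x) \<le> norm (C * exp (- (x\<^sup>2 / (4 * s))))"
      using C by (intro AE_I2) (auto intro: order.trans)
  qed measurable
qed

lemma bmeas_poly_heat_kernel:
  assumes "0 < s"
  shows "bmeas (\<lambda>x. poly p x * heat_kernel s 0 x)"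
proof -
  obtain C where C: "0 \<le> C" "\<And>x. \<bar>poly p x * heat_kernel s 0 x\<bar> \<le> C * exp (- (x\<^sup>2 / (4 * s)))"
    using poly_heat_kernel_bound[OF assms, of p] by blast
  have "C * exp (- (x\<^sup>2 / (4 * s))) \<le> C * 1" for x
    using C(1) assms by (intro mult_left_mono) auto
  then have "\<bar>poly p x * heat_kernel s 0 x\<bar> \<le> C" for x using C(2)[of x] by (metis mult.right_neutral order.trans)
  then show ?thesis unfolding bmeas_def using poly_heat_kernel_measurable by blast
qed

section \<open>Indices and the antisymmetric form\<close>

datatype idx = Phi nat | One nat nat | Pt nat nat

text \<open>The \<open>Phi\<close> indices come first, then time, then the number of the point. The
  two indices of a point are neighbours, as \<open>pf_integrate_out\<close> requires, and the
  \<open>Phi\<close> indices form an initial block, as \<open>pf_schur\<close> requires. The order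
  is also that of the rows of \<open>A_matrix\<close>.\<close>

fun idx_key :: "idx \<Rightarrow> nat \<times> nat \<times> nat" where
  "idx_key (Phi i) = (0, i, 0)"
| "idx_key (One \<mu> k) = (Suc \<mu>, k, 0)"
| "idx_key (Pt \<mu> k) = (Suc \<mu>, k, 1)"

definition lex3 :: "nat \<times> nat \<times> nat \<Rightarrow> nat \<times> nat \<times> nat \<Rightarrow> bool" where
  "lex3 p q = (case (p, q) of ((a, b, c), (a', b', c')) \<Rightarrow> a < a' \<or> a = a' \<and> (b < b' \<or> b = b' \<and> c < c'))"

definition idx_sgn :: "idx \<Rightarrow> idx \<Rightarrow> real" where
  "idx_sgn p q = (if lex3 (idx_key p) (idx_key q) then 1 else -1)"

lemma idx_sgn_sign_function: "sign_function idx_sgn"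
proof
  fix p q :: idx
  assume "p \<noteq> q"
  then have "idx_key p \<noteq> idx_key q" by (cases p; cases q) auto
  then show "idx_sgn q p = - idx_sgn p q" by (auto simp: idx_sgn_def lex3_def split: prod.splits)
qed (simp add: idx_sgn_def)

interpretation idx: sign_function idx_sgn by (rule idx_sgn_sign_function)

locale noncolliding_setting =
  fixes N M :: nat and t :: "nat \<Rightarrow> real" and P :: "nat \<Rightarrow> real poly"
  assumes N: "N \<ge> 2" "even N" and M: "M \<ge> 1" and t0: "t 0 = 0" and t_mono: "strict_mono_on {0..M+1} t"
    and degP: "\<And>i. i < N \<Longrightarrow> degree (P i) = i \<and> coeff (P i) i \<noteq> 0"
begin

lemma t_less: "\<mu> < \<nu> \<Longrightarrow> \<nu> \<le> M + 1 \<Longrightarrow> t \<mu> < t \<nu>"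
  using t_mono by (auto simp: strict_mono_on_def)

lemma t_le: "\<mu> \<le> \<nu> \<Longrightarrow> \<nu> \<le> M + 1 \<Longrightarrow> t \<mu> \<le> t \<nu>"
  using t_less[of \<mu> \<nu>] by (cases "\<mu> = \<nu>") auto

lemma t_pos: "0 < \<mu> \<Longrightarrow> \<mu> \<le> M + 1 \<Longrightarrow> 0 < t \<mu>"
  using t_less[of 0 \<mu>] t0 by simp

lemma t1_pos: "0 < t 1" by (rule t_pos) auto

abbreviation "phi' \<equiv> phi P t"
abbreviation "psi' \<equiv> psi M P t"

lemma bmeas_phi: "1 \<le> \<mu> \<Longrightarrow> \<mu> \<le> M + 1 \<Longrightarrow> bmeas (phi' i \<mu>)"
  unfolding phi_def[abs_def] using t_le[of 1 \<mu>] by (intro bmeas_heat_integral bmeas_poly_heat_kernel t1_pos) auto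

lemma integrable_phi: "1 \<le> \<mu> \<Longrightarrow> \<mu> \<le> M + 1 \<Longrightarrow> integrable lborel (phi' i \<mu>)"
  unfolding phi_def[abs_def] using t_le[of 1 \<mu>]
  by (intro integrable_heat_integral bmeas_poly_heat_kernel integrable_poly_heat_kernel t1_pos) auto

lemma heat_integral_phi:
  assumes "1 \<le> \<mu>" "\<mu> \<le> \<nu>" "\<nu> \<le> M + 1"
  shows "heat_integral (t \<nu> - t \<mu>) x (phi' i \<mu>) = phi' i \<nu> x"
  unfolding phi_def[abs_def]
  using heat_integral_semigroup[of "t \<nu> - t \<mu>" "t \<mu> - t 1"] t_le[of 1 \<mu>] t_le[of \<mu> \<nu>] assms
    bmeas_poly_heat_kernel[OF t1_pos]
  by simp

lemma has_integral_phi_heat_kernel: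
  assumes "1 \<le> \<mu>" "\<mu> < \<nu>" "\<nu> \<le> M + 1"
  shows "has_bochner_integral lborel (\<lambda>x. phi' i \<mu> x * heat_kernel (t \<nu> - t \<mu>) x z) (phi' i \<nu> z)"
proof -
  have s: "0 < t \<nu> - t \<mu>" using t_less assms by simp
  have "integrable lborel (\<lambda>x. heat_kernel (t \<nu> - t \<mu>) z x * phi' i \<mu> x)"
    using s assms by (intro integrable_heat_kernel_mult bmeas_phi) auto
  moreover have "(\<integral>x. heat_kernel (t \<nu> - t \<mu>) z x * phi' i \<mu> x \<partial>lborel) = phi' i \<nu> z"
    using heat_integral_phi[of \<mu> \<nu> z i] assms s by (simp add: heat_integral_pos)
  ultimately show ?thesis
    by (simp add: has_bochner_integral_iff heat_kernel_commute[of _ _ z] mult.commute)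
qed

text \<open>Self-adjointness shifts the remaining flow from \<open>H\<close> to \<open>phi'\<close>,
  so the value no longer depends on \<mu>.\<close>

lemma has_integral_phi_heat_integral:
  assumes "1 \<le> \<mu>" "\<mu> \<le> M + 1" "bmeas H"
  shows "has_bochner_integral lborel (\<lambda>x. phi' i \<mu> x * heat_integral (t (M + 1) - t \<mu>) x H)
    (\<integral>z. phi' i (M + 1) z * H z \<partial>lborel)"
proof -
  have s: "0 \<le> t (M + 1) - t \<mu>" using t_le assms by simp
  have "(\<integral>x. phi' i \<mu> x * heat_integral (t (M + 1) - t \<mu>) x H \<partial>lborel)
    = (\<integral>z. heat_integral (t (M + 1) - t \<mu>) z (phi' i \<mu>) * H z \<partial>lborel)"
    using assms by (intro integral_heat_integral s integrable_phi bmeas_phi)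
  also have "\<dots> = (\<integral>z. phi' i (M + 1) z * H z \<partial>lborel)"
    using heat_integral_phi[of \<mu> "M + 1"] assms by simp
  finally show ?thesis
    unfolding has_bochner_integral_iff using assms s
    by (auto intro!: integrable_mult_bmeas integrable_phi bmeas_heat_integral)
qed

lemma psi_eq: "psi' i \<mu> x = heat_integral (t (M + 1) - t \<mu>) x (sgn_integral (phi' i (M + 1)))"
  unfolding psi_def sgn_integral_def ..

lemma A0_eq:
  assumes "i < N" "j < N"
  shows "A0 N M P t $$ (i, j) = (\<integral>y. phi' i (M + 1) y * sgn_integral (phi' j (M + 1)) y \<partial>lborel)"
proof -
  have "(\<integral>y'. sgn (y' - y) * phi' i (M + 1) y * phi' j (M + 1) y' \<partial>lborel)
      = phi' i (M + 1) y * sgn_integral (phi' j (M + 1)) y" for y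
  proof -
    have "(\<integral>y'. sgn (y' - y) * phi' i (M + 1) y * phi' j (M + 1) y' \<partial>lborel)
      = (\<integral>y'. phi' i (M + 1) y * (sgn (y' - y) * phi' j (M + 1) y') \<partial>lborel)" by (simp add: mult_ac)
    then show ?thesis by (simp add: sgn_integral_def)
  qed
  then show ?thesis using assms by (simp add: A0_def)
qed

lemma A0_antisym: "i < N \<Longrightarrow> j < N \<Longrightarrow> A0 N M P t $$ (j, i) = - A0 N M P t $$ (i, j)"
  unfolding A0_eq by (rule sgn_integral_antisym) (intro integrable_phi; simp)+

text \<open>The kernels of the theorem arise from this form as a Schur complement, see
  \<open>kernel_entries\<close>. A \<open>Pt\<close> and a \<open>One\<close> pair only if time
  strictly increases; in particular the two indices of one point pair to 0.\<close>

fun form :: "(nat \<Rightarrow> nat \<Rightarrow> real) \<Rightarrow> idx \<Rightarrow> idx \<Rightarrow> real" where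
  "form x (Phi i) (Phi j) = A0 N M P t $$ (i, j)"
| "form x (Phi i) (One \<nu> l) = phi' i \<nu> (x \<nu> l)"
| "form x (Phi i) (Pt \<nu> l) = - psi' i \<nu> (x \<nu> l)"
| "form x (One \<mu> k) (Phi j) = - phi' j \<mu> (x \<mu> k)"
| "form x (One \<mu> k) (One \<nu> l) = 0"
| "form x (One \<mu> k) (Pt \<nu> l) = - (if \<nu> < \<mu> then heat_kernel (t \<mu> - t \<nu>) (x \<nu> l) (x \<mu> k) else 0)"
| "form x (Pt \<mu> k) (Phi j) = psi' j \<mu> (x \<mu> k)"
| "form x (Pt \<mu> k) (One \<nu> l) = (if \<mu> < \<nu> then heat_kernel (t \<nu> - t \<mu>) (x \<mu> k) (x \<nu> l) else 0)"
| "form x (Pt \<mu> k) (Pt \<nu> l) = heat_integral (t (M + 1) - t \<mu>) (x \<mu> k)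
     (\<lambda>z. heat_integral (t (M + 1) - t \<nu>) (x \<nu> l) (\<lambda>w. sgn (w - z)))"

definition pts :: "(nat \<Rightarrow> nat) \<Rightarrow> (nat \<times> nat) set" where
  "pts n = (SIGMA \<mu>:{1..M+1}. {..<n \<mu>})"

definition idxs :: "(nat \<Rightarrow> nat) \<Rightarrow> idx set" where
  "idxs n = Phi ` {..<N} \<union> case_prod One ` pts n \<union> case_prod Pt ` pts n"

lemma finite_pts: "finite (pts n)" by (simp add: pts_def)

lemma finite_idxs: "finite (idxs n)" by (simp add: idxs_def finite_pts)

lemma idxs_iff [simp]:
  "Phi i \<in> idxs n \<longleftrightarrow> i < N"
  "One \<mu> k \<in> idxs n \<longleftrightarrow> 1 \<le> \<mu> \<and> \<mu> \<le> M + 1 \<and> k < n \<mu>"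
  "Pt \<mu> k \<in> idxs n \<longleftrightarrow> 1 \<le> \<mu> \<and> \<mu> \<le> M + 1 \<and> k < n \<mu>"
  by (auto simp: idxs_def pts_def image_iff)

lemma card_idxs: "card (idxs n) = N + 2 * card (pts n)"
proof -
  have "card (idxs n) = card (Phi ` {..<N} \<union> case_prod One ` pts n) + card (case_prod Pt ` pts n)"
    unfolding idxs_def by (rule card_Un_disjoint) (auto simp: finite_pts)
  also have "card (Phi ` {..<N} \<union> case_prod One ` pts n) = card (Phi ` {..<N}) + card (case_prod One ` pts n)"
    by (rule card_Un_disjoint) (auto simp: finite_pts)
  also have "card (Phi ` {..<N}) = N" by (simp add: card_image inj_on_def)
  also have "card (case_prod One ` pts n) = card (pts n)" by (rule card_image) (auto simp: inj_on_def)
  also have "card (case_prod Pt ` pts n) = card (pts n)" by (rule card_image) (auto simp: inj_on_def)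
  finally show ?thesis by simp
qed

lemma even_idxs: "even (card (idxs n))" using N by (simp add: card_idxs)

lemma form_antisym: "skew_on (idxs n) (form x)"
proof (rule skew_onI)
  fix p q assume "p \<in> idxs n" "q \<in> idxs n" "p \<noteq> q"
  then show "form x q p = - form x p q"
    by (cases p; cases q) (auto intro: A0_antisym heat_integral_sgn_antisym simp: t_le)
qed

text \<open>Integrating over y glues the stretch from \<open>p\<close> up to time
  \<open>t \<mu>\<close> to the stretch from there to \<open>q\<close>. This works because in all
  these cases \<open>p\<close> starts before the point and \<open>q\<close> lies after it or is
  compared at the final time.\<close>

lemma form_reproducing:
  fixes \<mu> k :: nat and x :: "nat \<Rightarrow> nat \<Rightarrow> real"
  defines "X y \<equiv> x(\<mu> := (x \<mu>)(k := y))"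
  assumes mu: "1 \<le> \<mu>" "\<mu> \<le> M + 1" and k: "k = n \<mu>"
    and p: "p \<in> idxs n" "p \<in> Phi ` {..<N} \<or> (\<exists>\<kappa> j. p = Pt \<kappa> j \<and> \<kappa> < \<mu>)"
    and q: "q \<in> idxs n" "\<not> (\<exists>\<kappa> j. q = One \<kappa> j \<and> \<kappa> \<le> \<mu>)"
  shows "has_bochner_integral lborel (\<lambda>y. form (X y) p (One \<mu> k) * form (X y) (Pt \<mu> k) q) (form x p q)"
proof -
  let ?u = "t (M + 1) - t \<mu>"
  have u: "0 \<le> ?u" using t_le mu by simp
  have X: "X y \<mu> k = y" "\<And>\<nu> l. \<nu> \<noteq> \<mu> \<or> l < n \<nu> \<Longrightarrow> X y \<nu> l = x \<nu> l" for y
    by (auto simp: X_def k)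
  \<comment> \<open>Apart from the pairings with \<open>One\<close>, every entry of the row
    \<open>Pt \<mu> k\<close> is the heat integral of some function at the final time, so the
    remaining cases of \<open>q\<close> are treated at once. The value for \<open>One\<close> is a
    dummy.\<close>
  define H where "H = (case q of Phi j \<Rightarrow> sgn_integral (phi' j (M + 1))
     | Pt \<nu> l \<Rightarrow> (\<lambda>z. heat_integral (t (M + 1) - t \<nu>) (x \<nu> l) (\<lambda>w. sgn (w - z))) | One \<nu> l \<Rightarrow> (\<lambda>_. 0))"
  have bH: "bmeas H" unfolding H_def using q(1)
    by (cases q) (auto intro!: bmeas_sgn_integral integrable_phi bmeas_heat_integral_sgn t_le simp: bmeas_def[of "\<lambda>_. 0"])
  have Hq: "form (X y) (Pt \<mu> k) q = heat_integral ?u y H" if "\<And>\<nu> l. q \<noteq> One \<nu> l" for y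
    using q(1) that by (cases q) (auto simp: H_def X psi_eq)
  show ?thesis
  proof (cases "\<exists>\<kappa> j. p = Pt \<kappa> j \<and> \<kappa> < \<mu>")
    case True
    then obtain \<kappa> j where pp: "p = Pt \<kappa> j" "\<kappa> < \<mu>" by auto
    have lam: "1 \<le> \<kappa>" "j < n \<kappa>" "\<kappa> \<le> M + 1" using p(1) pp by auto
    have s: "0 < t \<mu> - t \<kappa>" using t_less[OF pp(2) mu(2)] by simp
    have P: "form (X y) p (One \<mu> k) = heat_kernel (t \<mu> - t \<kappa>) (x \<kappa> j) y" for y
      using pp by (simp add: X lam)
    show ?thesis
    proof (cases "\<exists>\<nu> l. q = One \<nu> l")
      case True
      then obtain \<nu> l where qq: "q = One \<nu> l" "\<mu> < \<nu>" "\<nu> \<le> M + 1" "l < n \<nu>"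
        using q by (cases q) auto
      have "has_bochner_integral lborel (\<lambda>y. heat_kernel (t \<mu> - t \<kappa>) (x \<kappa> j) y * heat_kernel (t \<nu> - t \<mu>) y (x \<nu> l))
        (heat_kernel ((t \<mu> - t \<kappa>) + (t \<nu> - t \<mu>)) (x \<kappa> j) (x \<nu> l))"
        using s t_less[OF qq(2,3)] by (intro heat_kernel_convolution) auto
      then show ?thesis unfolding P using qq pp by (simp add: X)
    next
      case False
      then have *: "form (X y) (Pt \<mu> k) q = heat_integral ?u y H" for y by (intro Hq) auto
      have "form x p q = heat_integral (t (M + 1) - t \<kappa>) (x \<kappa> j) H"
        using False pp by (cases q) (auto simp: H_def psi_eq)
      moreover have "has_bochner_integral lborel (\<lambda>y. heat_kernel (t \<mu> - t \<kappa>) (x \<kappa> j) y * heat_integral ?u y H)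
         (heat_integral ((t \<mu> - t \<kappa>) + ?u) (x \<kappa> j) H)"
        by (rule has_integral_heat_heat_integral[OF s u bH])
      ultimately show ?thesis unfolding P * by simp
    qed
  next
    case False
    then obtain i where pp: "p = Phi i" "i < N" using p by auto
    have P: "form (X y) p (One \<mu> k) = phi' i \<mu> y" for y using pp by (simp add: X)
    show ?thesis
    proof (cases "\<exists>\<nu> l. q = One \<nu> l")
      case True
      then obtain \<nu> l where qq: "q = One \<nu> l" "\<mu> < \<nu>" "\<nu> \<le> M + 1" "l < n \<nu>"
        using q by (cases q) auto
      then show ?thesis unfolding P using has_integral_phi_heat_kernel[OF mu(1) qq(2,3), of i "x \<nu> l"] qq pp
        by (simp add: X)
    next
      case False
      then have *: "form (X y) (Pt \<mu> k) q = heat_integral ?u y H" for y by (intro Hq) auto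
      have "form x p q = (\<integral>z. phi' i (M + 1) z * H z \<partial>lborel)"
      proof (cases q)
        case (Phi j)
        then show ?thesis using A0_eq q(1) pp by (simp add: H_def)
      next
        case (Pt \<nu> l)
        then have "0 \<le> t (M + 1) - t \<nu>" using q(1) t_le by simp
        then show ?thesis
          using Pt pp integral_heat_integral_sgn[of "t (M + 1) - t \<nu>" "phi' i (M + 1)" "x \<nu> l"] integrable_phi[of "M + 1" i]
          by (simp add: H_def psi_eq)
      qed (use False in auto)
      then show ?thesis unfolding P * using has_integral_phi_heat_integral[OF mu bH, of i] by simp
    qed
  qed
qed

theorem pf_integrate_point:
  fixes \<mu> :: nat and n :: "nat \<Rightarrow> nat" and x :: "nat \<Rightarrow> nat \<Rightarrow> real"
  assumes mu: "1 \<le> \<mu>" "\<mu> \<le> M + 1"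
  defines "X y \<equiv> x(\<mu> := (x \<mu>)(n \<mu> := y))"
  shows "has_bochner_integral lborel (\<lambda>y. pf idx_sgn (form (X y)) (idxs (n(\<mu> := Suc (n \<mu>)))))
     ((real N - real (n \<mu>)) * pf idx_sgn (form x) (idxs n))"
proof -
  let ?k = "n \<mu>"
  let ?b = "One \<mu> ?k" and ?v = "Pt \<mu> ?k"
  \<comment> \<open>\<open>A\<close> holds the indices that can pair with
    \<open>One \<mu> (n \<mu>)\<close>, and \<open>B\<close> those \<open>One\<close> indices with
    which \<open>Pt \<mu> (n \<mu>)\<close> cannot pair. Earlier times contribute equally to both,
    so the cardinalities differ by N minus the number of points already at time \<mu>.\<close>
  define A where "A = Phi ` {..<N} \<union> case_prod Pt ` (SIGMA \<kappa>:{1..<\<mu>}. {..<n \<kappa>})"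
  define B where "B = case_prod One ` (SIGMA \<kappa>:{1..\<mu>}. {..<n \<kappa>})"
  have ins: "idxs (n(\<mu> := Suc ?k)) = insert ?b (insert ?v (idxs n))"
  proof (rule Set.set_eqI)
    fix p show "p \<in> idxs (n(\<mu> := Suc ?k)) \<longleftrightarrow> p \<in> insert ?b (insert ?v (idxs n))"
      using mu by (cases p) auto
  qed
  have A_iff: "p \<in> A \<longleftrightarrow> p \<in> Phi ` {..<N} \<or> (\<exists>\<kappa> j. p = Pt \<kappa> j \<and> \<kappa> < \<mu>)" if "p \<in> idxs n" for p
    using that by (cases p) (auto simp: A_def image_iff)
  have B_iff: "p \<in> B \<longleftrightarrow> (\<exists>\<kappa> j. p = One \<kappa> j \<and> \<kappa> \<le> \<mu>)" if "p \<in> idxs n" for p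
    using that by (cases p) (auto simp: B_def image_iff)
  have cA: "card A = N + (\<Sum>\<kappa>\<in>{1..<\<mu>}. n \<kappa>)"
  proof -
    have "card A = card (Phi ` {..<N}) + card (case_prod Pt ` (SIGMA \<kappa>:{1..<\<mu>}. {..<n \<kappa>}))"
      unfolding A_def by (rule card_Un_disjoint) auto
    also have "card (Phi ` {..<N}) = N" by (simp add: card_image inj_on_def)
    also have "card (case_prod Pt ` (SIGMA \<kappa>:{1..<\<mu>}. {..<n \<kappa>})) = card (SIGMA \<kappa>:{1..<\<mu>}. {..<n \<kappa>})"
      by (rule card_image) (auto simp: inj_on_def)
    finally show ?thesis by simp
  qed
  have "card B = card (SIGMA \<kappa>:{1..\<mu>}. {..<n \<kappa>})"
    unfolding B_def by (rule card_image) (auto simp: inj_on_def)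
  also have "\<dots> = (\<Sum>\<kappa>\<in>{1..\<mu>}. n \<kappa>)" by simp
  also have "{1..\<mu>} = insert \<mu> {1..<\<mu>}" using mu by auto
  finally have cB: "card B = n \<mu> + (\<Sum>\<kappa>\<in>{1..<\<mu>}. n \<kappa>)" by simp
  have X: "X y \<mu> ?k = y" "\<And>\<nu> l. \<nu> \<noteq> \<mu> \<or> l < n \<nu> \<Longrightarrow> X y \<nu> l = x \<nu> l" for y
    by (auto simp: X_def)
  have "has_bochner_integral lborel (\<lambda>y. pf idx_sgn (form (X y)) (insert ?b (insert ?v (idxs n))))
      ((real (card A) - real (card B)) * pf idx_sgn (form x) (idxs n))"
  proof (rule idx.pf_integrate_out[OF finite_idxs even_idxs])
    show "idx_sgn ?b r = idx_sgn ?v r" if "r \<in> idxs n" for r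
      using that by (cases r) (auto simp: idx_sgn_def lex3_def)
    show "idx_sgn ?b ?v = 1" by (simp add: idx_sgn_def lex3_def)
    show "skew_on (insert ?b (insert ?v (idxs n))) (form (X y))" for y
      unfolding ins[symmetric] by (rule form_antisym)
    show "form (X y) p q = form x p q" if "p \<in> idxs n" "q \<in> idxs n" for y p q
      using that by (cases p; cases q) (auto simp: X)
    show "form x p q = 0" if "p \<in> B" "q \<in> idxs n - A" for p q
      using that by (cases q) (auto simp: B_def A_def image_iff)
    show "has_bochner_integral lborel (\<lambda>y. form (X y) p ?b * form (X y) ?v q) (if p \<in> A \<and> q \<notin> B then form x p q else 0)"
      if pq: "p \<in> idxs n" "q \<in> idxs n" for p q
    proof (cases "p \<in> A \<and> q \<notin> B")
      case True
      then show ?thesis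
        using form_reproducing[OF mu refl pq(1) _ pq(2), of x] A_iff[OF pq(1)] B_iff[OF pq(2)] unfolding X_def by simp
    next
      case False
      then have z: "form (X y) p ?b * form (X y) ?v q = 0" for y
        using pq by (cases p; cases q) (auto simp: A_iff B_iff)
      show ?thesis unfolding z if_not_P[OF False] by (rule has_bochner_integral_zero)
    qed
  qed (use mu in \<open>auto simp: A_def B_def\<close>)
  then show ?thesis unfolding ins cA cB by simp
qed

end

section \<open>The weight of a configuration and its integrals\<close>

lemma measurable_det [measurable (raw)]:
  assumes "\<And>i j. i < n \<Longrightarrow> j < n \<Longrightarrow> (\<lambda>z. f z i j) \<in> borel_measurable K"
  shows "(\<lambda>z. Determinant.det (mat n n (\<lambda>(i, j). f z i j :: real))) \<in> borel_measurable K"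
proof -
  have "(\<lambda>z. signof p * (\<Prod>i = 0..<n. mat n n (\<lambda>(i, j). f z i j) $$ (i, p i))) \<in> borel_measurable K"
    if p: "p permutes {0..<n}" for p
  proof -
    have "(\<lambda>z. mat n n (\<lambda>(i, j). f z i j) $$ (i, p i)) \<in> borel_measurable K" if "i \<in> {0..<n}" for i
    proof -
      have "p i < n" using permutes_in_image[OF p, of i] that by simp
      then show ?thesis using assms[of i "p i"] that by simp
    qed
    then show ?thesis by (intro borel_measurable_times borel_measurable_prod) auto
  qed
  then show ?thesis
    unfolding det_def'[OF mat_carrier] by (intro borel_measurable_sum) auto
qed

lemma abs_det_le:
  fixes f :: "nat \<Rightarrow> nat \<Rightarrow> real"
  assumes "\<And>p. p permutes {0..<n} \<Longrightarrow> (\<Prod>i = 0..<n. \<bar>f i (p i)\<bar>) \<le> C"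
  shows "\<bar>Determinant.det (mat n n (\<lambda>(i, j). f i j))\<bar> \<le> fact n * C"
proof -
  have "\<bar>Determinant.det (mat n n (\<lambda>(i, j). f i j))\<bar>
    \<le> (\<Sum>p | p permutes {0..<n}. \<bar>signof p * (\<Prod>i = 0..<n. mat n n (\<lambda>(i, j). f i j) $$ (i, p i))\<bar>)"
    unfolding det_def'[OF mat_carrier] by (rule sum_abs)
  also have "\<dots> \<le> (\<Sum>p | p permutes {0..<n}. C)"
  proof (rule sum_mono)
    fix p assume "p \<in> {p. p permutes {0..<n}}"
    then have p: "p permutes {0..<n}" by simp
    have "\<bar>signof p * (\<Prod>i = 0..<n. mat n n (\<lambda>(i, j). f i j) $$ (i, p i))\<bar> = (\<Prod>i = 0..<n. \<bar>f i (p i)\<bar>)"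
      unfolding abs_mult abs_prod using permutes_in_image[OF p]
      by (auto simp: sign_def intro!: prod.cong)
    then show "\<bar>signof p * (\<Prod>i = 0..<n. mat n n (\<lambda>(i, j). f i j) $$ (i, p i))\<bar> \<le> C"
      using assms[OF p] by simp
  qed
  also have "\<dots> = fact n * C" by (simp add: card_permutations)
  finally show ?thesis .
qed

text \<open>The bound on the entries separates rows from columns, so every permutation in the
  Leibniz formula yields the same product.\<close>

lemma abs_det_gaussian_le:
  fixes f :: "nat \<Rightarrow> nat \<Rightarrow> real"
  assumes "\<And>i j. i < n \<Longrightarrow> j < n \<Longrightarrow> \<bar>f i j\<bar> \<le> c i * exp (- g i) * exp (- h j)" "\<And>i. 0 \<le> c i"
  shows "\<bar>Determinant.det (mat n n (\<lambda>(i, j). f i j))\<bar>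
    \<le> fact n * (\<Prod>i<n. c i) * exp (- (\<Sum>i<n. g i)) * exp (- (\<Sum>j<n. h j))"
proof -
  have "\<bar>Determinant.det (mat n n (\<lambda>(i, j). f i j))\<bar>
      \<le> fact n * ((\<Prod>i<n. c i) * exp (- (\<Sum>i<n. g i)) * exp (- (\<Sum>j<n. h j)))"
  proof (rule abs_det_le)
    fix p assume p: "p permutes {0..<n}"
    have "(\<Prod>i = 0..<n. \<bar>f i (p i)\<bar>) \<le> (\<Prod>i = 0..<n. c i * exp (- g i) * exp (- h (p i)))"
      using permutes_in_image[OF p] assms(1) by (intro prod_mono) auto
    also have "\<dots> = (\<Prod>i<n. c i) * (\<Prod>i<n. exp (- g i)) * (\<Prod>i\<in>{..<n}. exp (- h (p i)))"
      by (simp add: prod.distrib lessThan_atLeast0)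
    also have "(\<Prod>i\<in>{..<n}. exp (- h (p i))) = (\<Prod>j\<in>{..<n}. exp (- h j))"
      using p by (intro prod.permute[symmetric, unfolded o_def]) (simp add: lessThan_atLeast0)
    finally show "(\<Prod>i = 0..<n. \<bar>f i (p i)\<bar>) \<le> (\<Prod>i<n. c i) * exp (- (\<Sum>i<n. g i)) * exp (- (\<Sum>j<n. h j))"
      by (simp add: exp_sum sum_negf[symmetric])
  qed
  then show ?thesis by simp
qed

text \<open>A heat kernel alone does not decay along the diagonal \<open>x = y\<close>. Part of the
  decay in x, supplied by the preceding time, is passed on to y.\<close>

lemma heat_kernel_det_gaussian:
  assumes "0 < s" "0 < a"
  shows "\<exists>C\<ge>0. \<exists>b>0. b \<le> a \<and> (\<forall>x y. \<bar>Determinant.det (mat n n (\<lambda>(i, j). heat_kernel s (x i) (y j)))\<bar> * exp (- (\<Sum>i<n. a * (x i)\<^sup>2))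
     \<le> C * exp (- (\<Sum>i<n. b * (x i)\<^sup>2)) * exp (- (\<Sum>i<n. b * (y i)\<^sup>2)))"
proof -
  \<comment> \<open>From \<open>y^2 \<le> 2 x^2 + 2 (x - y)^2\<close>, decay b in both variables
    costs 3b in x and 2b in x - y. The first is paid by a, the second by the exponent
    \<open>1 / (2 * s)\<close> of the kernel.\<close>
  define b where "b = min (a / 3) (1 / (4 * s))"
  have b: "b > 0" "3 * b \<le> a" "2 * b \<le> 1 / (2 * s)" "b \<le> a" using assms by (auto simp: b_def min_def field_simps)
  define c where "c = 1 / sqrt (2 * pi * s)"
  have c: "0 \<le> c" using assms by (simp add: c_def)
  have k: "\<bar>heat_kernel s x y\<bar> \<le> c * exp (- (b * x\<^sup>2 - a * x\<^sup>2)) * exp (- (b * y\<^sup>2))" for x y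
  proof -
    have "0 \<le> (x - (y - x))\<^sup>2" by simp
    then have "y\<^sup>2 \<le> 2 * x\<^sup>2 + 2 * (x - y)\<^sup>2" by (simp add: power2_eq_square algebra_simps)
    then have "b * y\<^sup>2 \<le> b * (2 * x\<^sup>2 + 2 * (x - y)\<^sup>2)" using b by (intro mult_left_mono) auto
    moreover have "2 * b * (x - y)\<^sup>2 \<le> (x - y)\<^sup>2 / (2 * s)" using mult_right_mono[OF b(3), of "(x - y)\<^sup>2"] by simp
    moreover have "3 * b * x\<^sup>2 \<le> a * x\<^sup>2" using b(2) by (rule mult_right_mono) simp
    ultimately have "- ((x - y)\<^sup>2 / (2 * s)) \<le> - (b * x\<^sup>2 - a * x\<^sup>2) + - (b * y\<^sup>2)" by (simp add: algebra_simps)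
    then have "exp (- ((x - y)\<^sup>2 / (2 * s))) \<le> exp (- (b * x\<^sup>2 - a * x\<^sup>2)) * exp (- (b * y\<^sup>2))"
      unfolding exp_add[symmetric] by simp
    then have "c * exp (- ((x - y)\<^sup>2 / (2 * s))) \<le> c * (exp (- (b * x\<^sup>2 - a * x\<^sup>2)) * exp (- (b * y\<^sup>2)))"
      using c by (rule mult_left_mono)
    then show ?thesis unfolding abs_of_nonneg[OF heat_kernel_nonneg[OF assms(1)]]
      by (simp add: heat_kernel_def c_def)
  qed
  have "\<bar>Determinant.det (mat n n (\<lambda>(i, j). heat_kernel s (x i) (y j)))\<bar> * exp (- (\<Sum>i<n. a * (x i)\<^sup>2))
     \<le> fact n * c ^ n * exp (- (\<Sum>i<n. b * (x i)\<^sup>2)) * exp (- (\<Sum>i<n. b * (y i)\<^sup>2))" for x y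
  proof -
    have "\<bar>Determinant.det (mat n n (\<lambda>(i, j). heat_kernel s (x i) (y j)))\<bar>
      \<le> fact n * (\<Prod>i<n. c) * exp (- (\<Sum>i<n. b * (x i)\<^sup>2 - a * (x i)\<^sup>2)) * exp (- (\<Sum>j<n. b * (y j)\<^sup>2))"
      by (rule abs_det_gaussian_le[OF k c])
    from mult_right_mono[OF this, of "exp (- (\<Sum>i<n. a * (x i)\<^sup>2))"]
    have "\<bar>Determinant.det (mat n n (\<lambda>(i, j). heat_kernel s (x i) (y j)))\<bar> * exp (- (\<Sum>i<n. a * (x i)\<^sup>2))
      \<le> fact n * c ^ n * (exp (- (\<Sum>i<n. b * (x i)\<^sup>2 - a * (x i)\<^sup>2)) * exp (- (\<Sum>i<n. a * (x i)\<^sup>2))) * exp (- (\<Sum>j<n. b * (y j)\<^sup>2))"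
      by (simp add: mult_ac)
    also have "exp (- (\<Sum>i<n. b * (x i)\<^sup>2 - a * (x i)\<^sup>2)) * exp (- (\<Sum>i<n. a * (x i)\<^sup>2)) = exp (- (\<Sum>i<n. b * (x i)\<^sup>2))"
      unfolding exp_add[symmetric] by (simp add: sum_subtractf)
    finally show ?thesis .
  qed
  then show ?thesis using b c by (intro exI[of _ "fact n * c ^ n"] exI[of _ b]) auto
qed

text \<open>The signs between \<open>One\<close> and \<open>Pt\<close> at the same time, which
  cancel the sign in \<open>pf_extract_det\<close>.\<close>

lemma prod_one_pt_sign: "(\<Prod>j<n. \<Prod>l<n. if j \<le> l then 1 else -1 :: real) = (-1) ^ (n * (n - 1) div 2)"
proof -
  have "(\<Prod>l<n. if j \<le> l then 1 else -1 :: real) = (-1) ^ j" if "j < n" for j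
  proof -
    have "(\<Prod>l<n. if j \<le> l then 1 else -1 :: real) = (\<Prod>l\<in>{..<j}. -1)"
      by (rule prod.mono_neutral_cong_right) (use that in auto)
    then show ?thesis by simp
  qed
  then have "(\<Prod>j<n. \<Prod>l<n. if j \<le> l then 1 else -1 :: real) = (-1) ^ (\<Sum>j<n. j)"
    by (simp add: power_sum)
  also have "(\<Sum>j<n. j) = n * (n - 1) div 2"
    using Sum_Ico_nat[of 0 n] by (simp add: lessThan_atLeast0)
  finally show ?thesis .
qed

context noncolliding_setting begin

definition trans_det :: "(nat \<Rightarrow> nat \<Rightarrow> real) \<Rightarrow> nat \<Rightarrow> real" where
  "trans_det x \<mu> = Determinant.det (mat N N (\<lambda>(i, j). heat_kernel (t (\<mu> + 1) - t \<mu>) (x \<mu> i) (x (\<mu> + 1) j)))"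

definition init_det :: "(nat \<Rightarrow> nat \<Rightarrow> real) \<Rightarrow> real" where
  "init_det x = Determinant.det (mat N N (\<lambda>(i, j). phi' i 1 (x 1 j)))"

definition full_weight :: "(nat \<Rightarrow> nat \<Rightarrow> real) \<Rightarrow> real" where
  "full_weight x = init_det x * (\<Prod>\<mu>=1..M. trans_det x \<mu>) * sgn (vandermonde N (x (M + 1)))"

text \<open>\<open>upper \<mu>\<close> is what remains of the indices once the levels \<open>\<le> \<mu>\<close> have been eliminated.\<close>

definition upper :: "nat \<Rightarrow> idx set" where
  "upper \<mu> = (if \<mu> = 0 then Phi else Pt \<mu>) ` {..<N}
     \<union> case_prod One ` ({\<mu>+1..M+1} \<times> {..<N}) \<union> case_prod Pt ` ({\<mu>+1..M+1} \<times> {..<N})"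

lemma upper_iff:
  "Phi i \<in> upper \<mu> \<longleftrightarrow> \<mu> = 0 \<and> i < N"
  "One \<nu> k \<in> upper \<mu> \<longleftrightarrow> \<mu> < \<nu> \<and> \<nu> \<le> M + 1 \<and> k < N"
  "Pt \<nu> k \<in> upper \<mu> \<longleftrightarrow> (\<mu> < \<nu> \<and> \<nu> \<le> M + 1 \<or> \<mu> = \<nu> \<and> \<mu> \<noteq> 0) \<and> k < N"
  by (auto simp: upper_def image_iff)

lemma upper_subset: "\<mu> \<le> M + 1 \<Longrightarrow> upper \<mu> \<subseteq> idxs (\<lambda>_. N)"
proof
  fix p assume "\<mu> \<le> M + 1" "p \<in> upper \<mu>"
  then show "p \<in> idxs (\<lambda>_. N)" by (cases p) (auto simp: upper_iff)
qed

lemma upper_0: "upper 0 = idxs (\<lambda>_. N)"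
proof (rule Set.set_eqI)
  fix p show "p \<in> upper 0 \<longleftrightarrow> p \<in> idxs (\<lambda>_. N)" by (cases p) (auto simp: upper_iff)
qed

text \<open>Once the earlier times are gone, a \<open>One\<close> at the lowest remaining time pairs
  only with the N indices left from the time before, or with \<open>Phi\<close> at the start. The
  sign of \<open>pf_extract_det\<close> meets its own square.\<close>

lemma pf_upper_step:
  assumes "\<mu> \<le> M"
  shows "pf idx_sgn (form x) (upper \<mu>) = Determinant.det (mat N N (\<lambda>(i, j). form x ((if \<mu> = 0 then Phi else Pt \<mu>) i) (One (\<mu> + 1) j)))
    * pf idx_sgn (form x) (upper (\<mu> + 1))"
proof -
  let ?u = "if \<mu> = 0 then Phi else Pt \<mu>" and ?b = "One (\<mu> + 1)" and ?W = "upper (\<mu> + 1)"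
  have eq: "upper \<mu> = ?u ` {..<N} \<union> ?b ` {..<N} \<union> ?W"
  proof (rule Set.set_eqI)
    fix p show "p \<in> upper \<mu> \<longleftrightarrow> p \<in> ?u ` {..<N} \<union> ?b ` {..<N} \<union> ?W"
      using assms by (cases p) (auto simp: upper_iff image_iff)
  qed
  have W: "upper (\<mu> + 1) = Pt (\<mu> + 1) ` {..<N} \<union> (case_prod One ` ({\<mu>+2..M+1} \<times> {..<N}) \<union> case_prod Pt ` ({\<mu>+2..M+1} \<times> {..<N}))"
    by (simp add: upper_def Un_assoc)
  have "card ?W = card (Pt (\<mu> + 1) ` {..<N}) + card (case_prod One ` ({\<mu>+2..M+1} \<times> {..<N}) \<union> case_prod Pt ` ({\<mu>+2..M+1} \<times> {..<N}))"
    unfolding W by (rule card_Un_disjoint) auto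
  also have "card (Pt (\<mu> + 1) ` {..<N}) = N" by (simp add: card_image inj_on_def)
  also have "card (case_prod One ` ({\<mu>+2..M+1} \<times> {..<N}) \<union> case_prod Pt ` ({\<mu>+2..M+1} \<times> {..<N}))
     = card (case_prod One ` ({\<mu>+2..M+1} \<times> {..<N})) + card (case_prod Pt ` ({\<mu>+2..M+1} \<times> {..<N}))"
    by (rule card_Un_disjoint) auto
  also have "card (case_prod One ` ({\<mu>+2..M+1} \<times> {..<N})) = card ({\<mu>+2..M+1} \<times> {..<N})"
    by (rule card_image) (auto simp: inj_on_def)
  also have "card (case_prod Pt ` ({\<mu>+2..M+1} \<times> {..<N})) = card ({\<mu>+2..M+1} \<times> {..<N})"
    by (rule card_image) (auto simp: inj_on_def)
  finally have evW: "even (card ?W)" using N by simp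
  \<comment> \<open>Within \<open>?W\<close>, only the \<open>Pt\<close> indices of the same time
    with smaller number precede \<open>?b j\<close>.\<close>
  have "(\<Prod>w\<in>?W. idx_sgn (?b j) w) = (\<Prod>l<N. if j \<le> l then 1 else -1)" if "j < N" for j
  proof -
    have "(\<Prod>w\<in>?W. idx_sgn (?b j) w) = (\<Prod>w\<in>Pt (\<mu> + 1) ` {..<N}. idx_sgn (?b j) w)"
      by (rule prod.mono_neutral_right) (auto simp: upper_def idx_sgn_def lex3_def)
    also have "\<dots> = (\<Prod>l<N. idx_sgn (?b j) (Pt (\<mu> + 1) l))"
      by (subst prod.reindex) (auto simp: inj_on_def)
    also have "\<dots> = (\<Prod>l<N. if j \<le> l then 1 else -1)"
      by (rule prod.cong) (auto simp: idx_sgn_def lex3_def)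
    finally show ?thesis .
  qed
  then have "(\<Prod>j<N. \<Prod>w\<in>?W. idx_sgn (?b j) w) = (\<Prod>j<N. \<Prod>l<N. if j \<le> l then 1 else -1)"
    by (intro prod.cong) auto
  then have sg: "(\<Prod>j<N. \<Prod>w\<in>?W. idx_sgn (?b j) w) = (-1) ^ (N * (N - 1) div 2)"
    unfolding prod_one_pt_sign .
  have "pf idx_sgn (form x) (?u ` {..<N} \<union> ?b ` {..<N} \<union> ?W)
    = (-1) ^ (N * (N - 1) div 2) * (\<Prod>j<N. \<Prod>w\<in>?W. idx_sgn (?b j) w)
     * Determinant.det (mat N N (\<lambda>(i, j). form x (?u i) (?b j))) * pf idx_sgn (form x) ?W"
  proof (rule idx.pf_extract_det)
    show "skew_on (?u ` {..<N} \<union> ?b ` {..<N} \<union> ?W) (form x)"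
      unfolding eq[symmetric] using assms by (intro skew_on_subset[OF form_antisym upper_subset]) auto
    show "form x (?b j) w = 0" if "j < N" "w \<in> ?b ` {..<N} \<union> ?W" for j w
      using that by (cases w) (auto simp: upper_iff)
    show "idx_sgn (?u i) w = 1" if "i < N" "w \<in> ?W" for i w
      using that by (cases w) (auto simp: upper_iff idx_sgn_def lex3_def)
    show "even (card ?W)" by (rule evW)
  qed (auto simp: upper_def inj_on_def idx_sgn_def lex3_def)
  then show ?thesis unfolding eq sg by (simp flip: power_add power_mult_distrib)
qed

lemma pf_full_weight: "pf idx_sgn (form x) (idxs (\<lambda>_. N)) = full_weight x"
proof -
  have "pf idx_sgn (form x) (upper 1) = (\<Prod>\<mu>=1..m. trans_det x \<mu>) * pf idx_sgn (form x) (upper (m + 1))" if "m \<le> M" for m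
    using that
  proof (induction m)
    case (Suc m)
    have "Determinant.det (mat N N (\<lambda>(i, j). form x ((if Suc m = 0 then Phi else Pt (Suc m)) i) (One (Suc m + 1) j))) = trans_det x (Suc m)"
      by (simp add: trans_det_def)
    then show ?case using Suc pf_upper_step[of "Suc m" x] by simp
  qed simp
  from this[of M] have "pf idx_sgn (form x) (upper 1) = (\<Prod>\<mu>=1..M. trans_det x \<mu>) * pf idx_sgn (form x) (upper (M + 1))" by simp
  moreover have "pf idx_sgn (form x) (upper 0) = init_det x * pf idx_sgn (form x) (upper 1)"
    using pf_upper_step[of 0 x] by (simp add: init_det_def)
  \<comment> \<open>At the final time the heat integrals in \<open>form\<close> run for time 0, so
    the entries are bare signs.\<close>
  moreover have "pf idx_sgn (form x) (upper (M + 1)) = sgn (vandermonde N (x (M + 1)))"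
  proof -
    have "upper (M + 1) = Pt (M + 1) ` {..<N}" by (simp add: upper_def)
    interpret n: sign_function nat_sgn by (rule nat_sgn_sign_function)
    have "pf nat_sgn (\<lambda>i j. sgn (x (M + 1) j - x (M + 1) i)) {..<N} = pf idx_sgn (form x) (upper (M + 1))"
    proof (rule n.pf_relabel[of "Pt (M + 1)"])
      show "bij_betw (Pt (M + 1)) {..<N} (upper (M + 1))"
        unfolding \<open>upper (M + 1) = _\<close> by (auto simp: bij_betw_def inj_on_def)
      show "skew_on (upper (M + 1)) (form x)" by (rule skew_on_subset[OF form_antisym upper_subset]) simp
    qed (use N idx_sgn_sign_function in \<open>auto simp: nat_sgn_def idx_sgn_def lex3_def\<close>)
    then show ?thesis using pf_sgn[OF N(2)] by simp
  qed
  ultimately show ?thesis unfolding upper_0 by (simp add: full_weight_def)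
qed

lemma init_det_bound:
  "\<exists>C\<ge>0. \<exists>b>0. \<forall>x. \<bar>init_det x\<bar> \<le> C * exp (- (\<Sum>k<N. b * (x 1 k)\<^sup>2))"
proof -
  have "\<exists>c. \<forall>i. 0 \<le> c i \<and> (\<forall>x. \<bar>poly (P i) x * heat_kernel (t 1) 0 x\<bar> \<le> c i * exp (- (x\<^sup>2 / (4 * t 1))))"
    by (rule choice) (use poly_heat_kernel_bound[OF t1_pos] in blast)
  then obtain c where c: "\<And>i. 0 \<le> c i" "\<And>i x. \<bar>poly (P i) x * heat_kernel (t 1) 0 x\<bar> \<le> c i * exp (- (x\<^sup>2 / (4 * t 1)))" by blast
  have "\<bar>init_det x\<bar> \<le> fact N * (\<Prod>i<N. c i) * exp (- (\<Sum>k<N. 1 / (4 * t 1) * (x 1 k)\<^sup>2))" for x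
  proof -
    have "\<bar>init_det x\<bar> \<le> fact N * (\<Prod>i<N. c i) * exp (- (\<Sum>i<N. 0)) * exp (- (\<Sum>j<N. 1 / (4 * t 1) * (x 1 j)\<^sup>2))"
      unfolding init_det_def by (rule abs_det_gaussian_le) (use c in \<open>auto simp: phi_def\<close>)
    then show ?thesis by simp
  qed
  moreover have "0 \<le> fact N * (\<Prod>i<N. c i)" using c by (intro mult_nonneg_nonneg prod_nonneg) auto
  moreover have "0 < 1 / (4 * t 1)" using t1_pos by simp
  ultimately show ?thesis by blast
qed

text \<open>The decay present at one time is shared with the next by
  \<open>heat_kernel_det_gaussian\<close>. The rate b may shrink at each of the finitely many
  transitions but stays positive.\<close>

lemma weight_bound:
  assumes "m \<le> M"
  shows "\<exists>C\<ge>0. \<exists>b>0. \<forall>x. \<bar>init_det x * (\<Prod>\<mu>=1..m. trans_det x \<mu>)\<bar> \<le> C * exp (- (\<Sum>\<mu>=1..m+1. \<Sum>k<N. b * (x \<mu> k)\<^sup>2))"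
  using assms
proof (induction m)
  case 0
  then show ?case using init_det_bound by simp
next
  case (Suc m)
  then obtain C a where C: "0 \<le> C" "0 < a" "\<And>x. \<bar>init_det x * (\<Prod>\<mu>=1..m. trans_det x \<mu>)\<bar> \<le> C * exp (- (\<Sum>\<mu>=1..m+1. \<Sum>k<N. a * (x \<mu> k)\<^sup>2))"
    by auto
  have s: "0 < t (Suc m + 1) - t (Suc m)" using t_less[of "Suc m" "Suc m + 1"] Suc.prems by simp
  obtain C' b where b: "0 \<le> C'" "0 < b" "b \<le> a"
    "\<And>x y. \<bar>Determinant.det (mat N N (\<lambda>(i, j). heat_kernel (t (Suc m + 1) - t (Suc m)) (x i) (y j)))\<bar> * exp (- (\<Sum>i<N. a * (x i)\<^sup>2))
     \<le> C' * exp (- (\<Sum>i<N. b * (x i)\<^sup>2)) * exp (- (\<Sum>i<N. b * (y i)\<^sup>2))"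
    using heat_kernel_det_gaussian[OF s C(2), of N] by blast
  have "\<bar>init_det x * (\<Prod>\<mu>=1..Suc m. trans_det x \<mu>)\<bar> \<le> (C * C') * exp (- (\<Sum>\<mu>=1..Suc m+1. \<Sum>k<N. b * (x \<mu> k)\<^sup>2))" for x
  proof -
    let ?A = "\<Sum>\<mu>=1..m. \<Sum>k<N. a * (x \<mu> k)\<^sup>2" and ?B = "\<Sum>\<mu>=1..m. \<Sum>k<N. b * (x \<mu> k)\<^sup>2"
    have "\<bar>init_det x * (\<Prod>\<mu>=1..Suc m. trans_det x \<mu>)\<bar> = \<bar>init_det x * (\<Prod>\<mu>=1..m. trans_det x \<mu>)\<bar> * \<bar>trans_det x (Suc m)\<bar>"
      by (simp add: abs_mult)
    also have "\<dots> \<le> C * exp (- (\<Sum>\<mu>=1..m+1. \<Sum>k<N. a * (x \<mu> k)\<^sup>2)) * \<bar>trans_det x (Suc m)\<bar>"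
      by (rule mult_right_mono[OF C(3)]) simp
    also have "\<dots> = C * exp (- ?A) * (\<bar>trans_det x (Suc m)\<bar> * exp (- (\<Sum>i<N. a * (x (Suc m) i)\<^sup>2)))"
      by (simp add: exp_add[symmetric] exp_minus[symmetric] exp_diff field_simps flip: exp_minus)
    also have "\<dots> \<le> C * exp (- ?A) * (C' * exp (- (\<Sum>i<N. b * (x (Suc m) i)\<^sup>2)) * exp (- (\<Sum>i<N. b * (x (Suc m + 1) i)\<^sup>2)))"
      unfolding trans_det_def by (intro mult_left_mono b(4)) (use C(1) in auto)
    also have "\<dots> \<le> C * exp (- ?B) * (C' * exp (- (\<Sum>i<N. b * (x (Suc m) i)\<^sup>2)) * exp (- (\<Sum>i<N. b * (x (Suc m + 1) i)\<^sup>2)))"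
    proof (intro mult_right_mono mult_left_mono)
      have "?B \<le> ?A" using b(3) by (intro sum_mono mult_right_mono) auto
      then show "exp (- ?A) \<le> exp (- ?B)" by simp
    qed (use C b in auto)
    also have "\<dots> = (C * C') * (exp (- ?B) * exp (- (\<Sum>i<N. b * (x (Suc m) i)\<^sup>2)) * exp (- (\<Sum>i<N. b * (x (Suc m + 1) i)\<^sup>2)))"
      by simp
    also have "exp (- ?B) * exp (- (\<Sum>i<N. b * (x (Suc m) i)\<^sup>2)) * exp (- (\<Sum>i<N. b * (x (Suc m + 1) i)\<^sup>2))
      = exp (- (\<Sum>\<mu>=1..Suc m+1. \<Sum>k<N. b * (x \<mu> k)\<^sup>2))"
      unfolding exp_add[symmetric] by simp
    finally show ?thesis .
  qed
  moreover have "0 \<le> C * C'" using C b by simp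
  ultimately show ?case using b(2) by blast
qed

lemma full_weight_bound:
  "\<exists>C\<ge>0. \<exists>b>0. \<forall>x. \<bar>full_weight x\<bar> \<le> C * (\<Prod>\<mu>=1..M+1. \<Prod>k<N. exp (- (b * (x \<mu> k)\<^sup>2)))"
proof -
  obtain C b where C: "0 \<le> C" "0 < b" "\<And>x. \<bar>init_det x * (\<Prod>\<mu>=1..M. trans_det x \<mu>)\<bar> \<le> C * exp (- (\<Sum>\<mu>=1..M+1. \<Sum>k<N. b * (x \<mu> k)\<^sup>2))"
    using weight_bound[of M] by auto
  have "\<bar>full_weight x\<bar> \<le> C * (\<Prod>\<mu>=1..M+1. \<Prod>k<N. exp (- (b * (x \<mu> k)\<^sup>2)))" for x
  proof -
    have "\<bar>full_weight x\<bar> \<le> \<bar>init_det x * (\<Prod>\<mu>=1..M. trans_det x \<mu>)\<bar> * 1"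
      unfolding full_weight_def by (subst abs_mult, intro mult_left_mono) (auto simp: sgn_if)
    also have "\<dots> \<le> C * exp (- (\<Sum>\<mu>=1..M+1. \<Sum>k<N. b * (x \<mu> k)\<^sup>2))" using C(3)[of x] by simp
    also have "exp (- (\<Sum>\<mu>=1..M+1. \<Sum>k<N. b * (x \<mu> k)\<^sup>2)) = (\<Prod>\<mu>=1..M+1. \<Prod>k<N. exp (- (b * (x \<mu> k)\<^sup>2)))"
      by (simp only: sum_negf[symmetric] exp_sum finite_atLeastAtMost finite_lessThan)
    finally show ?thesis .
  qed
  then show ?thesis using C by blast
qed

section \<open>Integrating the weight over the free coordinates\<close>

definition free :: "(nat \<Rightarrow> nat) \<Rightarrow> (nat \<times> nat) set" where
  "free n = (SIGMA \<mu>:{1..M+1}. {n \<mu>..<N})"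

definition comb :: "(nat \<Rightarrow> nat) \<Rightarrow> (nat \<Rightarrow> nat \<Rightarrow> real) \<Rightarrow> (nat \<times> nat \<Rightarrow> real) \<Rightarrow> nat \<Rightarrow> nat \<Rightarrow> real" where
  "comb n x z \<mu> i = (if i < n \<mu> then x \<mu> i else z (\<mu>, i))"

lemma finite_free: "finite (free n)" by (simp add: free_def)

lemma full_weight_cong:
  assumes "\<And>\<mu> k. 1 \<le> \<mu> \<Longrightarrow> \<mu> \<le> M + 1 \<Longrightarrow> k < N \<Longrightarrow> x \<mu> k = y \<mu> k"
  shows "full_weight x = full_weight y"
proof -
  have "trans_det x \<mu> = trans_det y \<mu>" if "\<mu> \<in> {1..M}" for \<mu>
    unfolding trans_det_def using that assms by (intro arg_cong[of _ _ Determinant.det] eq_matI) auto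
  moreover have "init_det x = init_det y"
    unfolding init_det_def using assms by (intro arg_cong[of _ _ Determinant.det] eq_matI) auto
  moreover have "vandermonde N (x (M + 1)) = vandermonde N (y (M + 1))"
    unfolding vandermonde_def using assms by (intro prod.cong) auto
  ultimately show ?thesis unfolding full_weight_def by simp
qed

lemma comb_measurable:
  assumes "1 \<le> \<mu>" "\<mu> \<le> M + 1" "i < N"
  shows "(\<lambda>z. comb n x z \<mu> i) \<in> borel_measurable (PiM (free n) (\<lambda>_. lborel))"
proof (cases "i < n \<mu>")
  case False
  then have "(\<mu>, i) \<in> free n" using assms by (simp add: free_def)
  then have "(\<lambda>z. z (\<mu>, i)) \<in> measurable (PiM (free n) (\<lambda>_. lborel)) lborel" by (rule measurable_component_singleton)
  then show ?thesis using False by (simp add: comb_def)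
qed (simp add: comb_def)

lemma full_weight_measurable:
  "(\<lambda>z. full_weight (comb n x z)) \<in> borel_measurable (PiM (free n) (\<lambda>_. lborel))"
proof -
  have "(\<lambda>z. trans_det (comb n x z) \<mu>) \<in> borel_measurable (PiM (free n) (\<lambda>_. lborel))" if "\<mu> \<in> {1..M}" for \<mu>
    unfolding trans_det_def using that by (intro measurable_det heat_kernel_measurable comb_measurable) auto
  moreover have "(\<lambda>z. init_det (comb n x z)) \<in> borel_measurable (PiM (free n) (\<lambda>_. lborel))"
  proof -
    have "phi' i 1 \<in> borel_measurable borel" for i by (rule bmeas_measurable, rule bmeas_phi) auto
    then show ?thesis unfolding init_det_def
      by (intro measurable_det measurable_compose[OF comb_measurable]) auto
  qed
  moreover have "(\<lambda>z. vandermonde N (comb n x z (M + 1))) \<in> borel_measurable (PiM (free n) (\<lambda>_. lborel))"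
    unfolding vandermonde_def by (intro borel_measurable_prod borel_measurable_diff comb_measurable) auto
  ultimately show ?thesis unfolding full_weight_def
    by (intro borel_measurable_times borel_measurable_prod measurable_compose[OF _ borel_measurable_sgn]) auto
qed

lemma full_weight_integrable:
  "integrable (PiM (free n) (\<lambda>_. lborel)) (\<lambda>z. full_weight (comb n x z))"
proof -
  interpret L: product_sigma_finite "\<lambda>_ :: nat \<times> nat. lborel :: real measure" by standard
  obtain C b where C: "0 \<le> C" "0 < b" "\<And>x. \<bar>full_weight x\<bar> \<le> C * (\<Prod>\<mu>=1..M+1. \<Prod>k<N. exp (- (b * (x \<mu> k)\<^sup>2)))"
    using full_weight_bound by blast
  let ?g = "\<lambda>z. C * (\<Prod>p\<in>free n. exp (- (b * (z p)\<^sup>2)))"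
  show ?thesis
  proof (rule Bochner_Integration.integrable_bound)
    show "integrable (PiM (free n) (\<lambda>_. lborel)) ?g"
      by (intro integrable_mult_right L.product_integrable_prod finite_free integrable_gaussian C)
    show "AE z in PiM (free n) (\<lambda>_. lborel). norm (full_weight (comb n x z)) \<le> norm (?g z)"
    proof (rule AE_I2)
      fix z
      let ?h = "\<lambda>(\<mu>, k). exp (- (b * (comb n x z \<mu> k)\<^sup>2))"
      have "(\<Prod>\<mu>=1..M+1. \<Prod>k<N. exp (- (b * (comb n x z \<mu> k)\<^sup>2))) = (\<Prod>p\<in>{1..M+1} \<times> {..<N}. ?h p)"
        by (simp add: prod.cartesian_product)
      also have "\<dots> \<le> (\<Prod>p\<in>{1..M+1} \<times> {..<N}. if p \<in> free n then exp (- (b * (z p)\<^sup>2)) else 1)"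
        using C(2) by (intro prod_mono) (auto simp: free_def comb_def)
      also have "\<dots> = (\<Prod>p\<in>free n. exp (- (b * (z p)\<^sup>2)))"
        by (rule prod.mono_neutral_cong_right) (auto simp: free_def)
      finally have "C * (\<Prod>\<mu>=1..M+1. \<Prod>k<N. exp (- (b * (comb n x z \<mu> k)\<^sup>2))) \<le> ?g z"
        using C(1) by (rule mult_left_mono)
      then show "norm (full_weight (comb n x z)) \<le> norm (?g z)"
        using C(3)[of "comb n x z"] by (auto intro: order.trans)
    qed
  qed (rule full_weight_measurable)
qed

lemma integral_PiM_empty:
  fixes f :: "('a \<Rightarrow> 'b) \<Rightarrow> real"
  shows "(\<integral>z. f z \<partial>PiM {} K) = f (\<lambda>_. undefined)"
  by (simp add: PiM_empty lebesgue_integral_count_space_finite)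

text \<open>Induction on the number of free coordinates. With none left the pfaffian is the weight
  itself; otherwise \<open>pf_integrate_point\<close> supplies the factor by which the factorial
  grows.\<close>

theorem integral_full_weight:
  assumes "\<And>\<mu>. \<mu> \<in> {1..M+1} \<Longrightarrow> n \<mu> \<le> N"
  shows "(\<integral>z. full_weight (comb n x z) \<partial>PiM (free n) (\<lambda>_. lborel))
    = (\<Prod>\<mu>=1..M+1. fact (N - n \<mu>)) * pf idx_sgn (form x) (idxs n)"
  using assms
proof (induction "card (free n)" arbitrary: n x)
  case 0
  then have emp: "free n = {}" using finite_free by simp
  have nN: "n \<mu> = N" if "\<mu> \<in> {1..M+1}" for \<mu>
  proof (rule ccontr)
    assume "n \<mu> \<noteq> N"
    then have "(\<mu>, n \<mu>) \<in> free n" using 0(2)[OF that] that by (simp add: free_def)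
    then show False using emp by simp
  qed
  then have "idxs n = idxs (\<lambda>_. N)"
  proof (intro Set.set_eqI)
    fix p show "p \<in> idxs n \<longleftrightarrow> p \<in> idxs (\<lambda>_. N)" using nN by (cases p) auto
  qed
  moreover have "full_weight (comb n x (\<lambda>_. undefined)) = full_weight x"
    by (rule full_weight_cong) (simp add: comb_def nN)
  ultimately show ?case unfolding emp integral_PiM_empty by (simp add: pf_full_weight nN)
next
  case (Suc m)
  interpret L: product_sigma_finite "\<lambda>_ :: nat \<times> nat. lborel :: real measure" by standard
  have "free n \<noteq> {}" using Suc.hyps(2) by auto
  then obtain p where p: "p \<in> free n" by blast
  obtain \<mu> where mu: "1 \<le> \<mu>" "\<mu> \<le> M + 1" "n \<mu> < N"
    using p by (auto simp: free_def intro!: that[of "fst p"])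
  \<comment> \<open>The lowest free coordinate at time \<mu> is integrated last: while it is held
    fixed it counts as one more prescribed point, and the inner integral is known by
    induction.\<close>
  define n' where "n' = n(\<mu> := Suc (n \<mu>))"
  let ?p = "(\<mu>, n \<mu>)"
  have fr: "free n = {?p} \<union> free n'" "{?p} \<inter> free n' = {}"
    using mu by (auto simp: free_def n'_def split: if_splits)
  have "card (free n) = Suc (card (free n'))" unfolding fr(1) using fr(2) finite_free by simp
  then have IH: "(\<integral>z. full_weight (comb n' x z) \<partial>PiM (free n') (\<lambda>_. lborel))
      = (\<Prod>\<mu>=1..M+1. fact (N - n' \<mu>)) * pf idx_sgn (form x) (idxs n')" for x
    using Suc.hyps(2) Suc.prems mu by (intro Suc.hyps(1)) (auto simp: n'_def)
  let ?X = "\<lambda>y. x(\<mu> := (x \<mu>)(n \<mu> := y))"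
  let ?F = "\<Prod>\<mu>=1..M+1. fact (N - n' \<mu>) :: real"
  have bi: "has_bochner_integral lborel (\<lambda>y. ?F * pf idx_sgn (form (?X y)) (idxs n'))
     (?F * ((real N - real (n \<mu>)) * pf idx_sgn (form x) (idxs n)))"
    unfolding n'_def by (intro has_bochner_integral_mult_right pf_integrate_point mu)
  have "(\<integral>z. full_weight (comb n x z) \<partial>PiM (free n) (\<lambda>_. lborel))
    = (\<integral>z1. (\<integral>z2. full_weight (comb n x (merge {?p} (free n') (z1, z2))) \<partial>PiM (free n') (\<lambda>_. lborel)) \<partial>PiM {?p} (\<lambda>_. lborel))"
    unfolding fr(1) by (rule L.product_integral_fold[OF fr(2)]) (use finite_free full_weight_integrable[of n x] fr(1) in auto)
  also have "\<dots> = (\<integral>z1. ?F * pf idx_sgn (form (?X (z1 ?p))) (idxs n') \<partial>PiM {?p} (\<lambda>_. lborel))"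
  proof (rule Bochner_Integration.integral_cong)
    fix z1 :: "nat \<times> nat \<Rightarrow> real"
    have "full_weight (comb n x (merge {?p} (free n') (z1, z2))) = full_weight (comb n' (?X (z1 ?p)) z2)" for z2
      by (rule full_weight_cong) (use mu in \<open>auto simp: comb_def n'_def merge_def free_def\<close>)
    then show "(\<integral>z2. full_weight (comb n x (merge {?p} (free n') (z1, z2))) \<partial>PiM (free n') (\<lambda>_. lborel))
      = ?F * pf idx_sgn (form (?X (z1 ?p))) (idxs n')" by (simp add: IH)
  qed simp
  also have "\<dots> = (\<integral>y. ?F * pf idx_sgn (form (?X y)) (idxs n') \<partial>lborel)"
    by (rule L.product_integral_singleton) (use bi in \<open>auto simp: has_bochner_integral_iff\<close>)
  also have "\<dots> = ?F * ((real N - real (n \<mu>)) * pf idx_sgn (form x) (idxs n))"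
    using bi by (rule has_bochner_integral_integral_eq)
  also have "\<dots> = (\<Prod>\<mu>=1..M+1. fact (N - n \<mu>)) * pf idx_sgn (form x) (idxs n)"
  proof -
    have f: "fact (N - n \<mu>) = (real N - real (n \<mu>)) * fact (N - Suc (n \<mu>))"
      using mu(3) fact_reduce[of "N - n \<mu>", where 'a = real] by (simp add: of_nat_diff)
    have mem: "\<mu> \<in> {1..M+1}" using mu by simp
    have "(\<Prod>\<nu>=1..M+1. fact (N - n \<nu>) :: real) = fact (N - n \<mu>) * (\<Prod>\<nu>\<in>{1..M+1} - {\<mu>}. fact (N - n \<nu>))"
      by (rule prod.remove[OF _ mem]) simp
    also have "(\<Prod>\<nu>\<in>{1..M+1} - {\<mu>}. fact (N - n \<nu>) :: real) = (\<Prod>\<nu>\<in>{1..M+1} - {\<mu>}. fact (N - n' \<nu>))"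
      by (rule prod.cong) (auto simp: n'_def)
    also have "fact (N - n \<mu>) * (\<Prod>\<nu>\<in>{1..M+1} - {\<mu>}. fact (N - n' \<nu>) :: real) = (real N - real (n \<mu>)) * (fact (N - n' \<mu>) * (\<Prod>\<nu>\<in>{1..M+1} - {\<mu>}. fact (N - n' \<nu>)))"
      unfolding f by (simp add: n'_def)
    also have "fact (N - n' \<mu>) * (\<Prod>\<nu>\<in>{1..M+1} - {\<mu>}. fact (N - n' \<nu>)) = ?F"
      by (rule prod.remove[OF _ mem, symmetric]) simp
    finally show ?thesis by simp
  qed
  finally show ?case .
qed

end

section \<open>Positivity and the multi-time density\<close>

lemma det_scale:
  fixes f g :: "nat \<Rightarrow> real"
  shows "Determinant.det (mat n n (\<lambda>(i, j). f i * g j * h i j)) = (\<Prod>i<n. f i) * (\<Prod>j<n. g j) * Determinant.det (mat n n (\<lambda>(i, j). h i j))"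
proof -
  have "signof p * (\<Prod>i = 0..<n. mat n n (\<lambda>(i, j). f i * g j * h i j) $$ (i, p i))
     = ((\<Prod>i<n. f i) * (\<Prod>j<n. g j)) * (signof p * (\<Prod>i = 0..<n. mat n n (\<lambda>(i, j). h i j) $$ (i, p i)))"
    if p: "p permutes {0..<n}" for p
  proof -
    have "(\<Prod>i = 0..<n. mat n n (\<lambda>(i, j). f i * g j * h i j) $$ (i, p i)) = (\<Prod>i = 0..<n. f i * g (p i) * h i (p i))"
      using permutes_in_image[OF p] by (intro prod.cong) auto
    also have "\<dots> = (\<Prod>i = 0..<n. f i) * (\<Prod>i = 0..<n. g (p i)) * (\<Prod>i = 0..<n. h i (p i))"
      by (simp add: prod.distrib)
    also have "(\<Prod>i = 0..<n. g (p i)) = (\<Prod>i = 0..<n. g i)"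
      by (rule prod.permute[OF p, unfolded o_def, symmetric])
    also have "(\<Prod>i = 0..<n. h i (p i)) = (\<Prod>i = 0..<n. mat n n (\<lambda>(i, j). h i j) $$ (i, p i))"
      using permutes_in_image[OF p] by (intro prod.cong) auto
    finally show ?thesis by (simp add: lessThan_atLeast0)
  qed
  then show ?thesis unfolding det_def'[OF mat_carrier] sum_distrib_left by (intro sum.cong) auto
qed

lemma det_permute:
  fixes f :: "nat \<Rightarrow> nat \<Rightarrow> real"
  assumes p: "p permutes {..<n}" and q: "q permutes {..<n}"
  shows "Determinant.det (mat n n (\<lambda>(i, j). f (p i) (q j))) = of_int (sign p) * of_int (sign q) * Determinant.det (mat n n (\<lambda>(i, j). f i j))"
proof -
  note pq = p[unfolded lessThan_atLeast0] q[unfolded lessThan_atLeast0]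
  let ?A = "mat n n (\<lambda>(i, j). f i j)" and ?B = "mat n n (\<lambda>(i, j). f i (q j))"
  have "mat n n (\<lambda>(i, j). f (p i) (q j)) = mat n n (\<lambda>(i, j). ?B $$ (p i, j))"
    using permutes_in_image[OF p] by (intro eq_matI) auto
  then have "Determinant.det (mat n n (\<lambda>(i, j). f (p i) (q j))) = of_int (sign p) * Determinant.det ?B"
    using det_permute_rows[of ?B n p] pq by simp
  also have "Determinant.det ?B = Determinant.det (transpose_mat ?B)"
    by (rule det_transpose[symmetric]) auto
  also have "transpose_mat ?B = mat n n (\<lambda>(i, j). transpose_mat ?A $$ (q i, j))"
    using permutes_in_image[OF q] by (intro eq_matI) auto
  also have "Determinant.det \<dots> = of_int (sign q) * Determinant.det (transpose_mat ?A)"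
    using det_permute_rows[of "transpose_mat ?A" n q] pq by simp
  also have "Determinant.det (transpose_mat ?A) = Determinant.det ?A"
    by (rule det_transpose) auto
  finally show ?thesis by simp
qed

section \<open>Total positivity of the exponential kernel\<close>

text \<open>The bound \<open>y < Max Z\<close> is carried along so that the zero found beyond the
  previous maximum is distinct from the earlier ones.\<close>

lemma rolle_zeros:
  fixes f f' :: "real \<Rightarrow> real"
  assumes "finite Z" "Z \<noteq> {}" "\<And>z. z \<in> Z \<Longrightarrow> f z = 0" and d: "\<And>x. (f has_real_derivative f' x) (at x)"
  shows "\<exists>Y. finite Y \<and> card Y = card Z - 1 \<and> (\<forall>y\<in>Y. f' y = 0 \<and> y < Max Z)"
  using assms(1-3)
proof (induction Z rule: finite_linorder_max_induct)
  case (insert b A)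
  have b: "b \<notin> A" using insert.hyps by auto
  show ?case
  proof (cases "A = {}")
    case False
    then obtain Y where Y: "finite Y" "card Y = card A - 1" "\<forall>y\<in>Y. f' y = 0 \<and> y < Max A"
      using insert by blast
    have m: "Max A \<in> A" "Max A < b" using insert.hyps False by auto
    obtain z where z: "Max A < z" "z < b" "f b - f (Max A) = (b - Max A) * f' z"
      using MVT2[OF m(2), of f f'] d by blast
    have "f' z = 0" using z m insert.prems by auto
    have "Max (insert b A) = b" using insert.hyps False by (intro Max_eqI) (auto intro: less_imp_le)
    moreover have "z \<notin> Y" using Y z by auto
    moreover have "card A > 0" using False insert.hyps(1) by (simp add: card_gt_0_iff)
    then have "card (insert z Y) = card (insert b A) - 1"
      using Y(1,2) \<open>z \<notin> Y\<close> b insert.hyps(1) by simp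
    moreover have "f' y = 0 \<and> y < b" if "y \<in> insert z Y" for y
      using that Y(3) z(2) m(2) \<open>f' z = 0\<close> by force
    ultimately show ?thesis using Y(1) by (intro exI[of _ "insert z Y"]) auto
  qed (use insert in auto)
qed simp

text \<open>Divide by one of the exponentials and apply Rolle's theorem to lose a term.\<close>

lemma exponential_sum_zeros:
  fixes c :: "real \<Rightarrow> real"
  assumes "finite X" "finite Z" "card X \<le> card Z" "\<And>z. z \<in> Z \<Longrightarrow> (\<Sum>x\<in>X. c x * exp (x * z)) = 0" "x \<in> X"
  shows "c x = 0"
  using assms
proof (induction "card X" arbitrary: X Z c x)
  case (Suc k)
  obtain a where a: "a \<in> X" using Suc.hyps(2) by fastforce
  let ?f = "\<lambda>y. \<Sum>x\<in>X. c x * exp ((x - a) * y)"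
  let ?f' = "\<lambda>y. \<Sum>x\<in>X. c x * (x - a) * exp ((x - a) * y)"
  have Z: "Z \<noteq> {}" using Suc.hyps(2) Suc.prems(3) by auto
  have fz: "?f z = 0" if "z \<in> Z" for z
  proof -
    have "?f z = exp (- a * z) * (\<Sum>x\<in>X. c x * exp (x * z))"
      unfolding sum_distrib_left by (rule sum.cong) (auto simp: exp_add[symmetric] algebra_simps)
    then show ?thesis using Suc.prems(4)[OF that] by simp
  qed
  have "(?f has_real_derivative ?f' y) (at y)" for y
    by (auto intro!: derivative_eq_intros sum.cong simp: mult_ac)
  then obtain Y where Y: "finite Y" "card Y = card Z - 1" "\<forall>y\<in>Y. ?f' y = 0 \<and> y < Max Z"
    using rolle_zeros[OF Suc.prems(2) Z, of ?f ?f'] fz by blast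
  \<comment> \<open>Coefficients of the derivative as a function of the shifted exponent
    \<open>u = x - a\<close>; the term of \<open>a\<close> has disappeared, so the induction
    hypothesis applies with one exponent and one zero fewer.\<close>
  let ?d = "\<lambda>u. c (u + a) * u"
  have inj: "inj_on (\<lambda>x. x - a) (X - {a})" by (auto simp: inj_on_def)
  have cX: "k = card ((\<lambda>x. x - a) ` (X - {a}))"
    using Suc.hyps(2) Suc.prems(1) a by (simp add: card_image[OF inj])
  have zero: "(\<Sum>u\<in>(\<lambda>x. x - a) ` (X - {a}). ?d u * exp (u * y)) = 0" if y: "y \<in> Y" for y
  proof -
    have "(\<Sum>u\<in>(\<lambda>x. x - a) ` (X - {a}). ?d u * exp (u * y)) = (\<Sum>x\<in>X - {a}. c x * (x - a) * exp ((x - a) * y))"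
      by (subst sum.reindex[OF inj]) simp
    also have "\<dots> = ?f' y" using a Suc.prems(1) by (subst sum.remove[of X a]) auto
    finally show ?thesis using Y y by simp
  qed
  have off: "c x = 0" if "x \<in> X - {a}" for x
  proof -
    have "?d (x - a) = 0"
      by (rule Suc.hyps(1)[OF cX _ Y(1) _ zero]) (use Suc.prems Suc.hyps(2) Y(2) cX that in auto)
    then show ?thesis using that by simp
  qed
  obtain z where z: "z \<in> Z" using Z by blast
  have "0 = c a * exp (a * z) + (\<Sum>x\<in>X - {a}. c x * exp (x * z))"
    using Suc.prems(4)[OF z] Suc.prems(1) a by (simp add: sum.remove)
  also have "(\<Sum>x\<in>X - {a}. c x * exp (x * z)) = 0" using off by (intro sum.neutral) auto
  finally have "c a = 0" by simp
  then show ?case using off Suc.prems(5) by (cases "x = a") auto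
qed auto

text \<open>As a function of the last \<open>y\<close> the determinant is an exponential sum whose zeros are the other
  \<open>y j\<close>, and its leading coefficient is a smaller determinant.\<close>

theorem det_exp_pos:
  fixes x y :: "nat \<Rightarrow> real"
  assumes "strict_mono_on {..<n} x" "strict_mono_on {..<n} y"
  shows "0 < Determinant.det (mat n n (\<lambda>(i, j). exp (x i * y j)))"
  using assms
proof (induction n arbitrary: y)
  case 0
  then show ?case by (simp add: det_def)
next
  case (Suc n)
  have xm: "x i < x j" if "i < j" "j < Suc n" for i j
    using Suc.prems(1) that by (auto simp: strict_mono_on_def)
  have ym: "y i < y j" if "i < j" "j < Suc n" for i j
    using Suc.prems(2) that by (auto simp: strict_mono_on_def)
  define A where "A s = mat (Suc n) (Suc n) (\<lambda>(i, j). exp (x i * (y(n := s)) j))" for s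
  define c where "c i = cofactor (A 0) i n" for i
  have cof: "cofactor (A s) i n = c i" if "i < Suc n" for s i
  proof -
    have "mat_delete (A s) i n = mat_delete (A 0) i n"
      unfolding mat_delete_def A_def using that by (intro eq_matI) auto
    then show ?thesis by (simp add: c_def cofactor_def)
  qed
  have D: "Determinant.det (A s) = (\<Sum>i<Suc n. c i * exp (x i * s))" for s
  proof -
    have "Determinant.det (A s) = (\<Sum>i<Suc n. A s $$ (i, n) * cofactor (A s) i n)"
      by (rule laplace_expansion_column) (auto simp: A_def)
    also have "\<dots> = (\<Sum>i<Suc n. c i * exp (x i * s))"
    proof (rule sum.cong)
      fix i assume i: "i \<in> {..<Suc n}"
      then have "A s $$ (i, n) = exp (x i * s)" by (simp add: A_def)
      then show "A s $$ (i, n) * cofactor (A s) i n = c i * exp (x i * s)" using cof i by simp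
    qed simp
    finally show ?thesis .
  qed
  have cn: "0 < c n"
  proof -
    have "mat_delete (A 0) n n = mat n n (\<lambda>(i, j). exp (x i * y j))"
      unfolding mat_delete_def A_def by (intro eq_matI) auto
    moreover have "0 < Determinant.det (mat n n (\<lambda>(i, j). exp (x i * y j)))"
      by (rule Suc.IH) (use Suc.prems in \<open>auto simp: strict_mono_on_def\<close>)
    ultimately show ?thesis by (simp add: c_def cofactor_def)
  qed
  define F where "F s = (\<Sum>i<Suc n. c i * exp (x i * s))" for s
  have zeros: "F (y j) = 0" if "j < n" for j
  proof -
    have "Determinant.det (A (y j)) = 0"
      by (rule det_identical_columns[where i = j and j = n and n = "Suc n"])
        (use that in \<open>auto simp: A_def col_def intro!: eq_vecI\<close>)
    then show ?thesis by (simp add: D F_def)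
  qed
  have injx: "inj_on x {..<Suc n}"
    by (rule linorder_inj_onI) (use xm in force)+
  \<comment> \<open>A zero to the right of \<open>y 0, ..., y (n - 1)\<close> would be zero number
    \<open>n + 1\<close> of a sum of \<open>n + 1\<close> exponentials, forcing
    \<open>c n = 0\<close>.\<close>
  have nz: "F s \<noteq> 0" if s: "\<And>j. j < n \<Longrightarrow> y j < s" for s
  proof
    assume Fs: "F s = 0"
    define X where "X = x ` {..<Suc n}"
    define d where "d u = c (the_inv_into {..<Suc n} x u)" for u
    have d: "d (x i) = c i" if "i < Suc n" for i
      using the_inv_into_f_f[OF injx] that by (simp add: d_def)
    have "d (x n) = 0"
    proof (rule exponential_sum_zeros[where c = d and x = "x n" and X = X and Z = "insert s (y ` {..<n})"])
      have "inj_on y {..<n}" by (rule linorder_inj_onI) (use ym in force)+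
      moreover have "s \<notin> y ` {..<n}" using s by fastforce
      ultimately show "card X \<le> card (insert s (y ` {..<n}))"
        unfolding X_def using card_image[OF injx] by (simp add: card_image)
      show "(\<Sum>u\<in>X. d u * exp (u * z)) = 0" if "z \<in> insert s (y ` {..<n})" for z
      proof -
        have "(\<Sum>u\<in>X. d u * exp (u * z)) = F z"
          unfolding X_def F_def by (subst sum.reindex[OF injx]) (auto intro!: sum.cong simp: d)
        then show ?thesis using that Fs zeros by auto
      qed
    qed (auto simp: X_def)
    then show False using cn d by simp
  qed
  \<comment> \<open>The largest exponent \<open>x n\<close> dominates, so \<open>F\<close>
    eventually has the sign of \<open>c n\<close>.\<close>
  have lim: "((\<lambda>s. \<Sum>i<Suc n. c i * exp ((x i - x n) * s)) \<longlongrightarrow> (\<Sum>i<Suc n. if i = n then c n else 0)) at_top"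
  proof (rule tendsto_sum)
    fix i assume "i \<in> {..<Suc n}"
    show "((\<lambda>s. c i * exp ((x i - x n) * s)) \<longlongrightarrow> (if i = n then c n else 0)) at_top"
    proof (cases "i = n")
      case False
      then have neg: "x i - x n < 0" using xm[of i n] \<open>i \<in> _\<close> by auto
      have "filterlim (\<lambda>s. (x i - x n) * s) at_bot at_top"
        using filterlim_tendsto_neg_mult_at_bot[OF tendsto_const neg filterlim_ident] .
      then have "((\<lambda>s. exp ((x i - x n) * s)) \<longlongrightarrow> 0) at_top"
        by (rule filterlim_compose[OF exp_at_bot])
      then show ?thesis using tendsto_mult_right_zero False by auto
    qed simp
  qed
  then have lim': "((\<lambda>s. \<Sum>i<Suc n. c i * exp ((x i - x n) * s)) \<longlongrightarrow> c n) at_top" by simp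
  have "eventually (\<lambda>s. 0 < (\<Sum>i<Suc n. c i * exp ((x i - x n) * s))) at_top"
    by (rule order_tendstoD(1)[OF lim' cn])
  then have "eventually (\<lambda>s. 0 < (\<Sum>i<Suc n. c i * exp ((x i - x n) * s)) \<and> y n < s) at_top"
    by (intro eventually_conj eventually_gt_at_top)
  then obtain s where s: "0 < (\<Sum>i<Suc n. c i * exp ((x i - x n) * s))" "y n < s"
    by (auto simp: eventually_at_top_linorder)
  have "F s = exp (x n * s) * (\<Sum>i<Suc n. c i * exp ((x i - x n) * s))"
    unfolding F_def sum_distrib_left by (rule sum.cong) (auto simp: exp_add[symmetric] algebra_simps)
  then have Fs: "0 < F s" using s by simp
  \<comment> \<open>Otherwise the intermediate value theorem would give a zero between
    \<open>y n\<close> and \<open>s\<close>, in the region that \<open>nz\<close> excludes.\<close>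
  have "0 < F (y n)"
  proof (rule ccontr)
    assume "\<not> 0 < F (y n)"
    then have "F (y n) \<le> 0" by simp
    moreover have "\<forall>u. y n \<le> u \<and> u \<le> s \<longrightarrow> isCont F u" unfolding F_def by (auto intro!: continuous_intros)
    ultimately obtain u where "y n \<le> u" "u \<le> s" "F u = 0"
      using IVT[of F "y n" 0 s] Fs s(2) by auto
    moreover have "y j < u" if "j < n" for j using ym[of j n] that \<open>y n \<le> u\<close> by simp
    ultimately show False using nz[of u] by auto
  qed
  moreover have "A (y n) = mat (Suc n) (Suc n) (\<lambda>(i, j). exp (x i * y j))"
    by (simp add: A_def)
  ultimately show ?case using D[of "y n"] by (simp add: F_def)
qed

text \<open>The squares in the Gaussian exponent are positive row and column factors; what remains
  is the kernel \<open>exp (x * y / s)\<close>.\<close>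

lemma karlin_mcgregor_pos:
  assumes "0 < s" "strict_mono_on {..<n} x" "strict_mono_on {..<n} y"
  shows "0 < karlin_mcgregor n s x y"
proof -
  define f where "f u = exp (- (u\<^sup>2 / (2 * s)))" for u
  have "heat_kernel s u v = (f u / sqrt (2 * pi * s)) * f v * exp (u / s * v)" for u v
  proof -
    have "- ((u - v)\<^sup>2 / (2 * s)) = - (u\<^sup>2 / (2 * s)) + - (v\<^sup>2 / (2 * s)) + u / s * v"
      using assms(1) by (simp add: power2_eq_square field_simps)
    then show ?thesis unfolding heat_kernel_def f_def by (simp only: exp_add) simp
  qed
  then have "karlin_mcgregor n s x y = (\<Prod>i<n. f (x i) / sqrt (2 * pi * s)) * (\<Prod>j<n. f (y j))
      * Determinant.det (mat n n (\<lambda>(i, j). exp (x i / s * y j)))"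
    unfolding karlin_mcgregor_def by (simp only: det_scale)
  moreover have "0 < Determinant.det (mat n n (\<lambda>(i, j). exp (x i / s * y j)))"
    by (rule det_exp_pos) (use assms in \<open>auto simp: strict_mono_on_def divide_strict_right_mono\<close>)
  moreover have "0 < (\<Prod>i<n. f (x i) / sqrt (2 * pi * s))" "0 < (\<Prod>j<n. f (y j))"
    using assms(1) by (auto intro!: prod_pos simp: f_def)
  ultimately show ?thesis by simp
qed

section \<open>The probability of non-collision\<close>

lemma measurable_coordinate:
  "i < n \<Longrightarrow> (\<lambda>y. y i) \<in> borel_measurable (PiM {..<n} (\<lambda>_. lborel :: real measure))"
  using measurable_component_singleton[of i "{..<n}" "\<lambda>_. lborel :: real measure"] by simp

lemma karlin_mcgregor_integrable:
  assumes "0 < s"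
  shows "integrable (PiM {..<n} (\<lambda>_. lborel)) (karlin_mcgregor n s x)"
proof -
  interpret L: product_sigma_finite "\<lambda>_ :: nat. lborel :: real measure" by standard
  define c where "c = 1 / sqrt (2 * pi * s)"
  have c: "0 \<le> c" using assms by (simp add: c_def)
  \<comment> \<open>The factor in u grows, which is harmless as x is fixed; the double minus gives
    it the shape that \<open>abs_det_gaussian_le\<close> expects.\<close>
  have k: "\<bar>heat_kernel s u v\<bar> \<le> c * exp (- (- (u\<^sup>2 / (2 * s)))) * exp (- (1 / (4 * s) * v\<^sup>2))" for u v
  proof -
    have "0 \<le> (2 * u - v)\<^sup>2" by simp
    then have "v\<^sup>2 / 2 \<le> (u - v)\<^sup>2 + u\<^sup>2" by (simp add: power2_eq_square algebra_simps)
    then have "v\<^sup>2 / 2 / (2 * s) \<le> ((u - v)\<^sup>2 + u\<^sup>2) / (2 * s)" using assms by (intro divide_right_mono) auto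
    then have "- ((u - v)\<^sup>2 / (2 * s)) \<le> - (- (u\<^sup>2 / (2 * s))) + - (1 / (4 * s) * v\<^sup>2)" by (simp add: add_divide_distrib)
    then have "exp (- ((u - v)\<^sup>2 / (2 * s))) \<le> exp (- (- (u\<^sup>2 / (2 * s)))) * exp (- (1 / (4 * s) * v\<^sup>2))"
      unfolding exp_add[symmetric] by simp
    then have "c * exp (- ((u - v)\<^sup>2 / (2 * s))) \<le> c * (exp (- (- (u\<^sup>2 / (2 * s)))) * exp (- (1 / (4 * s) * v\<^sup>2)))"
      using c by (rule mult_left_mono)
    then show ?thesis unfolding abs_of_nonneg[OF heat_kernel_nonneg[OF assms]]
      by (simp add: heat_kernel_def c_def)
  qed
  let ?K = "fact n * (\<Prod>i<n. c) * exp (- (\<Sum>i<n. - ((x i)\<^sup>2 / (2 * s))))"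
  have meas: "karlin_mcgregor n s x \<in> borel_measurable (PiM {..<n} (\<lambda>_. lborel))"
    unfolding karlin_mcgregor_def[abs_def]
    by (intro measurable_det heat_kernel_measurable borel_measurable_const measurable_coordinate)
  have int: "integrable (PiM {..<n} (\<lambda>_. lborel)) (\<lambda>y. ?K * (\<Prod>j<n. exp (- (1 / (4 * s) * (y j)\<^sup>2))))"
    using assms by (intro integrable_mult_right L.product_integrable_prod integrable_gaussian) auto
  have bnd: "\<bar>karlin_mcgregor n s x y\<bar> \<le> ?K * (\<Prod>j<n. exp (- (1 / (4 * s) * (y j)\<^sup>2)))" for y
  proof -
    have "\<bar>karlin_mcgregor n s x y\<bar> \<le> ?K * exp (- (\<Sum>j<n. 1 / (4 * s) * (y j)\<^sup>2))"
      unfolding karlin_mcgregor_def by (rule abs_det_gaussian_le[OF k c])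
    also have "exp (- (\<Sum>j<n. 1 / (4 * s) * (y j)\<^sup>2)) = (\<Prod>j<n. exp (- (1 / (4 * s) * (y j)\<^sup>2)))"
      by (simp only: sum_negf[symmetric] exp_sum finite_lessThan)
    finally show ?thesis .
  qed
  have "norm (karlin_mcgregor n s x y) \<le> norm (?K * (\<Prod>j<n. exp (- (1 / (4 * s) * (y j)\<^sup>2))))" for y
    unfolding real_norm_def by (rule order.trans[OF bnd abs_ge_self])
  then show ?thesis by (intro Bochner_Integration.integrable_bound[OF int meas] AE_I2)
qed

lemma ordered_configs_measurable: "ordered_configs n \<in> sets (PiM {..<n} (\<lambda>_. lborel))"
proof -
  have "ordered_configs n = {y \<in> space (PiM {..<n} (\<lambda>_. lborel)). \<forall>j\<in>{..<n}. \<forall>i\<in>{..<j}. y i < y j}"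
    by (auto simp: ordered_configs_def space_PiM strict_mono_on_def)
  also have "\<dots> \<in> sets (PiM {..<n} (\<lambda>_. lborel))"
    by (intro sets.sets_Collect_finite_All borel_measurable_less measurable_coordinate) auto
  finally show ?thesis .
qed

text \<open>The integrand is positive on all ordered configurations, and these contain a box of
  positive volume.\<close>

theorem noncolliding_prob_pos:
  assumes "0 \<le> s" "strict_mono_on {..<n} x"
  shows "0 < noncolliding_prob n s x"
proof (cases "s = 0")
  case False
  then have s: "0 < s" using assms by simp
  interpret L: product_sigma_finite "\<lambda>_ :: nat. lborel :: real measure" by standard
  let ?P = "PiM {..<n} (\<lambda>_. lborel)"
  let ?f = "\<lambda>y. indicator (ordered_configs n) y *\<^sub>R karlin_mcgregor n s x y"
  have int: "integrable ?P ?f"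
    by (rule integrable_mult_indicator[OF ordered_configs_measurable karlin_mcgregor_integrable[OF s]])
  have pos: "0 < karlin_mcgregor n s x y" if "y \<in> ordered_configs n" for y
    using that by (intro karlin_mcgregor_pos s assms) (auto simp: ordered_configs_def)
  have nn: "0 \<le> ?f y" for y using pos[of y] by (auto simp: indicator_def intro: less_imp_le)
  have "integral\<^sup>L ?P ?f \<noteq> 0"
  proof
    assume "integral\<^sup>L ?P ?f = 0"
    then have "AE y in ?P. ?f y = 0"
      using integral_nonneg_eq_0_iff_AE[OF int] nn by simp
    \<comment> \<open>Intervals of length 1/2 starting at successive integers, so that every choice
      of points from them is increasing.\<close>
    let ?B = "Pi\<^sub>E {..<n} (\<lambda>i. {real i <..< real i + 1 / 2})"
    have B: "?B \<in> sets ?P" by (intro sets_PiM_I_finite) auto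
    have sub: "?B \<subseteq> ordered_configs n"
    proof
      fix y assume y: "y \<in> ?B"
      have "y i < y j" if "i < j" "j < n" for i j
      proof -
        have "y i < real i + 1 / 2" "real j < y j" using y that by (auto simp: PiE_iff)
        then show ?thesis using that by linarith
      qed
      then show "y \<in> ordered_configs n" using y by (auto simp: ordered_configs_def strict_mono_on_def PiE_iff)
    qed
    have "AE y in ?P. y \<notin> ?B"
      using \<open>AE y in ?P. ?f y = 0\<close>
    proof eventually_elim
      case (elim y)
      then show ?case using sub pos[of y] by (auto simp: indicator_def split: if_splits)
    qed
    then have "emeasure ?P ?B = 0" using AE_iff_null_sets[OF B] by (simp add: null_setsD1)
    moreover have "emeasure ?P ?B = (\<Prod>i<n. emeasure lborel {real i <..< real i + 1 / 2})"
      by (rule L.emeasure_PiM) auto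
    moreover have "\<dots> = (\<Prod>i<n. ennreal (1 / 2))" by (intro prod.cong) auto
    ultimately show False by (auto simp: prod_zero_iff)
  qed
  moreover have "0 \<le> integral\<^sup>L ?P ?f" using nn by (intro Bochner_Integration.integral_nonneg) auto
  ultimately show ?thesis using False by (simp add: noncolliding_prob_def set_lebesgue_integral_def)
qed (simp add: noncolliding_prob_def)

lemma rearrange_permutation:
  assumes "inj_on x {..<n}"
  shows "\<exists>\<sigma>. \<sigma> permutes {..<n} \<and> (\<forall>i<n. rearrange n x i = x (\<sigma> i)) \<and> strict_mono_on {..<n} (rearrange n x)"
proof -
  let ?xs = "map x [0..<n]"
  have "mset (sort ?xs) = mset ?xs" by simp
  from mset_eq_permutation[OF this] obtain \<sigma> where \<sigma>: "\<sigma> permutes {..<length ?xs}" "permute_list \<sigma> ?xs = sort ?xs" by blast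
  have "rearrange n x i = x (\<sigma> i)" if "i < n" for i
  proof -
    have "\<sigma> i < n" using permutes_in_image[OF \<sigma>(1), of i] that by simp
    then show ?thesis using permute_list_nth[OF \<sigma>(1), of i] that unfolding rearrange_def \<sigma>(2)[symmetric] by simp
  qed
  moreover have "strict_mono_on {..<n} (rearrange n x)"
  proof -
    have "distinct (sort ?xs)" using assms by (simp add: distinct_map lessThan_atLeast0)
    then have "sorted_wrt (<) (sort ?xs)" by (simp add: strict_sorted_iff)
    then show ?thesis unfolding rearrange_def strict_mono_on_def by (auto simp: sorted_wrt_iff_nth_less)
  qed
  ultimately show ?thesis using \<sigma> by auto
qed

lemma vandermonde_sorted_pos: "strict_mono_on {..<n} x \<Longrightarrow> 0 < vandermonde n x"
  unfolding vandermonde_def by (intro prod_pos) (auto simp: strict_mono_on_def)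

section \<open>From transition densities to the weight\<close>

context noncolliding_setting begin

lemma init_det_eq:
  "init_det x = (\<Prod>i<N. coeff (P i) i) * vandermonde N (x 1) * (\<Prod>k<N. heat_kernel (t 1) 0 (x 1 k))"
proof -
  have "init_det x = Determinant.det (mat N N (\<lambda>(i, j). 1 * heat_kernel (t 1) 0 (x 1 j) * poly (P i) (x 1 j)))"
    by (simp add: init_det_def phi_def mult.commute)
  also have "\<dots> = (\<Prod>k<N. heat_kernel (t 1) 0 (x 1 k)) * Determinant.det (mat N N (\<lambda>(i, j). poly (P i) (x 1 j)))"
    by (subst det_scale) simp
  also have "Determinant.det (mat N N (\<lambda>(i, j). poly (P i) (x 1 j))) = (\<Prod>i<N. coeff (P i) i) * vandermonde N (x 1)"
    by (rule vandermonde_det_polys) (use degP in auto)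
  finally show ?thesis by simp
qed

lemma full_weight_noninj:
  assumes "1 \<le> \<mu>" "\<mu> \<le> M + 1" "\<not> inj_on (x \<mu>) {..<N}"
  shows "full_weight x = 0"
proof -
  obtain i j where ij: "i < j" "j < N" "x \<mu> i = x \<mu> j"
    using assms(3) unfolding inj_on_def by (metis lessThan_iff linorder_neqE_nat)
  show ?thesis
  proof (cases "\<mu> = M + 1")
    case True
    have "(\<Prod>i<j. x \<mu> j - x \<mu> i) = 0" using ij by (intro prod_zero) (auto intro!: bexI[of _ i])
    then have "vandermonde N (x \<mu>) = 0" unfolding vandermonde_def using ij(2) by (intro prod_zero) auto
    then show ?thesis using True by (simp add: full_weight_def)
  next
    case False
    have "trans_det x \<mu> = 0" unfolding trans_det_def
      by (rule det_identical_rows[where i = i and j = j and n = N]) (use ij in \<open>auto intro!: eq_vecI\<close>)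
    then have "(\<Prod>\<mu>=1..M. trans_det x \<mu>) = 0" using False assms by (intro prod_zero) auto
    then show ?thesis by (simp add: full_weight_def)
  qed
qed

text \<open>Sorting each configuration multiplies every determinant next to it by the sign of the
  sorting permutation. At inner times two determinants meet and the signs cancel, at the first time
  the Vandermonde product supplies the second sign, and the sign at the final time is that of the
  Vandermonde product there.\<close>

theorem multi_time_density_eq:
  assumes T: "t (M + 1) = T"
  shows "multi_time_density N T M t x
    = entrance_const N T (t 1) / (\<Prod>i<N. coeff (P i) i) * full_weight x"
proof (cases "\<forall>\<mu>\<in>{1..M+1}. inj_on (x \<mu>) {..<N}")
  case False
  then show ?thesis using full_weight_noninj by (auto simp: multi_time_density_def)
next
  case True
  define r where "r \<mu> = rearrange N (x \<mu>)" for \<mu>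
  have "\<exists>\<sigma>. \<forall>\<mu>\<in>{1..M+1}. \<sigma> \<mu> permutes {..<N} \<and> (\<forall>i<N. r \<mu> i = x \<mu> (\<sigma> \<mu> i)) \<and> strict_mono_on {..<N} (r \<mu>)"
    unfolding r_def by (rule bchoice) (use True rearrange_permutation in blast)
  then obtain \<sigma> where \<sigma>: "\<And>\<mu>. \<mu> \<in> {1..M+1} \<Longrightarrow> \<sigma> \<mu> permutes {..<N}"
    "\<And>\<mu> i. \<mu> \<in> {1..M+1} \<Longrightarrow> i < N \<Longrightarrow> r \<mu> i = x \<mu> (\<sigma> \<mu> i)"
    "\<And>\<mu>. \<mu> \<in> {1..M+1} \<Longrightarrow> strict_mono_on {..<N} (r \<mu>)" by blast
  define s where "s \<mu> = (of_int (sign (\<sigma> \<mu>)) :: real)" for \<mu>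
  have ss: "s \<mu> * s \<mu> = 1" for \<mu> by (simp add: s_def sign_def)
  define q where "q \<mu> = noncolliding_prob N (T - t \<mu>) (r \<mu>)" for \<mu>
  have q: "q \<mu> \<noteq> 0" if "\<mu> \<in> {1..M+1}" for \<mu>
    using noncolliding_prob_pos[OF _ \<sigma>(3)[OF that], of "T - t \<mu>"] t_le[of \<mu> "M + 1"] that T by (auto simp: q_def)
  define d where "d \<mu> = karlin_mcgregor N (t (\<mu> + 1) - t \<mu>) (r \<mu>) (r (\<mu> + 1))" for \<mu>
  \<comment> \<open>Cancelling the conditioning factors uses \<open>q \<mu> \<noteq> 0\<close>. The
    one left at the end is the probability for duration 0, which is 1.\<close>
  have tele: "q 1 * (\<Prod>\<mu>=1..m. d \<mu> * q (\<mu> + 1) / q \<mu>) = (\<Prod>\<mu>=1..m. d \<mu>) * q (m + 1)" if "m \<le> M" for m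
    using that
  proof (induction m)
    case (Suc m)
    have "q 1 * (\<Prod>\<mu>=1..Suc m. d \<mu> * q (\<mu> + 1) / q \<mu>) = (q 1 * (\<Prod>\<mu>=1..m. d \<mu> * q (\<mu> + 1) / q \<mu>)) * (d (Suc m) * q (Suc m + 1) / q (Suc m))"
      by (simp add: mult.assoc)
    also have "\<dots> = (\<Prod>\<mu>=1..m. d \<mu>) * q (m + 1) * (d (Suc m) * q (Suc m + 1) / q (Suc m))"
      using Suc by simp
    also have "\<dots> = (\<Prod>\<mu>=1..Suc m. d \<mu>) * q (Suc m + 1)" using q[of "Suc m"] Suc.prems by simp
    finally show ?case .
  qed simp
  have d: "d \<mu> = s \<mu> * s (\<mu> + 1) * trans_det x \<mu>" if "\<mu> \<in> {1..M}" for \<mu>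
  proof -
    have m: "\<mu> \<in> {1..M+1}" "\<mu> + 1 \<in> {1..M+1}" using that by auto
    have "d \<mu> = Determinant.det (mat N N (\<lambda>(i, j). heat_kernel (t (\<mu> + 1) - t \<mu>) (x \<mu> (\<sigma> \<mu> i)) (x (\<mu> + 1) (\<sigma> (\<mu> + 1) j))))"
      unfolding d_def karlin_mcgregor_def using \<sigma>(2)[OF m(1)] \<sigma>(2)[OF m(2)]
      by (intro arg_cong[of _ _ Determinant.det] eq_matI) auto
    then show ?thesis unfolding s_def trans_det_def
      using det_permute[OF \<sigma>(1)[OF m(1)] \<sigma>(1)[OF m(2)], of "\<lambda>i j. heat_kernel (t (\<mu> + 1) - t \<mu>) (x \<mu> i) (x (\<mu> + 1) j)"] by simp
  qed
  have ds: "(\<Prod>\<mu>=1..m. d \<mu>) = s 1 * s (m + 1) * (\<Prod>\<mu>=1..m. trans_det x \<mu>)" if "m \<le> M" for m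
    using that
  proof (induction m)
    case 0
    then show ?case using ss[of 1] by simp
  next
    case (Suc m)
    have "(\<Prod>\<mu>=1..Suc m. d \<mu>) = s 1 * s (m + 1) * (\<Prod>\<mu>=1..m. trans_det x \<mu>) * (s (Suc m) * s (Suc m + 1) * trans_det x (Suc m))"
      using Suc d[of "Suc m"] by simp
    also have "\<dots> = s 1 * (s (Suc m) * s (Suc m)) * s (Suc m + 1) * (\<Prod>\<mu>=1..Suc m. trans_det x \<mu>)" by (simp add: mult_ac)
    finally show ?case unfolding ss by simp
  qed
  have h: "vandermonde N (r \<mu>) = s \<mu> * vandermonde N (x \<mu>)" if m: "\<mu> \<in> {1..M+1}" for \<mu>
  proof -
    have "vandermonde N (r \<mu>) = vandermonde N (x \<mu> \<circ> \<sigma> \<mu>)"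
      unfolding vandermonde_def using \<sigma>(2)[OF m] by (intro prod.cong) auto
    then show ?thesis unfolding s_def vandermonde_permute[OF \<sigma>(1)[OF m]] .
  qed
  have last: "s (M + 1) = sgn (vandermonde N (x (M + 1)))"
  proof -
    have "0 < s (M + 1) * vandermonde N (x (M + 1))"
      using vandermonde_sorted_pos[OF \<sigma>(3), of "M + 1"] h[of "M + 1"] by simp
    moreover have "s (M + 1) = 1 \<or> s (M + 1) = -1" by (simp add: s_def sign_def)
    ultimately show ?thesis by (auto simp: sgn_if)
  qed
  have one: "1 \<in> {1..M+1}" by simp
  have p: "(\<Prod>i<N. heat_kernel (t 1) 0 (r 1 i)) = (\<Prod>i<N. heat_kernel (t 1) 0 (x 1 i))"
  proof -
    have "(\<Prod>i<N. heat_kernel (t 1) 0 (r 1 i)) = (\<Prod>i<N. heat_kernel (t 1) 0 (x 1 (\<sigma> 1 i)))"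
      using \<sigma>(2)[OF one] by (intro prod.cong) auto
    also have "\<dots> = (\<Prod>i<N. heat_kernel (t 1) 0 (x 1 i))"
      by (rule prod.permute[OF \<sigma>(1)[OF one], unfolded o_def, symmetric])
    finally show ?thesis .
  qed
  have "multi_time_density N T M t x = entrance_const N T (t 1) * vandermonde N (r 1) * (\<Prod>i<N. heat_kernel (t 1) 0 (r 1 i))
     * (q 1 * (\<Prod>\<mu>=1..M. d \<mu> * q (\<mu> + 1) / q \<mu>))"
    using True by (simp add: multi_time_density_def entrance_density_def transition_density_def q_def d_def r_def)
  also have "q 1 * (\<Prod>\<mu>=1..M. d \<mu> * q (\<mu> + 1) / q \<mu>) = s 1 * s (M + 1) * (\<Prod>\<mu>=1..M. trans_det x \<mu>)"
    using tele[of M] ds[of M] T by (simp add: q_def noncolliding_prob_def)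
  also have "entrance_const N T (t 1) * vandermonde N (r 1) * (\<Prod>i<N. heat_kernel (t 1) 0 (r 1 i)) * (s 1 * s (M + 1) * (\<Prod>\<mu>=1..M. trans_det x \<mu>))
     = entrance_const N T (t 1) * (s 1 * s 1) * (vandermonde N (x 1) * (\<Prod>i<N. heat_kernel (t 1) 0 (x 1 i))) * (\<Prod>\<mu>=1..M. trans_det x \<mu>) * s (M + 1)"
    unfolding h[OF one] p by (simp only: mult_ac)
  also have "\<dots> = entrance_const N T (t 1) / (\<Prod>i<N. coeff (P i) i) * full_weight x"
  proof -
    have "(\<Prod>i<N. coeff (P i) i) \<noteq> 0" using degP by simp
    then show ?thesis unfolding ss full_weight_def init_det_eq last by simp
  qed
  finally show ?thesis .
qed

end

section \<open>Skew-orthogonal polynomials and the normalization\<close>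

lemma poly_gaussian_tendsto:
  assumes "0 < s"
  shows "((\<lambda>x. poly p x * heat_kernel s 0 x) \<longlongrightarrow> 0) at_top" (is ?A)
    "((\<lambda>x. poly p x * heat_kernel s 0 x) \<longlongrightarrow> 0) at_bot" (is ?B)
proof -
  obtain C where C: "0 \<le> C" "\<And>x. \<bar>poly p x * heat_kernel s 0 x\<bar> \<le> C * exp (- (x\<^sup>2 / (4 * s)))"
    using poly_heat_kernel_bound[OF assms, of p] by blast
  have *: "((\<lambda>x. poly p x * heat_kernel s 0 x) \<longlongrightarrow> 0) F" if "filterlim (\<lambda>x::real. x ^ 2) at_top F" for F
  proof (rule Lim_null_comparison)
    show "\<forall>\<^sub>F x in F. norm (poly p x * heat_kernel s 0 x) \<le> C * exp (- (1 / (4 * s)) * x\<^sup>2)"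
      using C by (intro always_eventually) simp
    have "filterlim (\<lambda>x. - (1 / (4 * s)) * x\<^sup>2) at_bot F"
      using assms by (intro filterlim_tendsto_neg_mult_at_bot[OF tendsto_const _ that]) simp
    then have "((\<lambda>x. exp (- (1 / (4 * s)) * x\<^sup>2)) \<longlongrightarrow> 0) F"
      by (rule filterlim_compose[OF exp_at_bot])
    then show "((\<lambda>x. C * exp (- (1 / (4 * s)) * x\<^sup>2)) \<longlongrightarrow> 0) F"
      by (rule tendsto_mult_right_zero)
  qed
  show ?A by (intro * filterlim_pow_at_top filterlim_ident) simp
  show ?B by (intro * filterlim_pow_at_bot_even filterlim_ident) simp_all
qed

text \<open>The polynomial factor in the derivative of \<open>p\<close> times the Gaussian
  \<open>heat_kernel s 0\<close>.\<close>

definition gauss_deriv :: "real \<Rightarrow> real poly \<Rightarrow> real poly" where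
  "gauss_deriv s p = pderiv p - Polynomial.smult (1 / s) (pCons 0 p)"

lemma DERIV_poly_heat_kernel:
  assumes "0 < s"
  shows "((\<lambda>x. poly p x * heat_kernel s 0 x) has_real_derivative (poly (gauss_deriv s p) x * heat_kernel s 0 x)) (at x)"
proof -
  have "((\<lambda>x. exp (- (x\<^sup>2 / (2 * s)))) has_real_derivative - (x / s) * exp (- (x\<^sup>2 / (2 * s)))) (at x)"
    using assms by (auto intro!: derivative_eq_intros simp: field_simps)
  then have "((\<lambda>x. heat_kernel s 0 x) has_real_derivative - (x / s) * heat_kernel s 0 x) (at x)"
    unfolding heat_kernel_def by (auto dest: DERIV_cdivide[where c = "sqrt (2 * pi * s)"])
  from DERIV_mult[OF poly_DERIV this, of p] show ?thesis
    by (rule DERIV_cong) (simp add: gauss_deriv_def algebra_simps)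
qed

lemma integral_half_lines:
  assumes "0 < s"
  shows "(LINT w:{z<..}|lborel. poly (gauss_deriv s p) w * heat_kernel s 0 w) = - (poly p z * heat_kernel s 0 z)"
    "(LINT w:{..<z}|lborel. poly (gauss_deriv s p) w * heat_kernel s 0 w) = poly p z * heat_kernel s 0 z"
proof -
  let ?f = "\<lambda>w. poly (gauss_deriv s p) w * heat_kernel s 0 w" and ?F = "\<lambda>w. poly p w * heat_kernel s 0 w"
  have cont: "isCont ?f x" for x
    by (rule DERIV_isCont[OF DERIV_poly_heat_kernel[OF assms]])
  have F: "(?F has_vector_derivative ?f x) (at x)" for x
    using DERIV_poly_heat_kernel[OF assms, of p x] by (simp add: has_real_derivative_iff_has_vector_derivative)
  have int: "set_integrable lborel A ?f" if "A \<in> sets borel" for A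
    unfolding set_integrable_def using that integrable_poly_heat_kernel[OF assms]
    by (intro integrable_mult_indicator) auto
  have tz: "(?F \<longlongrightarrow> ?F z) (at_right z)" "(?F \<longlongrightarrow> ?F z) (at_left z)"
    using DERIV_isCont[OF DERIV_poly_heat_kernel[OF assms, of p z]]
    by (auto simp: isCont_def filterlim_at_split)
  have "(LBINT w=ereal z..\<infinity>. ?f w) = 0 - ?F z"
  proof (rule interval_integral_FTC_integrable)
    show "((?F \<circ> real_of_ereal) \<longlongrightarrow> ?F z) (at_right (ereal z))"
      unfolding ereal_tendsto_simps by (rule tz)
    show "((?F \<circ> real_of_ereal) \<longlongrightarrow> 0) (at_left \<infinity>)"
      unfolding ereal_tendsto_simps by (rule poly_gaussian_tendsto[OF assms])
  qed (use F cont int in auto)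
  then show "(LINT w:{z<..}|lborel. ?f w) = - ?F z" by (simp add: interval_integral_to_infinity_eq)
  have "(LBINT w=-\<infinity>..ereal z. ?f w) = ?F z - 0"
  proof (rule interval_integral_FTC_integrable)
    show "((?F \<circ> real_of_ereal) \<longlongrightarrow> ?F z) (at_left (ereal z))"
      unfolding ereal_tendsto_simps by (rule tz)
    show "((?F \<circ> real_of_ereal) \<longlongrightarrow> 0) (at_right (- \<infinity>))"
      unfolding ereal_tendsto_simps by (rule poly_gaussian_tendsto[OF assms])
  qed (use F cont int in auto)
  then show "(LINT w:{..<z}|lborel. ?f w) = ?F z" by (simp add: interval_lebesgue_integral_def)
qed

text \<open>The two half lines contribute the same boundary value, whence the factor 2: the sign
  kernel undoes differentiation.\<close>

lemma sgn_integral_gauss_deriv: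
  assumes "0 < s"
  shows "sgn_integral (\<lambda>w. poly (gauss_deriv s p) w * heat_kernel s 0 w) z = - 2 * (poly p z * heat_kernel s 0 z)"
proof -
  let ?f = "\<lambda>w. poly (gauss_deriv s p) w * heat_kernel s 0 w"
  have int: "integrable lborel (\<lambda>w. indicator A w *\<^sub>R ?f w)" if "A \<in> sets borel" for A
    using that integrable_poly_heat_kernel[OF assms] by (intro integrable_mult_indicator) auto
  have "sgn_integral ?f z = (\<integral>w. indicator {z<..} w *\<^sub>R ?f w - indicator {..<z} w *\<^sub>R ?f w \<partial>lborel)"
    unfolding sgn_integral_def by (rule Bochner_Integration.integral_cong) (auto simp: indicator_def sgn_if)
  also have "\<dots> = (\<integral>w. indicator {z<..} w *\<^sub>R ?f w \<partial>lborel) - (\<integral>w. indicator {..<z} w *\<^sub>R ?f w \<partial>lborel)"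
    by (rule Bochner_Integration.integral_diff; rule int) auto
  finally show ?thesis using integral_half_lines[OF assms, where p = p and z = z]
    by (simp add: set_lebesgue_integral_def)
qed

lemma integral_gauss_deriv:
  assumes "0 < s"
  shows "(\<integral>w. poly (gauss_deriv s p) w * heat_kernel s 0 w \<partial>lborel) = 0"
proof -
  let ?f = "\<lambda>w. poly (gauss_deriv s p) w * heat_kernel s 0 w"
  have int: "integrable lborel (\<lambda>w. indicator A w *\<^sub>R ?f w)" if "A \<in> sets borel" for A
    using that integrable_poly_heat_kernel[OF assms] by (intro integrable_mult_indicator) auto
  have "(\<integral>w. ?f w \<partial>lborel) = (\<integral>w. indicator {0<..} w *\<^sub>R ?f w + indicator {..<0} w *\<^sub>R ?f w \<partial>lborel)"
  proof (rule integral_cong_AE)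
    have "AE w in lborel. w \<noteq> (0::real)" by (rule AE_lborel_singleton)
    then show "AE w in lborel. ?f w = indicator {0<..} w *\<^sub>R ?f w + indicator {..<0} w *\<^sub>R ?f w"
      by eventually_elim (auto simp: indicator_def)
  qed (use int in auto)
  also have "\<dots> = (\<integral>w. indicator {0<..} w *\<^sub>R ?f w \<partial>lborel) + (\<integral>w. indicator {..<0} w *\<^sub>R ?f w \<partial>lborel)"
    by (rule Bochner_Integration.integral_add; rule int) auto
  finally show ?thesis using integral_half_lines[OF assms, where p = p and z = 0]
    by (simp add: set_lebesgue_integral_def)
qed

text \<open>The monic Hermite polynomials for the weight \<open>heat_kernel s 0\<close>.\<close>

primrec hermite :: "real \<Rightarrow> nat \<Rightarrow> real poly" where
  "hermite s 0 = 1"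
| "hermite s (Suc n) = pCons 0 (hermite s n) - Polynomial.smult s (pderiv (hermite s n))"

lemma degree_hermite_le: "degree (hermite s n) \<le> n"
proof (induction n)
  case (Suc n)
  have "degree (pCons 0 (hermite s n)) \<le> Suc n" using Suc by (simp add: degree_pCons_le order.trans)
  moreover have "degree (Polynomial.smult s (pderiv (hermite s n))) \<le> Suc n"
    using Suc by (intro order.trans[OF degree_smult_le]) (simp add: degree_pderiv)
  ultimately show ?case by (auto intro: degree_diff_le)
qed simp

lemma coeff_hermite: "coeff (hermite s n) n = 1"
proof (induction n)
  case (Suc n)
  have "coeff (hermite s n) (Suc (Suc n)) = 0"
    using degree_hermite_le[of s n] by (intro coeff_eq_0) simp
  then show ?case using Suc by (simp add: coeff_pderiv)
qed simp

text \<open>Integration by parts: the recursion for \<open>hermite\<close> is arranged so that each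
  step trades one Hermite degree for one derivative of \<open>q\<close>, up to a total derivative.
  Orthogonality and norm come out together.\<close>

lemma hermite_integral:
  assumes "0 < s" "degree q \<le> n"
  shows "(\<integral>x. poly (hermite s n * q) x * heat_kernel s 0 x \<partial>lborel) = s ^ n * fact n * coeff q n"
  using assms(2)
proof (induction n arbitrary: q)
  case 0
  then obtain a where "q = [:a:]" by (metis degree_eq_zeroE le_zero_eq)
  then show ?case using integral_heat_kernel[OF assms(1), of 0] by simp
next
  case (Suc n)
  let ?h = "hermite s n"
  have eq: "hermite s (Suc n) * q = Polynomial.smult s (?h * pderiv q) - Polynomial.smult s (gauss_deriv s (?h * q))"
    using assms(1) by (simp add: gauss_deriv_def pderiv_mult algebra_simps smult_add_right smult_diff_right)
  have "(\<integral>x. poly (hermite s (Suc n) * q) x * heat_kernel s 0 x \<partial>lborel)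
    = (\<integral>x. s * (poly (?h * pderiv q) x * heat_kernel s 0 x) - s * (poly (gauss_deriv s (?h * q)) x * heat_kernel s 0 x) \<partial>lborel)"
    unfolding eq by (simp add: algebra_simps)
  also have "\<dots> = s * (\<integral>x. poly (?h * pderiv q) x * heat_kernel s 0 x \<partial>lborel) - s * (\<integral>x. poly (gauss_deriv s (?h * q)) x * heat_kernel s 0 x \<partial>lborel)"
    by (subst Bochner_Integration.integral_diff) (auto intro!: integrable_mult_right integrable_poly_heat_kernel[OF assms(1)] simp del: poly_mult)
  also have "\<dots> = s * (s ^ n * fact n * coeff (pderiv q) n)"
    using Suc.IH[of "pderiv q"] Suc.prems integral_gauss_deriv[OF assms(1)] by (simp add: degree_pderiv)
  finally show ?case by (simp add: coeff_pderiv algebra_simps)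
qed

text \<open>This is why Hermite polynomials of variance \<open>s / 2\<close> appear: once the sign
  kernel is undone, both Gaussian factors stand at the same point.\<close>

lemma heat_kernel_0_square:
  assumes "0 < s"
  shows "heat_kernel s 0 x * heat_kernel s 0 x = heat_kernel (s / 2) 0 x / (2 * sqrt (pi * s))"
proof -
  have "sqrt (2 * pi * s) * sqrt (2 * pi * s) = sqrt (2 * pi * (s / 2)) * (2 * sqrt (pi * s))"
  proof -
    have "sqrt (2 * pi * (s / 2)) * (2 * sqrt (pi * s)) = 2 * (sqrt (pi * s) * sqrt (pi * s))" by simp
    then show ?thesis using assms by simp
  qed
  moreover have "exp (- (x\<^sup>2 / (2 * s))) * exp (- (x\<^sup>2 / (2 * s))) = exp (- (x\<^sup>2 / (2 * (s / 2))))"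
    unfolding exp_add[symmetric] using assms by simp
  ultimately show ?thesis by (simp add: heat_kernel_def)
qed

text \<open>\<open>skew_form s\<close> is the pairing in the entries of \<open>A0\<close>, for \<open>phi\<close> replaced by polynomials times
  \<open>heat_kernel s 0\<close>.\<close>

definition skew_form :: "real \<Rightarrow> real poly \<Rightarrow> real poly \<Rightarrow> real" where
  "skew_form s p q = (\<integral>y. (poly p y * heat_kernel s 0 y) * sgn_integral (\<lambda>w. poly q w * heat_kernel s 0 w) y \<partial>lborel)"

lemma skew_form_antisym: "0 < s \<Longrightarrow> skew_form s q p = - skew_form s p q"
  unfolding skew_form_def by (intro sgn_integral_antisym integrable_poly_heat_kernel)

lemma skew_form_linear:
  assumes "0 < s" "degree p \<le> k"
  shows "skew_form s p q = (\<Sum>j\<le>k. coeff p j * skew_form s (monom 1 j) q)"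
proof -
  let ?H = "sgn_integral (\<lambda>w. poly q w * heat_kernel s 0 w)"
  have p: "poly p y = (\<Sum>j\<le>k. coeff p j * y ^ j)" for y
    unfolding poly_altdef by (rule sum.mono_neutral_left) (use assms in \<open>auto simp: coeff_eq_0\<close>)
  have int: "integrable lborel (\<lambda>y. (poly (monom 1 j) y * heat_kernel s 0 y) * ?H y)" for j
    using assms by (intro integrable_mult_bmeas bmeas_sgn_integral integrable_poly_heat_kernel)
  have "skew_form s p q = (\<integral>y. (\<Sum>j\<le>k. coeff p j * ((poly (monom 1 j) y * heat_kernel s 0 y) * ?H y)) \<partial>lborel)"
    unfolding skew_form_def p
    by (rule Bochner_Integration.integral_cong) (simp_all only: poly_monom sum_distrib_right mult.assoc mult_1)
  also have "\<dots> = (\<Sum>j\<le>k. \<integral>y. coeff p j * ((poly (monom 1 j) y * heat_kernel s 0 y) * ?H y) \<partial>lborel)"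
    by (rule Bochner_Integration.integral_sum) (intro integrable_mult_right int)
  also have "\<dots> = (\<Sum>j\<le>k. coeff p j * skew_form s (monom 1 j) q)"
    by (simp only: integral_mult_right_zero skew_form_def)
  finally show ?thesis .
qed

text \<open>The pairing with a derivative reduces to an \<open>L\<^sup>2\<close> product, which makes the polynomials
  \<open>skew_hermite s\<close> skew-orthogonal.\<close>

definition skew_hermite :: "real \<Rightarrow> nat \<Rightarrow> real poly" where
  "skew_hermite s i = (if even i then hermite (s / 2) i else Polynomial.smult (- s) (gauss_deriv s (hermite (s / 2) (i - 1))))"

text \<open>The sign integral removes the derivative, the two Gaussians merge into one of half the
  variance, and \<open>hermite_integral\<close> evaluates the result.\<close>

lemma skew_form_gauss_deriv:
  assumes "0 < s" "degree p \<le> n"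
  shows "skew_form s p (Polynomial.smult (- s) (gauss_deriv s (hermite (s / 2) n)))
    = sqrt (s / pi) * ((s / 2) ^ n * fact n * coeff p n)"
proof -
  let ?h = "hermite (s / 2) n"
  have H: "sgn_integral (\<lambda>w. poly (Polynomial.smult (- s) (gauss_deriv s ?h)) w * heat_kernel s 0 w) y = 2 * s * (poly ?h y * heat_kernel s 0 y)" for y
  proof -
    have "sgn_integral (\<lambda>w. poly (Polynomial.smult (- s) (gauss_deriv s ?h)) w * heat_kernel s 0 w) y
      = (\<integral>w. (- s) * (sgn (w - y) * (poly (gauss_deriv s ?h) w * heat_kernel s 0 w)) \<partial>lborel)"
      unfolding sgn_integral_def by (rule Bochner_Integration.integral_cong) auto
    also have "\<dots> = (- s) * sgn_integral (\<lambda>w. poly (gauss_deriv s ?h) w * heat_kernel s 0 w) y"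
      unfolding sgn_integral_def by (rule integral_mult_right_zero)
    finally show ?thesis unfolding sgn_integral_gauss_deriv[OF assms(1)] by simp
  qed
  have "skew_form s p (Polynomial.smult (- s) (gauss_deriv s ?h))
     = (\<integral>y. 2 * s / (2 * sqrt (pi * s)) * (poly (?h * p) y * heat_kernel (s / 2) 0 y) \<partial>lborel)"
    unfolding skew_form_def H
  proof (rule Bochner_Integration.integral_cong)
    fix y
    have "poly p y * heat_kernel s 0 y * (2 * s * (poly ?h y * heat_kernel s 0 y))
      = 2 * s * (poly ?h y * poly p y) * (heat_kernel s 0 y * heat_kernel s 0 y)" by simp
    then show "poly p y * heat_kernel s 0 y * (2 * s * (poly ?h y * heat_kernel s 0 y))
      = 2 * s / (2 * sqrt (pi * s)) * (poly (?h * p) y * heat_kernel (s / 2) 0 y)"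
      unfolding heat_kernel_0_square[OF assms(1)] by simp
  qed simp
  also have "\<dots> = 2 * s / (2 * sqrt (pi * s)) * ((s / 2) ^ n * fact n * coeff p n)"
    unfolding integral_mult_right_zero using hermite_integral[of "s / 2" p n] assms by simp
  also have "2 * s / (2 * sqrt (pi * s)) = sqrt (s / pi)"
  proof -
    have "s = sqrt s * sqrt s" using assms by simp
    then have "s / (sqrt pi * sqrt s) = sqrt s / sqrt pi"
      using assms by (metis mult.commute nonzero_mult_divide_mult_cancel_left real_sqrt_eq_zero_cancel_iff less_irrefl)
    then show ?thesis by (simp add: real_sqrt_mult real_sqrt_divide)
  qed
  finally show ?thesis .
qed

lemma degree_skew_hermite: "degree (skew_hermite s i) \<le> i"
proof (cases "even i")
  case False
  then obtain k where i: "i = Suc k" by (cases i) auto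
  let ?h = "hermite (s / 2) k"
  have "degree (pderiv ?h) \<le> Suc k" using degree_hermite_le[of "s / 2" k] by (simp add: degree_pderiv)
  moreover have "degree (Polynomial.smult (1 / s) (pCons 0 ?h)) \<le> Suc k"
    using degree_hermite_le[of "s / 2" k] by (intro order.trans[OF degree_smult_le] order.trans[OF degree_pCons_le]) simp
  ultimately have "degree (gauss_deriv s ?h) \<le> Suc k" unfolding gauss_deriv_def by (rule degree_diff_le)
  then have "degree (Polynomial.smult (- s) (gauss_deriv s ?h)) \<le> Suc k" using degree_smult_le order.trans by blast
  then show ?thesis using False i by (simp add: skew_hermite_def)
qed (simp add: skew_hermite_def degree_hermite_le)

text \<open>The factor \<open>- s\<close> in the odd case is there for this:
  \<open>gauss_deriv s\<close> multiplies the top coefficient by \<open>- 1 / s\<close>.\<close>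

lemma coeff_skew_hermite: "0 < s \<Longrightarrow> coeff (skew_hermite s i) i = 1"
proof (cases "even i")
  case False
  assume s: "0 < s"
  obtain k where i: "i = Suc k" using False by (cases i) auto
  let ?h = "hermite (s / 2) k"
  have "coeff ?h (Suc (Suc k)) = 0"
    using degree_hermite_le[of "s / 2" k] by (intro coeff_eq_0) simp
  then show ?thesis using False i s coeff_hermite[of "s / 2" k]
    by (simp add: skew_hermite_def gauss_deriv_def coeff_pderiv)
qed (simp add: skew_hermite_def coeff_hermite)

theorem pf_skew_form:
  assumes s: "0 < s" and q: "\<And>i. i < 2 * n \<Longrightarrow> degree (q i) \<le> i"
  shows "pf nat_sgn (\<lambda>i j. skew_form s (q i) (q j)) {..<2 * n}
    = (\<Prod>i<2 * n. coeff (q i) i) * (\<Prod>k<n. sqrt (s / pi) * ((s / 2) ^ (2 * k) * fact (2 * k)))"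
proof -
  \<comment> \<open>Any two families differ only by their leading coefficients, so the value for
    monomials is found from \<open>skew_hermite\<close>, where the matrix is block diagonal in the
    sense of \<open>pf_block_diagonal\<close>, and then carried over to \<open>q\<close>.\<close>
  let ?m = "pf nat_sgn (\<lambda>i j. skew_form s (monom 1 i) (monom 1 j)) {..<2 * n}"
  have pf: "pf nat_sgn (\<lambda>i j. skew_form s (q i) (q j)) {..<2 * n} = (\<Prod>i<2 * n. coeff (q i) i) * ?m"
    if "\<And>i. i < 2 * n \<Longrightarrow> degree (q i) \<le> i" for q :: "nat \<Rightarrow> real poly"
  proof (rule pf_polynomial_form)
    show "skew_form s q p = - skew_form s p q" for p q by (rule skew_form_antisym[OF s])
    show "skew_form s p q = (\<Sum>j\<le>k. coeff p j * skew_form s (monom 1 j) q)" if "degree p \<le> k" for p q k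
      by (rule skew_form_linear[OF s that])
  qed (use that in auto)
  let ?R = "skew_hermite s"
  have odd: "skew_form s p (?R (2 * k + 1)) = sqrt (s / pi) * ((s / 2) ^ (2 * k) * fact (2 * k) * coeff p (2 * k))"
    if "degree p \<le> 2 * k" for p k
    using skew_form_gauss_deriv[OF s that] by (simp add: skew_hermite_def)
  have "pf nat_sgn (\<lambda>i j. skew_form s (?R i) (?R j)) {..<2 * n} = (\<Prod>k<n. skew_form s (?R (2 * k)) (?R (2 * k + 1)))"
  proof (rule pf_block_diagonal)
    show "skew_on {..<2 * n} (\<lambda>i j. skew_form s (?R i) (?R j))"
      by (rule skew_onI) (rule skew_form_antisym[OF s])
    show "skew_form s (?R (2 * k + 1)) (?R j) = 0" if "j < 2 * k" for k j
    proof -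
      have "degree (?R j) < 2 * k" using degree_skew_hermite[of s j] that by simp
      then have "skew_form s (?R j) (?R (2 * k + 1)) = 0" using odd[of "?R j" k] by (simp add: coeff_eq_0)
      then show ?thesis using skew_form_antisym[OF s, of "?R (2 * k + 1)" "?R j"] by simp
    qed
  qed
  also have "\<dots> = (\<Prod>k<n. sqrt (s / pi) * ((s / 2) ^ (2 * k) * fact (2 * k)))"
    by (rule prod.cong) (simp_all add: odd[OF degree_skew_hermite] coeff_skew_hermite[OF s] del: One_nat_def add_Suc_right)
  finally have "?m = (\<Prod>k<n. sqrt (s / pi) * ((s / 2) ^ (2 * k) * fact (2 * k)))"
    using pf[OF degree_skew_hermite] coeff_skew_hermite[OF s] by simp
  then show ?thesis using pf[OF q] by simp
qed

section \<open>The functions \<open>phi\<close> at the final time\<close>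

text \<open>Expanding around the mean m leaves Gaussian moments as constants; the top power of m
  meets the zeroth moment, which is 1.\<close>

lemma poly_heat_average:
  assumes "0 < v" "degree p \<le> d"
  shows "\<exists>q. degree q \<le> d \<and> coeff q d = coeff p d \<and> (\<forall>m. (\<integral>y. poly p y * heat_kernel v m y \<partial>lborel) = poly q m)"
proof -
  define c where "c k = (\<integral>u. poly (monom 1 k) u * heat_kernel v 0 u \<partial>lborel)" for k
  have c0: "c 0 = 1" using integral_heat_kernel[OF assms(1), of 0] by (simp add: c_def)
  define q where "q = (\<Sum>i\<le>d. \<Sum>k\<le>i. monom (coeff p i * of_nat (i choose k) * c (i - k)) k)"
  have "degree q \<le> d" unfolding q_def
    by (intro degree_sum_le order.trans[OF degree_monom_le]) auto
  moreover have "coeff q d = coeff p d"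
  proof -
    have "coeff q d = (\<Sum>i\<le>d. \<Sum>k\<le>i. if k = d then coeff p i * of_nat (i choose k) * c (i - k) else 0)"
      by (simp add: q_def coeff_sum)
    also have "\<dots> = (\<Sum>i\<le>d. if i = d then coeff p d else 0)"
      by (rule sum.cong) (auto simp: c0 intro!: sum.neutral)
    finally show ?thesis by simp
  qed
  moreover have "(\<integral>y. poly p y * heat_kernel v m y \<partial>lborel) = poly q m" for m
  proof -
    have p: "poly p (m + u) = (\<Sum>i\<le>d. \<Sum>k\<le>i. coeff p i * of_nat (i choose k) * m ^ k * poly (monom 1 (i - k)) u)" for u
    proof -
      have "poly p (m + u) = (\<Sum>i\<le>d. coeff p i * (m + u) ^ i)"
        unfolding poly_altdef by (rule sum.mono_neutral_left) (use assms in \<open>auto simp: coeff_eq_0\<close>)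
      also have "\<dots> = (\<Sum>i\<le>d. \<Sum>k\<le>i. coeff p i * of_nat (i choose k) * m ^ k * poly (monom 1 (i - k)) u)"
        unfolding binomial_ring sum_distrib_left by (simp add: poly_monom mult_ac)
      finally show ?thesis .
    qed
    have "(\<integral>y. poly p y * heat_kernel v m y \<partial>lborel) = (\<integral>u. poly p (m + 1 * u) * heat_kernel v m (m + 1 * u) \<partial>lborel)"
      by (subst lborel_integral_real_affine[of 1 _ m]) auto
    also have "\<dots> = (\<integral>u. (\<Sum>i\<le>d. \<Sum>k\<le>i. coeff p i * of_nat (i choose k) * m ^ k * (poly (monom 1 (i - k)) u * heat_kernel v 0 u)) \<partial>lborel)"
    proof (rule Bochner_Integration.integral_cong)
      fix u :: real
      have "heat_kernel v m (m + 1 * u) = heat_kernel v 0 u" by (simp add: heat_kernel_def)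
      then show "poly p (m + 1 * u) * heat_kernel v m (m + 1 * u)
        = (\<Sum>i\<le>d. \<Sum>k\<le>i. coeff p i * of_nat (i choose k) * m ^ k * (poly (monom 1 (i - k)) u * heat_kernel v 0 u))"
        by (simp only: p mult_1 sum_distrib_right mult.assoc)
    qed simp
    also have "\<dots> = (\<Sum>i\<le>d. \<Sum>k\<le>i. coeff p i * of_nat (i choose k) * m ^ k * c (i - k))"
    proof -
      have int: "integrable lborel (\<lambda>u. coeff p i * of_nat (i choose k) * m ^ k * (poly (monom 1 (i - k)) u * heat_kernel v 0 u))" for i k
        by (intro integrable_mult_right integrable_poly_heat_kernel assms)
      show ?thesis
        by (subst Bochner_Integration.integral_sum, intro Bochner_Integration.integrable_sum int)
          (subst Bochner_Integration.integral_sum, rule int, simp only: integral_mult_right_zero c_def)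
    qed
    also have "\<dots> = poly q m"
      by (simp add: q_def poly_sum poly_monom mult_ac)
    finally show ?thesis .
  qed
  ultimately show ?thesis by blast
qed

context noncolliding_setting begin

text \<open>A Brownian path from 0 that is at x at the final time is, at time \<open>t 1\<close>,
  Gaussian with mean proportional to x. So \<open>phi'\<close> is the final Gaussian times the
  bridge average of \<open>P i\<close>, a polynomial in that mean.\<close>

lemma phi_final:
  assumes "i < N"
  shows "\<exists>q. degree q \<le> i \<and> coeff q i = coeff (P i) i * (t 1 / t (M + 1)) ^ i
    \<and> phi' i (M + 1) = (\<lambda>x. poly q x * heat_kernel (t (M + 1)) 0 x)"
proof -
  let ?T = "t (M + 1)"
  define s where "s = ?T - t 1"
  have s: "0 < s" using t_less[of 1 "M + 1"] M by (simp add: s_def)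
  have t1: "0 < t 1" by (rule t1_pos)
  have T: "s + t 1 = ?T" "0 < ?T" using t_pos[of "M + 1"] by (auto simp: s_def)
  \<comment> \<open>The variance of the Brownian bridge at time \<open>t 1\<close>.\<close>
  define v where "v = s * t 1 / ?T"
  have v: "0 < v" using s t1 T by (simp add: v_def)
  obtain q where q: "degree q \<le> i" "coeff q i = coeff (P i) i" "\<And>m. (\<integral>y. poly (P i) y * heat_kernel v m y \<partial>lborel) = poly q m"
    using poly_heat_average[OF v, of "P i" i] degP[OF assms] by auto
  define r where "r = pcompose q [:0, t 1 / ?T:]"
  have "degree r \<le> i" unfolding r_def using degree_pcompose_le[of q "[:0, t 1 / ?T:]"] q(1)
    by (auto intro: order.trans)
  moreover have "coeff r i = coeff (P i) i * (t 1 / ?T) ^ i"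
    unfolding r_def coeff_pcompose_linear q(2) by simp
  moreover have "phi' i (M + 1) x = poly r x * heat_kernel ?T 0 x" for x
  proof -
    have "phi' i (M + 1) x = (\<integral>y. heat_kernel s x y * (poly (P i) y * heat_kernel (t 1) 0 y) \<partial>lborel)"
      unfolding phi_def using s by (simp add: heat_integral_pos s_def)
    also have "\<dots> = (\<integral>y. heat_kernel ?T 0 x * (poly (P i) y * heat_kernel v (t 1 / ?T * x) y) \<partial>lborel)"
    proof (rule Bochner_Integration.integral_cong)
      fix y
      have "heat_kernel s x y * heat_kernel (t 1) y 0 = heat_kernel ?T x 0 * heat_kernel v (t 1 / ?T * x) y"
        using heat_kernel_mult[OF s t1, of x y 0] unfolding T(1) v_def by simp
      then show "heat_kernel s x y * (poly (P i) y * heat_kernel (t 1) 0 y) = heat_kernel ?T 0 x * (poly (P i) y * heat_kernel v (t 1 / ?T * x) y)"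
        by (simp add: heat_kernel_commute[of _ 0] mult_ac)
    qed simp
    also have "\<dots> = heat_kernel ?T 0 x * poly q (t 1 / ?T * x)"
      unfolding integral_mult_right_zero q(3) ..
    also have "\<dots> = poly r x * heat_kernel ?T 0 x" by (simp add: r_def poly_pcompose mult_ac)
    finally show ?thesis .
  qed
  ultimately show ?thesis by blast
qed

lemma pf_A0:
  "pf nat_sgn (\<lambda>i j. A0 N M P t $$ (i, j)) {..<N}
    = (\<Prod>i<N. coeff (P i) i * (t 1 / t (M + 1)) ^ i)
      * (\<Prod>k<N div 2. sqrt (t (M + 1) / pi) * ((t (M + 1) / 2) ^ (2 * k) * fact (2 * k)))"
proof -
  interpret n: sign_function nat_sgn by (rule nat_sgn_sign_function)
  have "\<exists>q. \<forall>i\<in>{..<N}. degree (q i) \<le> i \<and> coeff (q i) i = coeff (P i) i * (t 1 / t (M + 1)) ^ i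
    \<and> phi' i (M + 1) = (\<lambda>x. poly (q i) x * heat_kernel (t (M + 1)) 0 x)"
    by (rule bchoice) (use phi_final in blast)
  then obtain q where q: "\<And>i. i < N \<Longrightarrow> degree (q i) \<le> i"
    "\<And>i. i < N \<Longrightarrow> coeff (q i) i = coeff (P i) i * (t 1 / t (M + 1)) ^ i"
    "\<And>i. i < N \<Longrightarrow> phi' i (M + 1) = (\<lambda>x. poly (q i) x * heat_kernel (t (M + 1)) 0 x)" by blast
  have N2: "N = 2 * (N div 2)" using N by simp
  have "pf nat_sgn (\<lambda>i j. A0 N M P t $$ (i, j)) {..<N} = pf nat_sgn (\<lambda>i j. skew_form (t (M + 1)) (q i) (q j)) {..<N}"
  proof (rule n.pf_cong)
    show "skew_on {..<N} (\<lambda>i j. A0 N M P t $$ (i, j))" by (rule skew_onI) (auto intro: A0_antisym)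
    show "A0 N M P t $$ (i, j) = skew_form (t (M + 1)) (q i) (q j)" if "i \<in> {..<N}" "j \<in> {..<N}" for i j
      using that by (simp only: lessThan_iff A0_eq skew_form_def q(3))
  qed (use N in auto)
  also have "\<dots> = (\<Prod>i<N. coeff (q i) i) * (\<Prod>k<N div 2. sqrt (t (M + 1) / pi) * ((t (M + 1) / 2) ^ (2 * k) * fact (2 * k)))"
    using pf_skew_form[of "t (M + 1)" "N div 2" q] q(1) t_pos[of "M + 1"] N2 by simp
  also have "(\<Prod>i<N. coeff (q i) i) = (\<Prod>i<N. coeff (P i) i * (t 1 / t (M + 1)) ^ i)"
    by (rule prod.cong) (auto simp: q(2))
  finally show ?thesis .
qed

end

section \<open>Gamma values and the entrance constant\<close>

lemma Gamma_plus1_pos: "0 < x \<Longrightarrow> Gamma (x + 1) = x * Gamma x" for x :: real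
  by (rule Gamma_plus1) (auto elim!: nonpos_Ints_cases)

text \<open>Legendre's duplication formula at the arguments in question, by the functional
  equation.\<close>

lemma Gamma_half_mult: "Gamma (real k + 1 / 2) * Gamma (real k + 1) = sqrt pi * fact (2 * k) / 4 ^ k"
proof (induction k)
  case 0
  then show ?case by (simp add: Gamma_one_half_real)
next
  case (Suc k)
  have "Gamma (real (Suc k) + 1 / 2) = (real k + 1 / 2) * Gamma (real k + 1 / 2)"
    using Gamma_plus1_pos[of "real k + 1 / 2"] by (simp add: add_ac)
  moreover have "Gamma (real (Suc k) + 1) = (real k + 1) * Gamma (real k + 1)"
    using Gamma_plus1_pos[of "real k + 1"] by (simp add: add_ac)
  ultimately have "Gamma (real (Suc k) + 1 / 2) * Gamma (real (Suc k) + 1)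
     = (real k + 1 / 2) * (real k + 1) * (Gamma (real k + 1 / 2) * Gamma (real k + 1))" by simp
  also have "\<dots> = (real k + 1 / 2) * (real k + 1) * (sqrt pi * fact (2 * k) / 4 ^ k)" unfolding Suc ..
  also have "\<dots> = sqrt pi * fact (2 * Suc k) / 4 ^ Suc k" by (simp add: field_simps)
  finally show ?case .
qed

text \<open>Consecutive Gamma factors are paired by \<open>Gamma_half_mult\<close>. The variable
  \<open>r\<close> will be \<open>sqrt T\<close>, which keeps all exponents integral.\<close>

lemma prod_Gamma_halves:
  fixes r :: real
  assumes "0 < r"
  shows "(\<Prod>j=1..2 * n. Gamma (real j / 2)) * r ^ (n * (2 * n - 1))
    = pi ^ n * (\<Prod>k<n. r / sqrt pi * ((r\<^sup>2 / 2) ^ (2 * k) * fact (2 * k)))"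
proof (induction n)
  case (Suc n)
  have e: "Suc n * (2 * Suc n - 1) = n * (2 * n - 1) + (4 * n + 1)" by (cases n) auto
  have half: "real (2 * n + 1) / 2 = real n + 1 / 2" "real (2 * n + 2) / 2 = real n + 1" by (simp_all add: field_simps)
  have "(\<Prod>j=1..2 * Suc n. Gamma (real j / 2)) = (\<Prod>j=1..2 * n. Gamma (real j / 2)) * (Gamma (real (2 * n + 1) / 2) * Gamma (real (2 * n + 2) / 2))"
    by simp
  then have "(\<Prod>j=1..2 * Suc n. Gamma (real j / 2)) * r ^ (Suc n * (2 * Suc n - 1))
    = ((\<Prod>j=1..2 * n. Gamma (real j / 2)) * r ^ (n * (2 * n - 1))) * (sqrt pi * fact (2 * n) / 4 ^ n * r ^ (4 * n + 1))"
    unfolding half Gamma_half_mult e power_add by simp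
  also have "sqrt pi * fact (2 * n) / 4 ^ n * r ^ (4 * n + 1) = pi * (r / sqrt pi * ((r\<^sup>2 / 2) ^ (2 * n) * fact (2 * n)))"
  proof -
    have "(r\<^sup>2 / 2) ^ (2 * n) = r ^ (4 * n) / 4 ^ n"
      by (simp add: power_divide power_mult[symmetric]) (simp add: power_mult)
    moreover have "pi / sqrt pi = sqrt pi" by (simp add: real_div_sqrt)
    ultimately show ?thesis by (simp add: field_simps)
  qed
  finally show ?case unfolding Suc by simp
qed simp

text \<open>The entrance constant is the reciprocal of the pfaffian of \<open>A0\<close> for monic
  polynomials.\<close>

lemma entrance_const_normalization:
  assumes "0 < s" "0 < T" "even N"
  shows "entrance_const N T s * ((\<Prod>i<N. (s / T) ^ i) * (\<Prod>k<N div 2. sqrt (T / pi) * ((T / 2) ^ (2 * k) * fact (2 * k)))) = 1"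
proof -
  obtain n where N: "N = 2 * n" using assms(3) by blast
  \<comment> \<open>The integer \<open>N * (N - 1) / 2\<close>, which turns the real powers of
    \<open>entrance_const\<close> into natural ones.\<close>
  define K where "K = n * (2 * n - 1)"
  define r where "r = sqrt T"
  have r: "0 < r" "r\<^sup>2 = T" using assms by (auto simp: r_def)
  have K: "real N * (real N - 1) / 2 = real K" unfolding N K_def by (cases n) (auto simp: field_simps)
  have "(\<Sum>i<N. i) = K"
    using Sum_Ico_nat[of 0 N] by (simp add: lessThan_atLeast0 N K_def)
  then have sT: "(\<Prod>i<N. (s / T) ^ i) = (s / T) ^ K" by (simp add: power_sum[symmetric])
  have "T powr (real N * (real N - 1) / 4) = r powr (real K)"
  proof -
    have q: "real N * (real N - 1) / 4 = real K / 2" using K by simp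
    have "T = r powr 2" using r by simp
    then have "T powr (real K / 2) = r powr (2 * (real K / 2))" by (simp only: powr_powr)
    then show ?thesis unfolding q by simp
  qed
  then have Tp: "T powr (real N * (real N - 1) / 4) = r ^ K" using r by (simp add: powr_realpow)
  have sp: "s powr (- (real N * (real N - 1) / 2)) = 1 / s ^ K"
    unfolding K using assms by (simp add: powr_minus powr_realpow divide_inverse)
  have pp: "pi powr (real N / 2) = pi ^ n" unfolding N by (simp add: powr_realpow)
  let ?G = "\<Prod>j=1..N. Gamma (real j / 2) :: real" and ?Q = "\<Prod>k<n. r / sqrt pi * ((r\<^sup>2 / 2) ^ (2 * k) * fact (2 * k))"
  have G: "?G > 0" by (intro prod_pos Gamma_real_pos) auto
  have Q: "(\<Prod>k<N div 2. sqrt (T / pi) * ((T / 2) ^ (2 * k) * fact (2 * k))) = ?Q"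
    unfolding N r by (simp add: r_def real_sqrt_divide)
  have GQ: "?G * r ^ K = pi ^ n * ?Q" using prod_Gamma_halves[OF r(1), of n] unfolding N K_def .
  have "r ^ K * r ^ K = T ^ K" unfolding r(2)[symmetric] power2_eq_square power_mult_distrib ..
  moreover have "entrance_const N T s * ((s / T) ^ K * ?Q) = (pi ^ n * ?Q) * r ^ K / (?G * T ^ K)"
    unfolding entrance_const_def Tp sp pp using assms G by (simp add: power_divide field_simps)
  ultimately have "entrance_const N T s * ((s / T) ^ K * ?Q) = (?G * T ^ K) / (?G * T ^ K)"
    unfolding GQ[symmetric] by (simp add: mult_ac)
  moreover have ne: "?G * T ^ K \<noteq> 0" using G assms(2) by (metis less_irrefl mult_eq_0_iff zero_less_power)
  ultimately show ?thesis unfolding sT Q using divide_self[OF ne] by metis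
qed

section \<open>The correlation functions\<close>

context sign_function begin

text \<open>Each pair brings one factor \<open>c\<close>, and each index occurs in exactly one pair.
  This absorbs the signs by which \<open>A_matrix\<close> differs from
  \<open>kernel\<close>.\<close>

lemma pf_scale:
  assumes "finite S" "even (card S)" "skew_on S a"
  shows "pf e (\<lambda>p q. c * s p * s q * a p q) S = c ^ (card S div 2) * (\<Prod>p\<in>S. s p) * pf e a S"
  using assms
proof (induction "card S" arbitrary: S rule: less_induct)
  case less
  let ?b = "\<lambda>p q. c * s p * s q * a p q"
  have b: "skew_on S ?b"
  proof (rule skew_onI)
    fix p q assume "p \<in> S" "q \<in> S" "p \<noteq> q"
    then have "a q p = - a p q" by (rule skew_onD[OF less.prems(3)])
    then show "c * s q * s p * a q p = - (c * s p * s q * a p q)" by simp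
  qed
  show ?case
  proof (cases "S = {}")
    case False
    then obtain p where p: "p \<in> S" by auto
    have "card S > 0" using p less.prems(1) by (metis card_gt_0_iff empty_iff)
    then have c2: "card S - 2 < card S" "2 \<le> card S" using less.prems(2) by (auto elim!: evenE)
    have IH: "pf e ?b (S - {p, q}) = c ^ (card S div 2 - 1) * (\<Prod>r\<in>S - {p, q}. s r) * pf e a (S - {p, q})" if q: "q \<in> S - {p}" for q
    proof -
      have c: "card (S - {p, q}) = card S - 2" using q p less.prems(1) by (intro card_minus_two) auto
      have "pf e ?b (S - {p, q}) = c ^ (card (S - {p, q}) div 2) * (\<Prod>r\<in>S - {p, q}. s r) * pf e a (S - {p, q})"
        by (rule less.hyps[OF _ _ _ skew_on_subset[OF less.prems(3)]]) (use c c2 less.prems(1,2) in auto)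
      moreover have "(card S - 2) div 2 = card S div 2 - 1" by simp
      ultimately show ?thesis unfolding c by simp
    qed
    have "pf e ?b S = (\<Sum>q\<in>S - {p}. psgn e S p q * ?b p q * pf e ?b (S - {p, q}))"
      by (rule pf_expand[OF less.prems(1,2) b p])
    also have "\<dots> = (\<Sum>q\<in>S - {p}. c ^ (card S div 2) * (\<Prod>r\<in>S. s r) * (psgn e S p q * a p q * pf e a (S - {p, q})))"
    proof (rule sum.cong)
      fix q assume q: "q \<in> S - {p}"
      have "(\<Prod>r\<in>S. s r) = s p * (\<Prod>r\<in>S - {p}. s r)"
        by (rule prod.remove[OF less.prems(1) p])
      moreover have "(\<Prod>r\<in>S - {p}. s r) = s q * (\<Prod>r\<in>S - {p} - {q}. s r)"
        by (rule prod.remove[OF _ q]) (use less.prems(1) in simp)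
      moreover have "S - {p} - {q} = S - {p, q}" by auto
      ultimately have S: "(\<Prod>r\<in>S. s r) = s p * (s q * (\<Prod>r\<in>S - {p, q}. s r))" by simp
      have "c ^ (card S div 2) = c * c ^ (card S div 2 - 1)"
        using c2(2) by (cases "card S div 2") auto
      then show "psgn e S p q * ?b p q * pf e ?b (S - {p, q}) = c ^ (card S div 2) * (\<Prod>r\<in>S. s r) * (psgn e S p q * a p q * pf e a (S - {p, q}))"
        unfolding IH[OF q] S by (simp only: mult_ac)
    qed simp
    also have "\<dots> = c ^ (card S div 2) * (\<Prod>r\<in>S. s r) * pf e a S"
      unfolding sum_distrib_left[symmetric] pf_expand[OF less.prems p] ..
    finally show ?thesis .
  qed simp
qed

end

lemma set_block_indices: "set (block_indices M n) = (SIGMA \<mu>:{1..M+1}. {..<n \<mu>})"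
  by (force simp: block_indices_def simp del: upt_Suc)

definition lex2 :: "nat \<times> nat \<Rightarrow> nat \<times> nat \<Rightarrow> bool" where
  "lex2 p q \<longleftrightarrow> fst p < fst q \<or> fst p = fst q \<and> snd p < snd q"

lemma sorted_block_indices: "sorted_wrt lex2 (block_indices M n)"
proof -
  have *: "sorted_wrt lex2 (concat (map (\<lambda>\<mu>. map (Pair \<mu>) [0..<n \<mu>]) [1..<m]))" for m
  proof (induction m)
    case (Suc m)
    show ?case
    proof (cases "m = 0")
      case False
      have "sorted_wrt lex2 (map (Pair m) [0..<n m])"
        by (simp add: sorted_wrt_map lex2_def)
      moreover have "lex2 p q" if "p \<in> set (concat (map (\<lambda>\<mu>. map (Pair \<mu>) [0..<n \<mu>]) [1..<m]))"
        "q \<in> set (map (Pair m) [0..<n m])" for p q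
        using that by (auto simp: lex2_def)
      moreover have "concat (map (\<lambda>\<mu>. map (Pair \<mu>) [0..<n \<mu>]) [1..<Suc m])
        = concat (map (\<lambda>\<mu>. map (Pair \<mu>) [0..<n \<mu>]) [1..<m]) @ map (Pair m) [0..<n m]"
        using False by simp
      ultimately show ?thesis using Suc by (simp only: sorted_wrt_append) blast
    qed simp
  qed simp
  show ?thesis using *[of "M + 2"] unfolding block_indices_def by (simp del: upt_Suc)
qed

lemma length_block_indices: "length (block_indices M n) = (\<Sum>\<mu>=1..M+1. n \<mu>)"
proof -
  have "distinct (block_indices M n)"
    unfolding distinct_conv_nth
  proof (intro allI impI)
    fix i j assume ij: "i < length (block_indices M n)" "j < length (block_indices M n)" "i \<noteq> j"
    have "lex2 (block_indices M n ! i) (block_indices M n ! j) \<or> lex2 (block_indices M n ! j) (block_indices M n ! i)"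
      using sorted_wrt_nth_less[OF sorted_block_indices] ij by (metis linorder_neqE_nat)
    then show "block_indices M n ! i \<noteq> block_indices M n ! j" by (auto simp: lex2_def)
  qed
  then have "length (block_indices M n) = card (SIGMA \<mu>:{1..M+1}. {..<n \<mu>})"
    using distinct_card set_block_indices by metis
  then show ?thesis by simp
qed

section \<open>Inverting \<open>A0\<close> and eliminating the \<open>Phi\<close> indices\<close>

context noncolliding_setting begin

abbreviation "Ainv \<equiv> A0_inv N M P t"

lemma A0_carrier: "A0 N M P t \<in> carrier_mat N N"
  by (simp add: A0_def)

lemma entrance_const_pf_A0:
  "entrance_const N (t (M + 1)) (t 1) * pf nat_sgn (\<lambda>i j. A0 N M P t $$ (i, j)) {..<N} = (\<Prod>i<N. coeff (P i) i)"
proof -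
  have eq: "entrance_const N (t (M + 1)) (t 1) * pf nat_sgn (\<lambda>i j. A0 N M P t $$ (i, j)) {..<N}
    = (\<Prod>i<N. coeff (P i) i) * (entrance_const N (t (M + 1)) (t 1) * ((\<Prod>i<N. (t 1 / t (M + 1)) ^ i)
      * (\<Prod>k<N div 2. sqrt (t (M + 1) / pi) * ((t (M + 1) / 2) ^ (2 * k) * fact (2 * k)))))"
    unfolding pf_A0 prod.distrib[of "\<lambda>i. coeff (P i) i"] by (simp only: mult_ac)
  have "0 < t (M + 1)" by (rule t_pos) auto
  from entrance_const_normalization[OF t1_pos this N(2)] show ?thesis
    unfolding eq by (simp only: mult_1_right)
qed

lemma pf_A0_nonzero: "pf nat_sgn (\<lambda>i j. A0 N M P t $$ (i, j)) {..<N} \<noteq> 0"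
proof -
  have "(\<Prod>i<N. coeff (P i) i) \<noteq> 0" using degP by simp
  then show ?thesis using entrance_const_pf_A0 by auto
qed

lemma skew_A0: "skew_on {..<N} (\<lambda>i j. A0 N M P t $$ (i, j))"
  by (rule skew_onI) (auto intro: A0_antisym)

text \<open>A null vector of \<open>A0\<close> is, by antisymmetry, a linear relation between its
  rows, which would make the pfaffian vanish.\<close>

lemma det_A0_nonzero: "Determinant.det (A0 N M P t) \<noteq> 0"
proof
  assume "Determinant.det (A0 N M P t) = 0"
  then obtain v where v: "v \<in> carrier_vec N" "v \<noteq> 0\<^sub>v N" "A0 N M P t *\<^sub>v v = 0\<^sub>v N"
    using det_0_iff_vec_prod_zero[OF A0_carrier] by auto
  obtain p where p: "p < N" "v $ p \<noteq> 0"
  proof (rule ccontr)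
    assume "\<not> thesis"
    then have "v = 0\<^sub>v N" using v(1) that by (intro eq_vecI) auto
    then show False using v by simp
  qed
  interpret n: sign_function nat_sgn by (rule nat_sgn_sign_function)
  have "pf nat_sgn (\<lambda>i j. A0 N M P t $$ (i, j)) {..<N} = 0"
  proof (rule n.pf_degenerate[where p = p and v = "\<lambda>i. v $ i"])
    show "A0 N M P t $$ (i, i) = 0" if "i \<in> {..<N}" for i using A0_antisym[of i i] that by simp
    show "(\<Sum>j\<in>{..<N}. v $ j * A0 N M P t $$ (j, s)) = 0" if s: "s \<in> {..<N}" for s
    proof -
      have "0 = (A0 N M P t *\<^sub>v v) $ s" using v(3) s by simp
      also have "\<dots> = (\<Sum>j<N. A0 N M P t $$ (s, j) * v $ j)"
        using s v(1) A0_carrier by (simp add: scalar_prod_def lessThan_atLeast0)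
      also have "\<dots> = (\<Sum>j<N. - (v $ j * A0 N M P t $$ (j, s)))"
      proof (rule sum.cong)
        fix j assume "j \<in> {..<N}"
        then have "A0 N M P t $$ (s, j) = - A0 N M P t $$ (j, s)" using s by (intro A0_antisym) auto
        then show "A0 N M P t $$ (s, j) * v $ j = - (v $ j * A0 N M P t $$ (j, s))" by simp
      qed simp
      finally show ?thesis by (simp add: sum_negf)
    qed
  qed (use p N skew_A0 in auto)
  then show False using pf_A0_nonzero by simp
qed

lemma Ainv: "Ainv \<in> carrier_mat N N" "A0 N M P t * Ainv = 1\<^sub>m N" "Ainv * A0 N M P t = 1\<^sub>m N"
proof -
  have "A0 N M P t \<in> Units (ring_mat TYPE(real) N ())"
    by (rule det_non_zero_imp_unit[OF A0_carrier det_A0_nonzero])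
  then obtain B where B: "mat_inverse (A0 N M P t) = Some B"
    using mat_inverse(1)[OF A0_carrier, where b = "()"] by (cases "mat_inverse (A0 N M P t)") auto
  then have "Ainv = B" by (simp add: A0_inv_def)
  then show "Ainv \<in> carrier_mat N N" "A0 N M P t * Ainv = 1\<^sub>m N" "Ainv * A0 N M P t = 1\<^sub>m N"
    using mat_inverse(2)[OF A0_carrier B] by auto
qed

lemma Ainv_A0_sum:
  assumes "k < N" "j < N"
  shows "(\<Sum>i<N. Ainv $$ (k, i) * A0 N M P t $$ (i, j)) = (if k = j then 1 else 0)"
proof -
  have "(Ainv * A0 N M P t) $$ (k, j) = (\<Sum>i<N. Ainv $$ (k, i) * A0 N M P t $$ (i, j))"
    using assms Ainv(1) A0_carrier by (simp add: scalar_prod_def lessThan_atLeast0)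
  then show ?thesis using Ainv(3) assms by simp
qed

text \<open>Minus the transpose of the inverse is again a left inverse of the antisymmetric
  \<open>A0\<close>, hence equal to the inverse.\<close>

lemma Ainv_antisym:
  assumes "i < N" "j < N"
  shows "Ainv $$ (j, i) = - Ainv $$ (i, j)"
proof -
  let ?A = "A0 N M P t" and ?B = "Ainv" and ?C = "- transpose_mat Ainv"
  have C: "?C \<in> carrier_mat N N" using Ainv(1) by simp
  have tA: "transpose_mat ?A = - ?A"
  proof (rule eq_matI)
    fix i j assume "i < dim_row (- ?A)" "j < dim_col (- ?A)"
    then have ij: "i < N" "j < N" using A0_carrier by auto
    then show "transpose_mat ?A $$ (i, j) = (- ?A) $$ (i, j)"
      using A0_carrier A0_antisym[OF ij] by simp
  qed (use A0_carrier in auto)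
  have "transpose_mat (?A * ?B) = transpose_mat ?B * transpose_mat ?A"
    by (rule transpose_mult[OF A0_carrier Ainv(1)])
  then have "1\<^sub>m N = transpose_mat ?B * (- ?A)" unfolding Ainv(2) tA by simp
  also have "\<dots> = ?C * ?A"
    using Ainv(1) A0_carrier by simp
  finally have CA: "?C * ?A = 1\<^sub>m N" by simp
  have "?C = ?C * (?A * ?B)" using C Ainv(2) by simp
  also have "\<dots> = (?C * ?A) * ?B" by (rule assoc_mult_mat[symmetric, OF C A0_carrier Ainv(1)])
  also have "\<dots> = ?B" using Ainv(1) by (simp add: CA)
  finally have "?B $$ (j, i) = ?C $$ (j, i)" by simp
  then show ?thesis using assms Ainv(1) by simp
qed

definition pt_idxs :: "(nat \<Rightarrow> nat) \<Rightarrow> idx set" where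
  "pt_idxs n = case_prod One ` pts n \<union> case_prod Pt ` pts n"

lemma pt_idxs_iff [simp]:
  "Phi i \<notin> pt_idxs n"
  "One \<mu> k \<in> pt_idxs n \<longleftrightarrow> 1 \<le> \<mu> \<and> \<mu> \<le> M + 1 \<and> k < n \<mu>"
  "Pt \<mu> k \<in> pt_idxs n \<longleftrightarrow> 1 \<le> \<mu> \<and> \<mu> \<le> M + 1 \<and> k < n \<mu>"
  by (auto simp: pt_idxs_def pts_def image_iff)

lemma finite_pt_idxs: "finite (pt_idxs n)" by (simp add: pt_idxs_def finite_pts)

lemma idxs_split: "idxs n = Phi ` {..<N} \<union> pt_idxs n"
  by (simp add: idxs_def pt_idxs_def Un_assoc)

lemma card_pt_idxs: "card (pt_idxs n) = 2 * card (pts n)"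
proof -
  have "card (pt_idxs n) = card (case_prod One ` pts n) + card (case_prod Pt ` pts n)"
    unfolding pt_idxs_def by (rule card_Un_disjoint) (auto simp: finite_pts)
  also have "card (case_prod One ` pts n) = card (pts n)" by (rule card_image) (auto simp: inj_on_def)
  also have "card (case_prod Pt ` pts n) = card (pts n)" by (rule card_image) (auto simp: inj_on_def)
  finally show ?thesis by simp
qed

text \<open>The Schur complement of the block \<open>A0\<close> in \<open>form\<close>.\<close>

definition kernel :: "(nat \<Rightarrow> nat \<Rightarrow> real) \<Rightarrow> idx \<Rightarrow> idx \<Rightarrow> real" where
  "kernel x p q = form x p q - (\<Sum>i<N. \<Sum>j<N. form x p (Phi j) * Ainv $$ (j, i) * form x (Phi i) q)"

lemma kernel_antisym: "skew_on (pt_idxs n) (kernel x)"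
proof (rule skew_onI)
  fix p q assume pq: "p \<in> pt_idxs n" "q \<in> pt_idxs n" "p \<noteq> q"
  have f: "form x r (Phi j) = - form x (Phi j) r" if "r \<in> pt_idxs n" "j < N" for r j
    using that by (intro skew_onD[OF form_antisym[of n]]) (auto simp: idxs_split)
  have "form x q p = - form x p q"
    using pq by (intro skew_onD[OF form_antisym[of n]]) (auto simp: idxs_split)
  moreover have "(\<Sum>i<N. \<Sum>j<N. form x q (Phi j) * Ainv $$ (j, i) * form x (Phi i) p)
    = - (\<Sum>i<N. \<Sum>j<N. form x p (Phi j) * Ainv $$ (j, i) * form x (Phi i) q)"
  proof -
    have "(\<Sum>i<N. \<Sum>j<N. form x q (Phi j) * Ainv $$ (j, i) * form x (Phi i) p)
      = (\<Sum>i<N. \<Sum>j<N. - (form x p (Phi i) * Ainv $$ (i, j) * form x (Phi j) q))"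
    proof (intro sum.cong refl)
      fix i j assume ij: "i \<in> {..<N}" "j \<in> {..<N}"
      then show "form x q (Phi j) * Ainv $$ (j, i) * form x (Phi i) p = - (form x p (Phi i) * Ainv $$ (i, j) * form x (Phi j) q)"
        using f[OF pq(2), of j] f[OF pq(1), of i] Ainv_antisym[of i j] by simp
    qed
    also have "\<dots> = - (\<Sum>i<N. \<Sum>j<N. form x p (Phi i) * Ainv $$ (i, j) * form x (Phi j) q)"
      by (simp add: sum_negf)
    also have "(\<Sum>i<N. \<Sum>j<N. form x p (Phi i) * Ainv $$ (i, j) * form x (Phi j) q)
      = (\<Sum>i<N. \<Sum>j<N. form x p (Phi j) * Ainv $$ (j, i) * form x (Phi i) q)"
      by (rule sum.swap)
    finally show ?thesis .
  qed
  ultimately show "kernel x q p = - kernel x p q" by (simp add: kernel_def)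
qed

lemma pf_idxs_schur:
  "pf idx_sgn (form x) (idxs n) = pf nat_sgn (\<lambda>i j. A0 N M P t $$ (i, j)) {..<N} * pf idx_sgn (kernel x) (pt_idxs n)"
proof -
  interpret n: sign_function nat_sgn by (rule nat_sgn_sign_function)
  \<comment> \<open>The row operations that clear the columns of the \<open>Phi\<close> indices:
    \<open>c\<close> solves \<open>c A0 = - (row r)\<close> by means of \<open>Ainv\<close>.\<close>
  define c where "c r s = (case s of Phi i \<Rightarrow> - (\<Sum>j<N. form x r (Phi j) * Ainv $$ (j, i)) | _ \<Rightarrow> 0)" for r s
  have cs: "(\<Sum>s\<in>Phi ` {..<N}. c r s * form x s q) = - (\<Sum>i<N. \<Sum>j<N. form x r (Phi j) * Ainv $$ (j, i) * form x (Phi i) q)" for r q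
    by (subst sum.reindex) (auto simp: inj_on_def c_def sum_distrib_right sum_negf)
  have "pf idx_sgn (form x) (Phi ` {..<N} \<union> pt_idxs n) = pf idx_sgn (form x) (Phi ` {..<N}) * pf idx_sgn (kernel x) (pt_idxs n)"
  proof (rule idx.pf_schur[where c = c])
    show "skew_on (Phi ` {..<N} \<union> pt_idxs n) (form x)"
      unfolding idxs_split[symmetric] by (rule form_antisym)
    show "form x s s = 0" if "s \<in> Phi ` {..<N}" for s
    proof -
      obtain i where "s = Phi i" "i < N" using \<open>s \<in> _\<close> by auto
      then show ?thesis using A0_antisym[of i i] by simp
    qed
    show "form x r s + (\<Sum>u\<in>Phi ` {..<N}. c r u * form x u s) = 0" if r: "r \<in> pt_idxs n" and s: "s \<in> Phi ` {..<N}" for r s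
    proof -
      obtain k where k: "s = Phi k" "k < N" using s by auto
      have "(\<Sum>i<N. \<Sum>j<N. form x r (Phi j) * Ainv $$ (j, i) * form x (Phi i) s)
        = (\<Sum>j<N. \<Sum>i<N. form x r (Phi j) * Ainv $$ (j, i) * form x (Phi i) s)" by (rule sum.swap)
      also have "\<dots> = (\<Sum>j<N. form x r (Phi j) * (\<Sum>i<N. Ainv $$ (j, i) * A0 N M P t $$ (i, k)))"
        by (simp add: k sum_distrib_left mult.assoc)
      also have "\<dots> = (\<Sum>j<N. if j = k then form x r (Phi k) else 0)"
        by (rule sum.cong) (use Ainv_A0_sum k(2) in auto)
      also have "\<dots> = form x r s" using k by simp
      finally show ?thesis unfolding cs by simp
    qed
    show "kernel x r r' = form x r r' + (\<Sum>s\<in>Phi ` {..<N}. c r s * form x s r')" for r r'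
      unfolding cs kernel_def by simp
    show "idx_sgn r s = idx_sgn r' s" if "s \<in> Phi ` {..<N}" "r \<in> pt_idxs n" "r' \<in> pt_idxs n" for s r r'
      using that by (cases r; cases r') (auto simp: idx_sgn_def lex3_def)
  qed (use N kernel_antisym in \<open>auto simp: finite_pt_idxs card_pt_idxs card_image inj_on_def\<close>)
  also have "pf idx_sgn (form x) (Phi ` {..<N}) = pf nat_sgn (\<lambda>i j. A0 N M P t $$ (i, j)) {..<N}"
  proof (rule n.pf_relabel[symmetric])
    show "bij_betw Phi {..<N} (Phi ` {..<N})" by (auto simp: bij_betw_def inj_on_def)
    show "skew_on (Phi ` {..<N}) (form x)"
      by (rule skew_on_subset[OF form_antisym[of n]]) (auto simp: idxs_split)
  qed (use N idx_sgn_sign_function in \<open>auto simp: nat_sgn_def idx_sgn_def lex3_def\<close>)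
  finally show ?thesis unfolding idxs_split .
qed

lemma kernel_entries:
  "kernel x (One \<mu> k) (One \<nu> l) = - D_kernel N M P t \<mu> \<nu> (x \<mu> k) (x \<nu> l)"
  "kernel x (One \<mu> k) (Pt \<nu> l) = S_tilde N M P t \<nu> \<mu> (x \<nu> l) (x \<mu> k)"
  "kernel x (Pt \<mu> k) (One \<nu> l) = - S_tilde N M P t \<mu> \<nu> (x \<mu> k) (x \<nu> l)"
  "kernel x (Pt \<mu> k) (Pt \<nu> l) = I_tilde N M P t \<mu> \<nu> (x \<mu> k) (x \<nu> l)"
proof -
  have sw: "(\<Sum>i<N. \<Sum>j<N. f j * Ainv $$ (j, i) * g i) = (\<Sum>i<N. \<Sum>j<N. f i * Ainv $$ (i, j) * g j)" for f g
    by (rule sum.swap)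
  have fl: "(\<Sum>i<N. \<Sum>j<N. f j * Ainv $$ (j, i) * g i) = - (\<Sum>i<N. \<Sum>j<N. g i * Ainv $$ (i, j) * f j)" for f g
    unfolding sum_negf[symmetric]
  proof (intro sum.cong refl)
    fix i j assume "i \<in> {..<N}" "j \<in> {..<N}"
    then have "Ainv $$ (j, i) = - Ainv $$ (i, j)" by (intro Ainv_antisym) auto
    then show "f j * Ainv $$ (j, i) * g i = - (g i * Ainv $$ (i, j) * f j)" by simp
  qed
  show "kernel x (One \<mu> k) (One \<nu> l) = - D_kernel N M P t \<mu> \<nu> (x \<mu> k) (x \<nu> l)"
    using sw[of "\<lambda>j. phi' j \<mu> (x \<mu> k)" "\<lambda>i. phi' i \<nu> (x \<nu> l)"] by (simp add: kernel_def D_kernel_def sum_negf)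
  show "kernel x (One \<mu> k) (Pt \<nu> l) = S_tilde N M P t \<nu> \<mu> (x \<nu> l) (x \<mu> k)"
    using fl[of "\<lambda>j. phi' j \<mu> (x \<mu> k)" "\<lambda>i. psi' i \<nu> (x \<nu> l)"] by (simp add: kernel_def S_tilde_def S_kernel_def)
  show "kernel x (Pt \<mu> k) (One \<nu> l) = - S_tilde N M P t \<mu> \<nu> (x \<mu> k) (x \<nu> l)"
    using sw[of "\<lambda>j. psi' j \<mu> (x \<mu> k)" "\<lambda>i. phi' i \<nu> (x \<nu> l)"] by (simp add: kernel_def S_tilde_def S_kernel_def)
  show "kernel x (Pt \<mu> k) (Pt \<nu> l) = I_tilde N M P t \<mu> \<nu> (x \<mu> k) (x \<nu> l)"
    using sw[of "\<lambda>j. psi' j \<mu> (x \<mu> k)" "\<lambda>i. psi' i \<nu> (x \<nu> l)"] by (simp add: kernel_def I_tilde_def I_kernel_def sum_negf)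
qed

section \<open>Identification with the block matrix\<close>

definition pt_sign :: "idx \<Rightarrow> real" where
  "pt_sign p = (case p of Pt _ _ \<Rightarrow> -1 | _ \<Rightarrow> 1)"

definition position :: "(nat \<Rightarrow> nat) \<Rightarrow> nat \<Rightarrow> idx" where
  "position n a = (case block_indices M n ! (a div 2) of (\<mu>, k) \<Rightarrow> if even a then One \<mu> k else Pt \<mu> k)"

lemma A_matrix_entry:
  fixes n x
  defines "L \<equiv> (\<Sum>\<mu>=1..M+1. n \<mu>)"
  assumes "a < 2 * L" "b < 2 * L"
  shows "A_matrix N M P t n x $$ (a, b) = (-1) * pt_sign (position n a) * pt_sign (position n b) * kernel x (position n a) (position n b)"
proof -
  obtain \<mu> k where mk: "block_indices M n ! (a div 2) = (\<mu>, k)" by fastforce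
  obtain \<nu> l where nl: "block_indices M n ! (b div 2) = (\<nu>, l)" by fastforce
  have "A_matrix N M P t n x $$ (a, b) = A_block N M P t \<mu> \<nu> (x \<mu> k) (x \<nu> l) $$ (a mod 2, b mod 2)"
    using assms mk nl by (simp add: A_matrix_def Let_def)
  moreover have "c mod 2 = (if even c then 0 else 1)" for c :: nat by presburger
  ultimately show ?thesis
    by (cases "even a"; cases "even b")
      (simp_all add: position_def mk nl pt_sign_def kernel_entries A_block_def mat_of_rows_list_def)
qed

text \<open>\<open>A_matrix\<close> is \<open>kernel\<close> with a factor -1 for every pair and
  another for every \<open>Pt\<close> index. There are as many pairs as points, so the two powers of
  -1 cancel.\<close>

lemma pfaffian_A_matrix: "pfaffian (A_matrix N M P t n x) = pf idx_sgn (kernel x) (pt_idxs n)"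
proof -
  interpret n: sign_function nat_sgn by (rule nat_sgn_sign_function)
  define L where "L = (\<Sum>\<mu>=1..M+1. n \<mu>)"
  let ?A = "A_matrix N M P t n x" and ?bi = "block_indices M n"
  let ?K = "\<lambda>p q. (-1) * pt_sign p * pt_sign q * kernel x p q"
  have len: "length ?bi = L" unfolding L_def by (rule length_block_indices)
  have setb: "set ?bi = pts n" unfolding set_block_indices pts_def ..
  have lex: "lex2 (?bi ! i) (?bi ! j)" if "i < j" "j < L" for i j
    using sorted_wrt_nth_less[OF sorted_block_indices] that len by metis
  have K: "skew_on (pt_idxs n) ?K"
  proof (rule skew_onI)
    fix p q assume "p \<in> pt_idxs n" "q \<in> pt_idxs n" "p \<noteq> q"
    then have "kernel x q p = - kernel x p q" by (rule skew_onD[OF kernel_antisym])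
    then show "?K q p = - ?K p q" by simp
  qed
  have mem: "position n a \<in> pt_idxs n" if "a < 2 * L" for a
  proof -
    have "?bi ! (a div 2) \<in> pts n" unfolding setb[symmetric] using that len by (intro nth_mem) auto
    then show ?thesis by (auto simp: position_def pts_def split: prod.splits)
  qed
  \<comment> \<open>Positions increase with respect to \<open>idx_key\<close>: equal halves mean
    \<open>One\<close> before \<open>Pt\<close> of the same point, different halves follow the order
    of \<open>block_indices\<close>.\<close>
  have sgn: "idx_sgn (position n a) (position n b) = 1" if ab: "a < b" "b < 2 * L" for a b
  proof (cases "a div 2 = b div 2")
    case True
    then have "even a \<and> odd b" using ab by presburger
    then show ?thesis using True by (auto simp: position_def idx_sgn_def lex3_def split: prod.splits)
  next
    case False
    then have "a div 2 < b div 2" "b div 2 < L" using ab by auto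
    from lex[OF this] show ?thesis
      by (auto simp: position_def idx_sgn_def lex3_def lex2_def split: prod.splits)
  qed
  have inj: "inj_on (position n) {..<2 * L}"
  proof (rule linorder_inj_onI)
    fix a b assume ab: "a < b" "a \<in> {..<2 * L}" "b \<in> {..<2 * L}"
    show "position n a \<noteq> position n b"
    proof
      assume "position n a = position n b"
      then have "idx_sgn (position n a) (position n a) = 1" using sgn[of a b] ab by simp
      then show False by (auto simp: idx_sgn_def lex3_def split: prod.splits if_splits)
    qed
  qed auto
  have c: "card (pt_idxs n) = 2 * L" by (simp add: card_pt_idxs pts_def L_def)
  have bij: "bij_betw (position n) {..<2 * L} (pt_idxs n)"
    unfolding bij_betw_def
  proof
    show "position n ` {..<2 * L} = pt_idxs n"
      using mem c card_image[OF inj] by (intro card_subset_eq finite_pt_idxs) auto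
  qed (rule inj)
  have entry: "?A $$ (a, b) = ?K (position n a) (position n b)" if "a < 2 * L" "b < 2 * L" for a b
    using A_matrix_entry that unfolding L_def by blast
  have "skew_on {..<2 * L} (\<lambda>a b. ?A $$ (a, b))"
  proof (rule skew_onI)
    fix a b assume ab: "a \<in> {..<2 * L}" "b \<in> {..<2 * L}" "a \<noteq> b"
    then have "?K (position n b) (position n a) = - ?K (position n a) (position n b)"
      using inj by (intro skew_onD[OF K] mem) (auto dest: inj_onD)
    then show "?A $$ (b, a) = - ?A $$ (a, b)" using ab entry by simp
  qed
  then have "pfaffian ?A = pf nat_sgn (\<lambda>a b. ?A $$ (a, b)) {..<2 * L}"
    by (intro pfaffian_eq_pf) (simp_all add: A_matrix_def L_def Let_def)
  also have "\<dots> = pf idx_sgn ?K (pt_idxs n)"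
  proof (rule n.pf_relabel[OF bij _ _ K idx_sgn_sign_function])
    show "?A $$ (a, b) = ?K (position n a) (position n b)" if "a \<in> {..<2 * L}" "b \<in> {..<2 * L}" for a b
      using entry that by simp
    show "nat_sgn a b = idx_sgn (position n a) (position n b)" if "a \<in> {..<2 * L}" "b \<in> {..<2 * L}" "a \<noteq> b" for a b
    proof (cases "a < b")
      case True
      then show ?thesis using sgn that by (simp add: nat_sgn_def)
    next
      case False
      have "position n b \<noteq> position n a" using inj_on_eq_iff[OF inj] that by auto
      then show ?thesis using idx.e_anti[of "position n b" "position n a"] sgn[of b a] that False by (simp add: nat_sgn_def)
    qed
  qed auto
  also have "\<dots> = (-1) ^ (card (pt_idxs n) div 2) * (\<Prod>p\<in>pt_idxs n. pt_sign p) * pf idx_sgn (kernel x) (pt_idxs n)"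
    by (rule idx.pf_scale[OF finite_pt_idxs _ kernel_antisym]) (simp add: card_pt_idxs)
  also have "(\<Prod>p\<in>pt_idxs n. pt_sign p) = (-1) ^ card (pts n)"
  proof -
    have "(\<Prod>p\<in>pt_idxs n. pt_sign p) = (\<Prod>p\<in>case_prod One ` pts n. pt_sign p) * (\<Prod>p\<in>case_prod Pt ` pts n. pt_sign p)"
      unfolding pt_idxs_def by (rule prod.union_disjoint) (auto simp: finite_pts)
    also have "(\<Prod>p\<in>case_prod One ` pts n. pt_sign p) = 1" by (rule prod.neutral) (auto simp: pt_sign_def)
    also have "(\<Prod>p\<in>case_prod Pt ` pts n. pt_sign p) = (\<Prod>p\<in>case_prod Pt ` pts n. -1)"
      by (rule prod.cong) (auto simp: pt_sign_def)
    also have "\<dots> = (-1) ^ card (case_prod Pt ` pts n)" by simp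
    also have "card (case_prod Pt ` pts n) = card (pts n)" by (rule card_image) (auto simp: inj_on_def)
    finally show ?thesis by simp
  qed
  finally show ?thesis unfolding card_pt_idxs by (simp flip: power_add power_mult_distrib)
qed

text \<open>All constants cancel: the factorials from the integration against those in
  \<open>correlation_function\<close>, and the entrance constant and the leading coefficients
  against the pfaffian of \<open>A0\<close>.\<close>

theorem correlation_eq_pfaffian:
  assumes "\<And>\<mu>. \<mu> \<in> {1..M+1} \<Longrightarrow> n \<mu> \<le> N"
  shows "correlation_function N (t (M + 1)) M t n x = pfaffian (A_matrix N M P t n x)"
proof -
  let ?C = "entrance_const N (t (M + 1)) (t 1) / (\<Prod>i<N. coeff (P i) i)"
  let ?F = "\<Prod>\<mu>=1..M+1. fact (N - n \<mu>) :: real"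
  have F: "?F \<noteq> 0" by simp
  have b: "(\<Prod>i<N. coeff (P i) i) \<noteq> 0" using degP by simp
  have m: "multi_time_density N (t (M + 1)) M t (\<lambda>\<mu> i. if i < n \<mu> then x \<mu> i else z (\<mu>, i)) = ?C * full_weight (comb n x z)" for z
    unfolding multi_time_density_eq[OF refl] comb_def[abs_def] ..
  have I: "(\<integral>z. full_weight (comb n x z) \<partial>PiM (free n) (\<lambda>_. lborel)) = ?F * pf idx_sgn (form x) (idxs n)"
    by (rule integral_full_weight) (rule assms)
  have "correlation_function N (t (M + 1)) M t n x
    = (\<Prod>\<mu>=1..M+1. 1 / fact (N - n \<mu>)) * (?C * (\<integral>z. full_weight (comb n x z) \<partial>PiM (free n) (\<lambda>_. lborel)))"
    unfolding correlation_function_def m free_def[symmetric] by (simp only: integral_mult_right_zero)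
  also have "\<dots> = (1 / ?F) * (?C * (?F * (pf nat_sgn (\<lambda>i j. A0 N M P t $$ (i, j)) {..<N} * pf idx_sgn (kernel x) (pt_idxs n))))"
    unfolding I pf_idxs_schur by (simp only: prod_dividef prod.neutral_const)
  also have "\<dots> = (entrance_const N (t (M + 1)) (t 1) * pf nat_sgn (\<lambda>i j. A0 N M P t $$ (i, j)) {..<N}) / (\<Prod>i<N. coeff (P i) i) * pf idx_sgn (kernel x) (pt_idxs n)"
    using F by (simp add: field_simps)
  also have "\<dots> = pf idx_sgn (kernel x) (pt_idxs n)" unfolding entrance_const_pf_A0 using b by simp
  finally show ?thesis unfolding pfaffian_A_matrix .
qed

end

theorem theorem1:
  fixes N M :: nat and T :: real
    and t :: "nat \<Rightarrow> real"
    and n :: "nat \<Rightarrow> nat"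
    and x :: "nat \<Rightarrow> nat \<Rightarrow> real"
    and P :: "nat \<Rightarrow> real poly"
  assumes "N \<ge> 2" and "even N" and "T > 0" and "M \<ge> 1"
    and "t 0 = 0" and "strict_mono_on {0..M+1} t" and "t (M + 1) = T"
    and "\<And>\<mu>. \<mu> \<in> {1..M+1} \<Longrightarrow> n \<mu> \<in> {1..N}"
    and "\<And>i. i < N \<Longrightarrow> degree (P i) = i \<and> coeff (P i) i \<noteq> 0"
  shows "correlation_function N T M t n x = pfaffian (A_matrix N M P t n x)"
proof -
  interpret noncolliding_setting N M t P by unfold_locales (use assms in auto)
  show ?thesis using correlation_eq_pfaffian[of n x] assms(7,8) by auto
qed

end
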